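(* Let $L$ be a positive integer and let $\mathcal M\subset\mathcal C_L$ be a symmetric finite subset of cardinality $N>L$. Let $a=a(\mathcal M)$, $b=b(\mathcal M)$ and $\vec a_{ij}=\vec a_{ij}(\mathcal M)$ be as defined in the context. Then the following hold. (a) The space $V(\mathcal M)$ is ample if and only if $a\neq b$. (b) Suppose that the vectors $\vec a_{ij}$, $1\le i\le j\le L$, are linearly independent. Then $$\mu(\mathcal M)=\frac{1}{(2\pi)^{\frac12\binom L2}(a-b)^{\frac{L-1}{2}}\big(a+(L-1)b\big)^{1/2}(\det C)^{1/2}}\int_{\mathrm{Sym}_L}e^{-\frac12\langle C^{-1}X,X\rangle}\,|\det X|\,|dX|.$$ Here $\mathrm{Sym}_L$ is the space of real symmetric $L\times L$ matrices with the inner product $\langle-,-\rangle$ for which $(H_{ij})_{1\le i\le j\le L}$ is an orthonormal basis, where $H_{ij}$ is the symmetric matrix whose only nonzero entries are in positions $(i,j)$ and $(j,i)$ and are equal to $1$. For $X=\sum_{i\le j}x_{ij}H_{ij}$ we set $|dX|=\left|\prod_{i\le j}dx_{ij}\right|$. The symmetric linear operator $C:\mathrm{Sym}_L\to\mathrm{Sym}_L$ is given in the orthonormal basis $(H_{ij})$ by the matrix $$C_{ij;k\ell}=(\vec a_{ij},\vec a_{k\ell})=\frac{2}{(2\pi)^L}\sum_{\vec m\in\mathcal M}m_im_jm_km_\ell .$$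
   Context: $\mathbb T^L=\mathbb R^L/(2\pi\mathbb Z)^L$ carries the flat metric, with angular coordinates $\theta_1,\dots,\theta_L$. For $\vec m,\vec n\in\mathbb Z^L$ write $\vec m\prec\vec n$ if the first nonzero entry of $\vec n-\vec m$ is positive, and let $\mathcal C_L=\{\vec m\in\mathbb Z^L:\vec 0\prec\vec m\}$. For $\vec m\in\mathcal C_L$ put $$A_{\vec m}=\frac{2^{1/2}}{(2\pi)^{L/2}}\cos\Big(\sum_j m_j\theta_j\Big),\qquad B_{\vec m}=\frac{2^{1/2}}{(2\pi)^{L/2}}\sin\Big(\sum_j m_j\theta_j\Big).$$ A finite set $\mathcal M\subset\mathcal C_L$ is symmetric if for any permutation $\varphi$ of $\{1,\dots,L\}$ one has $(m_1,\dots,m_L)\in\mathcal M\iff(m_{\varphi(1)},\dots,m_{\varphi(L)})\in\mathcal M\cup(-\mathcal M)$. $V(\mathcal M)=\mathrm{span}\{A_{\vec m},B_{\vec m}:\vec m\in\mathcal M\}\subset C^\infty(\mathbb T^L)$, with the $L^2(\mathbb T^L)$ inner product $(-,-)$. Define $$a_{jk}=\frac{2}{(2\pi)^L}\sum_{\vec m\in\mathcal M}m_jm_k,\qquad \vec a_{jk}=-\frac{2^{1/2}}{(2\pi)^{L/2}}\sum_{\vec m\in\mathcal M}m_jm_k\,A_{\vec m}\in V(\mathcal M).$$ If $\mathcal M$ is symmetric then $a_{jj}$ is independent of $j$ and its value is denoted $a(\mathcal M)$; also $a_{jk}$ with $j\ne k$ is independent of $j\neq k$ and its value is denoted $b(\mathcal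 M)$. (When $L=1$ there is no pair $j\ne k$; read $b=0$.) $V(\mathcal M)$ is ample if for every $x\in\mathbb T^L$ the map $V(\mathcal M)\to T^*_x\mathbb T^L$, $v\mapsto d_xv$, is surjective. $\mu(\mathcal M)=\frac{1}{\mathrm{area}(S)}\int_{S}\mu(v)\,|dS(v)|$, where $S$ is the unit sphere of $V(\mathcal M)$ and $\mu(v)$ is the number of critical points of $v$ on $\mathbb T^L$.
   Formalization: Part (a) is false as printed: for L=2, M={(1,-1),(2,-2),(3,-3)} has a≠b but V(M) is not ample. The formal (a) says V(M) is ample iff a≠b and a+(L-1)b≠0. Symmetry of M is required for m in C_L, since over all of Z^L it would force M to be empty. *)

theory Defs
  imports "HOL-Analysis.Analysis"
begin

text \<open>
  The dimension \<open>L\<close> is \<open>CARD('n)\<close>, where the coordinates are indexed by a finite linearly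
  ordered type \<open>'n\<close>.  A function on the torus is represented by its periodic lift to
  \<open>real ^ 'n\<close>, and the points of the torus by their representatives in the half-open box below,
  which contains exactly one representative of each coset of \<open>(2\<pi>\<int>)\<^sup>L\<close>.
\<close>

definition torus :: "(real ^ 'n::finite) set" where
  "torus = {\<theta>. \<forall>j. 0 \<le> \<theta> $ j \<and> \<theta> $ j < 2 * pi}"

definition l2_inner :: "(real ^ 'n::finite \<Rightarrow> real) \<Rightarrow> (real ^ 'n \<Rightarrow> real) \<Rightarrow> real" where
  "l2_inner f g = (LINT \<theta>:torus|lborel. f \<theta> * g \<theta>)"

definition vec_prec :: "int ^ 'n::{finite,linorder} \<Rightarrow> int ^ 'n::{finite,linorder} \<Rightarrow> bool" where
  "vec_prec m n \<longleftrightarrow> (\<exists>i. (\<forall>j<i. (n - m) $ j = 0) \<and> 0 < (n - m) $ i)"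

definition pos_cone :: "(int ^ 'n::{finite,linorder}) set" where
  "pos_cone = {m. vec_prec 0 m}"

definition A_fun :: "int ^ 'n::finite \<Rightarrow> real ^ 'n \<Rightarrow> real" where
  "A_fun m \<theta> = sqrt 2 / (2 * pi) powr (real CARD('n) / 2) * cos (\<Sum>j\<in>UNIV. of_int (m $ j) * \<theta> $ j)"

definition B_fun :: "int ^ 'n::finite \<Rightarrow> real ^ 'n \<Rightarrow> real" where
  "B_fun m \<theta> = sqrt 2 / (2 * pi) powr (real CARD('n) / 2) * sin (\<Sum>j\<in>UNIV. of_int (m $ j) * \<theta> $ j)"

text \<open>
  The equivalence is required for \<open>m\<close> in the cone: for \<open>m\<close> ranging over all of \<open>\<int>\<^sup>L\<close> the identity
  permutation would force \<open>-M \<subseteq> M\<close>, which is impossible for a nonempty subset of the cone.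
\<close>

definition symmetric_set :: "(int ^ 'n::{finite,linorder}) set \<Rightarrow> bool" where
  "symmetric_set M \<longleftrightarrow>
     (\<forall>\<phi>. bij \<phi> \<longrightarrow> (\<forall>m\<in>pos_cone. m \<in> M \<longleftrightarrow> (\<chi> j. m $ \<phi> j) \<in> M \<union> uminus ` M))"

definition trig_comb :: "(int ^ 'n::finite) set \<Rightarrow> (int ^ 'n \<Rightarrow> real \<times> real) \<Rightarrow> real ^ 'n \<Rightarrow> real" where
  "trig_comb M c \<theta> = (\<Sum>m\<in>M. fst (c m) * A_fun m \<theta> + snd (c m) * B_fun m \<theta>)"

definition trig_space :: "(int ^ 'n::finite) set \<Rightarrow> (real ^ 'n \<Rightarrow> real) set" where
  "trig_space M = range (trig_comb M)"

definition a_coef :: "(int ^ 'n::finite) set \<Rightarrow> 'n \<Rightarrow> 'n \<Rightarrow> real" where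
  "a_coef M j k = 2 / (2 * pi) ^ CARD('n) * (\<Sum>m\<in>M. of_int (m $ j * m $ k))"

definition a_vec :: "(int ^ 'n::finite) set \<Rightarrow> 'n \<Rightarrow> 'n \<Rightarrow> real ^ 'n \<Rightarrow> real" where
  "a_vec M j k \<theta> =
     - (sqrt 2 / (2 * pi) powr (real CARD('n) / 2)) * (\<Sum>m\<in>M. of_int (m $ j * m $ k) * A_fun m \<theta>)"

definition a_val :: "(int ^ 'n::finite) set \<Rightarrow> real" where
  "a_val M = (THE c. \<forall>j. a_coef M j j = c)"

definition b_val :: "(int ^ 'n::finite) set \<Rightarrow> real" where
  "b_val M = (if CARD('n) = 1 then 0 else THE c. \<forall>j k. j \<noteq> k \<longrightarrow> a_coef M j k = c)"

text \<open>A cotangent vector at any point of the torus is a linear functional on \<open>real ^ 'n\<close>.\<close>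

definition ample :: "(real ^ 'n::finite \<Rightarrow> real) set \<Rightarrow> bool" where
  "ample V \<longleftrightarrow>
     (\<forall>x\<in>torus. \<forall>\<xi>. linear \<xi> \<longrightarrow> (\<exists>v\<in>V. (v has_derivative \<xi>) (at x)))"

definition critical_points :: "(real ^ 'n::finite \<Rightarrow> real) \<Rightarrow> (real ^ 'n) set" where
  "critical_points v = {x \<in> torus. (v has_derivative (\<lambda>h. 0)) (at x)}"

text \<open>The number of critical points is \<open>\<infinity>\<close> (not \<open>0\<close>) when there are infinitely many of them.\<close>

definition num_critical :: "(real ^ 'n::finite \<Rightarrow> real) \<Rightarrow> ennreal" where
  "num_critical v = emeasure (count_space UNIV) (critical_points v)"

text \<open>
  Lebesgue measure on \<open>V(M)\<close>, transported from the coefficients with respect to the basis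
  \<open>A\<^sub>m, B\<^sub>m\<close>, which is orthonormal in \<open>L\<^sup>2\<close> when \<open>M\<close> is a finite subset of the cone.
\<close>

definition trig_lebesgue :: "(int ^ 'n::finite) set \<Rightarrow> (real ^ 'n \<Rightarrow> real) measure" where
  "trig_lebesgue M =
     (let R = (\<Pi>\<^sub>M m\<in>M. (lborel :: (real \<times> real) measure)) in
      distr R
        (sigma (trig_space M) {E. E \<subseteq> trig_space M \<and> trig_comb M -` E \<inter> space R \<in> sets R})
        (trig_comb M))"

definition trig_sphere :: "(int ^ 'n::finite) set \<Rightarrow> (real ^ 'n \<Rightarrow> real) set" where
  "trig_sphere M = {v \<in> trig_space M. l2_inner v v = 1}"

text \<open>
  The area of \<open>E \<subseteq> S\<close> is \<open>d\<close> times the volume of the cone \<open>{t v | 0 < t \<le> 1, v \<in> E}\<close>, where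
  \<open>d = 2 |M|\<close> is the dimension of \<open>V(M)\<close>; equivalently it is the image of \<open>d\<close> times the volume
  of the punctured unit ball under radial projection.
\<close>

definition sphere_area :: "(int ^ 'n::finite) set \<Rightarrow> (real ^ 'n \<Rightarrow> real) measure" where
  "sphere_area M =
     scale_measure (of_nat (2 * card M))
       (distr
          (restrict_space (trig_lebesgue M) {v \<in> trig_space M. 0 < l2_inner v v \<and> l2_inner v v \<le> 1})
          (restrict_space (trig_lebesgue M) (trig_sphere M))
          (\<lambda>v \<theta>. v \<theta> / sqrt (l2_inner v v)))"

definition mean_critical :: "(int ^ 'n::finite) set \<Rightarrow> ennreal" where
  "mean_critical M =
     (\<integral>\<^sup>+ v. num_critical v \<partial>sphere_area M) / emeasure (sphere_area M) (trig_sphere M)"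

text \<open>The index set of the basis \<open>H\<^sub>i\<^sub>j\<close>, \<open>i \<le> j\<close>, of the space of symmetric matrices.\<close>

typedef (overloaded) ('n::linorder) upper = "{p :: 'n \<times> 'n. fst p \<le> snd p}"
  morphisms pair_of Upper
  by (rule exI [of _ "(undefined, undefined)"]) simp

instance upper :: ("{finite,linorder}") finite
proof
  have "inj (pair_of :: 'a upper \<Rightarrow> 'a \<times> 'a)"
    by (simp add: inj_on_def pair_of_inject)
  moreover have "finite (range (pair_of :: 'a upper \<Rightarrow> 'a \<times> 'a))"
    by (rule finite_subset [OF subset_UNIV finite])
  ultimately show "finite (UNIV :: 'a upper set)"
    by (rule finite_imageD [rotated])
qed

definition ufst :: "'n::linorder upper \<Rightarrow> 'n" where
  "ufst p = fst (pair_of p)"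

definition usnd :: "'n::linorder upper \<Rightarrow> 'n" where
  "usnd p = snd (pair_of p)"

definition H_mat :: "'n \<Rightarrow> 'n \<Rightarrow> real ^ 'n::{finite,linorder} ^ 'n::{finite,linorder}" where
  "H_mat i j = (\<chi> k l. if (k = i \<and> l = j) \<or> (k = j \<and> l = i) then 1 else 0)"

text \<open>
  The space of symmetric matrices is identified with \<open>real ^ 'n upper\<close> through the coordinates with
  respect to the orthonormal basis \<open>H\<^sub>i\<^sub>j\<close>; the inner product and the volume are then the
  standard inner product and \<open>lborel\<close> on \<open>real ^ 'n upper\<close>.
\<close>

definition sym_mat :: "real ^ 'n upper \<Rightarrow> real ^ 'n::{finite,linorder} ^ 'n::{finite,linorder}" where
  "sym_mat x = (\<Sum>p\<in>UNIV. (x $ p) *\<^sub>R H_mat (ufst p) (usnd p))"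

definition C_mat :: "(int ^ 'n::{finite,linorder}) set \<Rightarrow> real ^ 'n upper ^ 'n upper" where
  "C_mat M = (\<chi> p q. l2_inner (a_vec M (ufst p) (usnd p)) (a_vec M (ufst q) (usnd q)))"

definition a_vecs_independent :: "(int ^ 'n::{finite,linorder}) set \<Rightarrow> bool" where
  "a_vecs_independent M \<longleftrightarrow>
     (\<forall>c :: 'n upper \<Rightarrow> real.
        (\<forall>\<theta>. (\<Sum>p\<in>UNIV. c p * a_vec M (ufst p) (usnd p) \<theta>) = 0) \<longrightarrow> (\<forall>p. c p = 0))"

end

theory Submission
  imports Defs "HOL-Probability.Distributions" "HOL-Real_Asymp.Real_Asymp"
begin

text \<open>
  A function \<open>v\<close> in \<open>V(M)\<close> is given by one pair \<open>c m\<close> of coefficients for each mode \<open>m\<close>.  At a point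
  \<open>x\<close> of the torus it is convenient to rotate each pair by the phase \<open>m \<bullet> x\<close>, into a pair
  \<open>(\<alpha>\<^sub>m, \<beta>\<^sub>m)\<close>: up to the common normalising factor, the value, the gradient and the Hessian of \<open>v\<close> at
  \<open>x\<close> are then \<open>\<Sum> \<alpha>\<^sub>m\<close>, \<open>\<Sum> \<beta>\<^sub>m m\<close> and \<open>- \<Sum> \<alpha>\<^sub>m m m\<^sup>T\<close>.  The gradient sees only the sine
  coefficients and the Hessian only the cosine coefficients, and the rotation preserves Lebesgue
  measure and the Gaussian density.

  Ampleness.  The differential at \<open>x\<close> is onto if and only if the modes span \<open>\<real>\<^sup>L\<close>
  (\<open>ample_iff_spanning\<close>), that is, if and only if their Gram matrix \<open>\<Sum> m m\<^sup>T\<close> is invertible.  A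
  symmetric set of modes makes the rescaled Gram matrix equal to \<open>a\<close> on the diagonal and to \<open>b\<close> off
  it, so its eigenvalues are \<open>a - b\<close> on the vectors with sum zero and \<open>a + (L - 1) b\<close> on
  \<open>(1, \<dots>, 1)\<close>.  Nonvanishing of the two is the condition for spanning (\<open>spanning_iff\<close>), and their
  product with multiplicities is the determinant (\<open>det_mode_gram\<close>).

  The mean.  The number of critical points does not change when \<open>v\<close> is multiplied by a positive
  number, so its mean over the unit sphere is its mean under the standard Gaussian measure on the
  coefficients (\<open>mean_critical_gaussian\<close>).  The Gaussian mean is given by a Kac-Rice formula
  (\<open>mode_frame.kac_rice\<close>).  Select \<open>L\<close> modes forming a basis of \<open>\<real>\<^sup>L\<close> and fix the coefficients at
  all other modes.  For a point \<open>x\<close>, prescribe the rotated cosine coefficients of the selected modes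
  arbitrarily; the condition that \<open>x\<close> be critical then determines the rotated sine coefficients of the
  selected modes.  Undoing the rotation gives a smooth map from pairs (cosine coefficients, point)
  to coefficients of the selected modes, a map between spaces of dimension \<open>2 L\<close>.  The preimages of a
  coefficient vector correspond to the critical points of the function with these coefficients
  (\<open>fibre_count\<close>), and its Jacobian is the determinant of the Hessian up to a constant
  (\<open>det_jacobian\<close>), so the area formula (\<open>area_formula\<close>) turns the mean number of critical points
  into the integral of \<open>\<bar>det Hess\<bar>\<close>.  After rotating back, the integrand does not depend on \<open>x\<close>, which gives the
  volume of the torus; the sine coefficients give the density of the gradient at \<open>0\<close>, whose
  covariance is the Gram matrix of the modes; the cosine coefficients give the mean of
  \<open>\<bar>det Hess\<bar>\<close>.

  It remains to identify the law of the Hessian.  The coordinates of the Hessian are linear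
  combinations of independent standard Gaussian variables with covariance matrix \<open>C\<close>.  Independence of
  the functions \<open>a\<^sub>i\<^sub>j\<close> says that this linear map is onto, so the law has the Gaussian density with
  covariance \<open>C\<close> (\<open>gaussian_pushforward\<close>); it also forces the modes to span
  (\<open>independent_spans\<close>).  The powers of \<open>2 \<pi>\<close> combine because the space of symmetric matrices has
  dimension \<open>L + (L choose 2)\<close>.
\<close>

section \<open>Determinants with an identity block\<close>

text \<open>
  Extending a permutation by the identity along an injection turns each transposition of a
  factorisation into a transposition, so the parity of the number of factors is unchanged.
\<close>

lemma sign_extend:
  fixes e :: "'a::finite \<Rightarrow> 'b::finite" and p :: "'a \<Rightarrow> 'a"
  assumes "inj e" "p permutes UNIV"
  shows "sign (\<lambda>b. if b \<in> range e then e (p (inv e b)) else b) = sign p"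
proof -
  let ?h = "\<lambda>p b. if b \<in> range e then e (p (inv e b)) else b"
  have sw: "swapidseq n p \<Longrightarrow> swapidseq n (?h p)" for n and p :: "'a \<Rightarrow> 'a"
  proof (induction rule: swapidseq.induct)
    case id
    have "?h id = id"
    proof
      fix b
      show "?h id b = id b"
        by (cases "b \<in> range e") (simp_all add: f_inv_into_f)
    qed
    then show ?case by (simp only: swapidseq.id)
  next
    case (comp_Suc n p a b)
    have "?h (Transposition.transpose a b \<circ> p) c = (Transposition.transpose (e a) (e b) \<circ> ?h p) c" for c
    proof (cases "c \<in> range e")
      case True
      then show ?thesis using \<open>inj e\<close> by (simp add: Transposition.transpose_def inj_eq)
    next
      case False
      then have "c \<noteq> e a" "c \<noteq> e b" by auto
      with False show ?thesis by (simp add: Transposition.transpose_def)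
    qed
    then have eq: "?h (Transposition.transpose a b \<circ> p) = Transposition.transpose (e a) (e b) \<circ> ?h p"
      by (rule ext)
    have "e a \<noteq> e b"
      using comp_Suc.hyps \<open>inj e\<close> by (simp add: inj_eq)
    from swapidseq.comp_Suc[OF comp_Suc.IH this] show ?case
      unfolding eq .
  qed
  obtain n where n: "swapidseq n p"
    using permutes_imp_permutation[OF finite assms(2)] unfolding permutation_def by blast
  have "evenperm (?h p) = even n" "evenperm p = even n"
    using evenperm_unique[OF sw[OF n] refl] evenperm_unique[OF n refl] by auto
  then show ?thesis
    by (simp add: sign_def)
qed

text \<open>
  The rows and columns outside the range of \<open>e\<close> form an identity block, and above it stands a zero
  block.  In the Leibniz expansion of \<open>det B\<close> a permutation contributes only if it maps the range of
  \<open>e\<close> to itself and fixes everything else.  For a bijection \<open>e\<close> the lemma says that determinants do not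
  depend on the naming of the indices.
\<close>

lemma det_block_embed:
  fixes A :: "real^'a::finite^'a" and B :: "real^'b::finite^'b" and e :: "'a \<Rightarrow> 'b"
  assumes e: "inj e"
    and A: "\<And>i j. B $ e i $ e j = A $ i $ j"
    and Z: "\<And>i c. c \<notin> range e \<Longrightarrow> B $ e i $ c = 0"
    and I: "\<And>c d. c \<notin> range e \<Longrightarrow> d \<notin> range e \<Longrightarrow> B $ c $ d = (if c = d then 1 else 0)"
  shows "det B = det A"
proof -
  let ?h = "\<lambda>p b. if b \<in> range e then e (p (inv e b)) else b"
  let ?P = "{p. p permutes (UNIV::'a set)}"
  let ?Q = "{q. q permutes (UNIV::'b set)}"
  have hbij: "?h p permutes UNIV" if "p permutes UNIV" for p
  proof -
    have p: "p x = p y \<longleftrightarrow> x = y" for x y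
      using permutes_inj[OF that] by (rule inj_eq)
    have ran: "?h p b \<in> range e \<longleftrightarrow> b \<in> range e" for b by simp
    have "inj (?h p)"
    proof (rule injI)
      fix b c assume eq: "?h p b = ?h p c"
      show "b = c"
      proof (cases "b \<in> range e")
        case True
        then have c: "c \<in> range e" using ran[of b] ran[of c] unfolding eq by blast
        from True obtain i where b: "b = e i" by blast
        from c obtain j where "c = e j" by blast
        then show ?thesis using eq e b by (simp add: inj_eq p)
      next
        case False
        then have "c \<notin> range e" using ran[of b] ran[of c] unfolding eq by blast
        then show ?thesis using eq False by simp
      qed
    qed
    then show ?thesis
      by (intro inj_imp_permutes) auto
  qed
  have inj_h: "inj_on ?h ?P"
  proof (rule inj_onI)
    fix p q assume "?h p = ?h q"
    then have "?h p (e i) = ?h q (e i)" for i by metis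
    then have "p i = q i" for i using e by (simp add: inj_eq)
    then show "p = q" by auto
  qed
  (* A permutation with nonzero contribution maps the range of e to itself because of the zero block,
     and fixes the other indices because of the identity block. *)
  have zero: "(\<Prod>c\<in>UNIV. B $ c $ q c) = 0" if q: "q \<in> ?Q - ?h ` ?P" for q
  proof (rule ccontr)
    assume nz: "(\<Prod>c\<in>UNIV. B $ c $ q c) \<noteq> 0"
    then have nz': "B $ c $ q c \<noteq> 0" for c by (simp add: prod_zero_iff)
    from q have "q permutes UNIV" by blast
    then have qb: "bij q" by (rule permutes_bij)
    have 1: "q (e i) \<in> range e" for i using Z nz' by blast
    have "card (q ` range e) = card (range e)"
      by (intro card_image inj_on_subset[OF bij_is_inj[OF qb]]) auto
    then have qr: "q ` range e = range e"
      by (intro card_subset_eq) (use 1 in auto)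
    have 2: "q c \<notin> range e" if c: "c \<notin> range e" for c
    proof (rule notI)
      assume "q c \<in> range e"
      with qr obtain b where "b \<in> range e" "q c = q b" by blast
      with qb have "c = b" by (simp add: bij_def inj_eq)
      with c \<open>b \<in> range e\<close> show False by blast
    qed
    have 3: "q c = c" if "c \<notin> range e" for c
      using I[OF that 2[OF that]] nz'[of c] by metis
    define p where "p = inv e \<circ> q \<circ> e"
    have ep: "e (p i) = q (e i)" for i
      using 1[of i] by (simp add: p_def f_inv_into_f)
    have "inj p"
    proof (rule injI)
      fix x y assume "p x = p y"
      then have "q (e x) = q (e y)" by (metis ep)
      with qb e show "x = y" by (simp add: bij_def inj_eq)
    qed
    then have "p \<in> ?P" by (auto intro: inj_imp_permutes)
    moreover have "?h p = q"
    proof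
      fix b
      show "?h p b = q b"
        by (cases "b \<in> range e") (use 3 e ep in auto)
    qed
    ultimately show False using q by blast
  qed
  have prod: "(\<Prod>c\<in>UNIV. B $ c $ ?h p c) = (\<Prod>i\<in>UNIV. A $ i $ p i)" for p
  proof -
    have "(\<Prod>c\<in>UNIV. B $ c $ ?h p c) = (\<Prod>c\<in>range e. B $ c $ ?h p c)"
      by (rule prod.mono_neutral_right) (auto simp: I)
    also have "\<dots> = (\<Prod>i\<in>UNIV. B $ e i $ ?h p (e i))"
      using e by (simp add: prod.reindex)
    finally show ?thesis using e by (simp add: A)
  qed
  have "det B = (\<Sum>q\<in>?Q. of_int (sign q) * (\<Prod>c\<in>UNIV. B $ c $ q c))"
    by (simp add: det_def)
  also have "\<dots> = (\<Sum>q\<in>?h ` ?P. of_int (sign q) * (\<Prod>c\<in>UNIV. B $ c $ q c))"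
    by (rule sum.mono_neutral_right) (use zero hbij in auto)
  also have "\<dots> = (\<Sum>p\<in>?P. of_int (sign (?h p)) * (\<Prod>c\<in>UNIV. B $ c $ ?h p c))"
    using inj_h by (simp add: sum.reindex)
  also have "\<dots> = (\<Sum>p\<in>?P. of_int (sign p) * (\<Prod>i\<in>UNIV. A $ i $ p i))"
    by (rule sum.cong) (use sign_extend[OF e] prod in auto)
  finally show ?thesis by (simp add: det_def)
qed

section \<open>The area formula\<close>

text \<open>
  The change of variables theorem is stated for vectors indexed by a wellordered type.  This copy of
  a finite type is ordered by an arbitrary enumeration, which makes the theorem applicable to
  vectors indexed by any finite type.
\<close>

typedef 'a wo = "UNIV :: 'a set" morphisms un_wo Wo by simp

lemma bij_un_wo: "bij un_wo"
  by (metis UNIV_I Wo_inverse bij_def injI surj_def un_wo_inject)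

instance wo :: (finite) finite
  by standard (metis bij_un_wo finite bij_betw_finite)

instantiation wo :: (finite) wellorder
begin

definition wo_rank :: "'a wo \<Rightarrow> nat" where
  "wo_rank = (SOME f. inj f)"

lemma inj_wo_rank: "inj (wo_rank :: 'a wo \<Rightarrow> nat)"
proof -
  obtain f :: "'a wo \<Rightarrow> nat" where "inj f"
    using finite_imp_inj_to_nat_seg[of "UNIV :: 'a wo set"] by auto
  then show ?thesis unfolding wo_rank_def by (rule someI[where P=inj])
qed

definition less_eq_wo :: "'a wo \<Rightarrow> 'a wo \<Rightarrow> bool" where
  "x \<le> y \<longleftrightarrow> wo_rank x \<le> wo_rank y"

definition less_wo :: "'a wo \<Rightarrow> 'a wo \<Rightarrow> bool" where
  "x < y \<longleftrightarrow> wo_rank x < wo_rank y"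

instance
proof
  fix P :: "'a wo \<Rightarrow> bool" and a
  assume step: "\<And>x. (\<And>y. y < x \<Longrightarrow> P y) \<Longrightarrow> P x"
  show "P a"
    by (induction a rule: measure_induct_rule[of wo_rank]) (use step less_wo_def in blast)
qed (use inj_wo_rank in \<open>auto simp: less_eq_wo_def less_wo_def inj_eq\<close>)

end

lemma prod_Basis_vec: "(\<Prod>b\<in>(Basis :: (real^'k::finite) set). f b) = (\<Prod>k\<in>UNIV. f (axis k 1))"
proof -
  have eq: "(Basis :: (real^'k) set) = range (\<lambda>k. axis k 1)"
    by (auto simp: Basis_vec_def)
  show ?thesis
    unfolding eq by (subst prod.reindex) (auto simp: inj_on_def axis_eq_axis)
qed

text \<open>
  Renaming the coordinates maps boxes to boxes with the same side lengths.
\<close>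

lemma distr_lborel_reindex:
  fixes e :: "'a::finite \<Rightarrow> 'b::finite"
  assumes e: "bij e"
  shows "distr lborel borel (\<lambda>x::real^'b. \<chi> i. x $ e i) = (lborel :: (real^'a) measure)"
proof (rule lborel_eqI[symmetric])
  fix l u :: "real^'a"
  assume le: "\<And>b. b \<in> Basis \<Longrightarrow> l \<bullet> b \<le> u \<bullet> b"
  have le': "l $ i \<le> u $ i" for i
    using le[of "axis i 1"] by (simp add: inner_axis axis_in_Basis_iff)
  let ?f = "\<lambda>x::real^'b. \<chi> i. x $ e i"
  let ?g = "\<lambda>x::real^'a. (\<chi> j. x $ inv e j) :: real^'b"
  have [measurable]: "?f \<in> borel_measurable borel"
    by (intro borel_measurable_continuous_onI continuous_intros)
  have vim: "?f -` box l u = box (?g l) (?g u)"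
    using e by (auto simp: mem_box_cart) (metis bij_inv_eq_iff)+
  have "emeasure (distr lborel borel ?f) (box l u) = emeasure lborel (box (?g l) (?g u))"
    by (subst emeasure_distr) (auto simp: vim)
  also have "\<dots> = (\<Prod>b\<in>Basis. (?g u - ?g l) \<bullet> b)"
    by (rule emeasure_lborel_box) (auto simp: Basis_vec_def inner_axis le')
  also have "(\<Prod>b\<in>Basis. (?g u - ?g l) \<bullet> b) = (\<Prod>j\<in>UNIV. u $ inv e j - l $ inv e j)"
    by (simp add: prod_Basis_vec inner_axis)
  also have "\<dots> = (\<Prod>i\<in>UNIV. u $ i - l $ i)"
    by (rule prod.reindex_bij_betw) (use e in \<open>simp add: bij_imp_bij_inv\<close>)
  also have "\<dots> = (\<Prod>b\<in>Basis. (u - l) \<bullet> b)"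
    by (simp add: prod_Basis_vec inner_axis)
  finally show "emeasure (distr lborel borel ?f) (box l u) = (\<Prod>b\<in>Basis. (u - l) \<bullet> b)" .
qed simp

text \<open>
  The change of variables theorem for an injective map, moved from gauge integrals to nonnegative
  Lebesgue integrals.
\<close>

lemma area_formula_piece:
  fixes g :: "real^'k::{finite,wellorder} \<Rightarrow> real^'k::_" and \<psi> :: "real^'k::_ \<Rightarrow> real"
  assumes der: "\<And>x. (g has_derivative (\<lambda>h. D x *v h)) (at x)"
    and inj: "inj_on g S" and S: "S \<in> sets borel"
    and psi: "\<And>y. 0 \<le> \<psi> y" "integrable lborel \<psi>"
  shows "(\<integral>\<^sup>+y. indicator (g ` S) y * ennreal (\<psi> y) \<partial>lborel)
       = (\<integral>\<^sup>+x. indicator S x * ennreal (\<bar>det (D x)\<bar> * \<psi> (g x)) \<partial>lborel)"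
    and "g ` S \<in> sets lebesgue"
proof -
  have Sl: "S \<in> sets lebesgue" using S by simp
  show gS: "g ` S \<in> sets lebesgue"
  proof (rule differentiable_image_in_sets_lebesgue[OF Sl])
    show "g differentiable_on S"
      unfolding differentiable_on_def differentiable_def
      using has_derivative_at_withinI[OF der] by blast
  qed simp
  have "integrable lebesgue \<psi>"
    using psi(2) by (subst integrable_completion) auto
  then have "\<psi> absolutely_integrable_on UNIV"
    by (simp add: set_integrable_def)
  then have abs: "\<psi> absolutely_integrable_on (g ` S)"
    by (rule set_integrable_subset[OF _ gS]) simp
  (* The change of variables theorem concerns vector valued functions, so \<psi> is read as a vector
     with one component. *)
  let ?F = "\<lambda>y. (vec (\<psi> y) :: real^1)"
  have D: "matrix (\<lambda>h. D x *v h) = D x" for x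
    by (rule matrix_of_matrix_vector_mul)
  have "(?F absolutely_integrable_on (g ` S)) \<and> integral (g ` S) ?F = vec (integral (g ` S) \<psi>)"
    using abs unfolding absolutely_integrable_on_1_iff integral_on_1_eq by simp
  moreover have "(\<lambda>x. \<bar>det (matrix (\<lambda>h. D x *v h))\<bar> *\<^sub>R ?F (g x)) absolutely_integrable_on S
      \<and> integral S (\<lambda>x. \<bar>det (matrix (\<lambda>h. D x *v h))\<bar> *\<^sub>R ?F (g x)) = vec (integral (g ` S) \<psi>)
    \<longleftrightarrow> (?F absolutely_integrable_on (g ` S)) \<and> integral (g ` S) ?F = vec (integral (g ` S) \<psi>)"
    by (rule has_absolute_integral_change_of_variables[OF Sl _ inj])
       (rule has_derivative_at_withinI[OF der])
  ultimately have "(\<lambda>x. \<bar>det (D x)\<bar> *\<^sub>R ?F (g x)) absolutely_integrable_on S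
      \<and> integral S (\<lambda>x. \<bar>det (D x)\<bar> *\<^sub>R ?F (g x)) = vec (integral (g ` S) \<psi>)"
    unfolding D by blast
  then have 1: "(\<lambda>x. \<bar>det (D x)\<bar> * \<psi> (g x)) absolutely_integrable_on S"
    and 2: "integral S (\<lambda>x. \<bar>det (D x)\<bar> * \<psi> (g x)) = integral (g ` S) \<psi>"
    unfolding absolutely_integrable_on_1_iff integral_on_1_eq by (simp_all add: vec_eq_iff)
  have "(\<psi> has_integral integral (g ` S) \<psi>) (g ` S)"
    by (rule integrable_integral[OF set_lebesgue_integral_eq_integral(1)[OF abs]])
  from nn_integral_has_integral_lebesgue[OF _ this] psi(1)
  have A: "(\<integral>\<^sup>+y. ennreal (indicator (g ` S) y * \<psi> y) \<partial>lborel) = ennreal (integral (g ` S) \<psi>)"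
    by simp
  have "((\<lambda>x. \<bar>det (D x)\<bar> * \<psi> (g x)) has_integral integral (g ` S) \<psi>) S"
    using integrable_integral[OF set_lebesgue_integral_eq_integral(1)[OF 1]] unfolding 2 .
  from nn_integral_has_integral_lebesgue[OF _ this] psi(1)
  have B: "(\<integral>\<^sup>+x. ennreal (indicator S x * (\<bar>det (D x)\<bar> * \<psi> (g x))) \<partial>lborel) = ennreal (integral (g ` S) \<psi>)"
    by simp
  have "(\<integral>\<^sup>+y. indicator (g ` S) y * ennreal (\<psi> y) \<partial>lborel) = (\<integral>\<^sup>+y. ennreal (indicator (g ` S) y * \<psi> y) \<partial>lborel)"
    by (rule nn_integral_cong) (auto simp: indicator_def)
  moreover have "(\<integral>\<^sup>+x. indicator S x * ennreal (\<bar>det (D x)\<bar> * \<psi> (g x)) \<partial>lborel)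
      = (\<integral>\<^sup>+x. ennreal (indicator S x * (\<bar>det (D x)\<bar> * \<psi> (g x))) \<partial>lborel)"
    by (rule nn_integral_cong) (auto simp: indicator_def)
  ultimately show "(\<integral>\<^sup>+y. indicator (g ` S) y * ennreal (\<psi> y) \<partial>lborel)
       = (\<integral>\<^sup>+x. indicator S x * ennreal (\<bar>det (D x)\<bar> * \<psi> (g x)) \<partial>lborel)"
    using A B by simp
qed

lemma matrix_inv_works:
  fixes A :: "real^'n^'n"
  assumes "invertible A"
  shows "A ** matrix_inv A = mat 1" "matrix_inv A ** A = mat 1"
  using someI_ex[of "\<lambda>A'. A ** A' = mat 1 \<and> A' ** A = mat 1"] assms
  unfolding invertible_def matrix_inv_def by blast+

text \<open>
  The inverse function theorem, in the part that is needed: near a point with invertible derivative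
  the derivative stays close to an invertible map in operator norm.
\<close>

lemma locally_injective_at_regular_point:
  fixes g :: "real^'k \<Rightarrow> real^'k"
  assumes der: "\<And>x. (g has_derivative (\<lambda>h. D x *v h)) (at x)"
    and cont: "continuous_on UNIV D" and reg: "det (D a) \<noteq> 0"
  shows "\<exists>U. open U \<and> a \<in> U \<and> inj_on g U"
proof -
  let ?g' = "\<lambda>h. matrix_inv (D a) *v h"
  have inv: "invertible (D a)" using reg by (simp add: invertible_det_nz)
  obtain r where "r > 0" "ball a r \<subseteq> UNIV" "inj_on g (ball a r)"
  proof (rule has_derivative_locally_injective[where a=a and S=UNIV and g'="?g'" and f=g and f'="\<lambda>x h. D x *v h"])
    show "bounded_linear ?g'" by (rule matrix_vector_mul_bounded_linear)
    show "?g' \<circ> (*v) (D a) = id"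
      using matrix_inv_works(2)[OF inv] by (simp add: fun_eq_iff matrix_vector_mul_assoc)
    fix e :: real assume "e > 0"
    define s where "s x = (\<Sum>i\<in>UNIV. \<Sum>j\<in>UNIV. \<bar>(D x - D a) $ i $ j\<bar>)" for x
    have "continuous_on UNIV s"
      unfolding s_def by (intro continuous_intros cont)
    then have "isCont s a" by (simp add: continuous_on_eq_continuous_at)
    moreover have "s a = 0" by (simp add: s_def)
    ultimately have "\<exists>d>0. \<forall>x. dist x a < d \<longrightarrow> \<bar>s x\<bar> < e"
      using \<open>e > 0\<close> unfolding continuous_at_eps_delta by (auto simp: dist_real_def)
    then obtain d where d: "d > 0" "\<And>x. dist x a < d \<Longrightarrow> \<bar>s x\<bar> < e" by blast
    have "onorm (\<lambda>v. D x *v v - D a *v v) < e" if "dist a x < d" for x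
    proof -
      have "onorm ((*v) (D x - D a)) \<le> s x"
        unfolding s_def by (rule onorm_le_matrix_component_sum)
      moreover have "(\<lambda>v. D x *v v - D a *v v) = (*v) (D x - D a)"
        by (simp add: fun_eq_iff matrix_vector_mult_diff_rdistrib)
      moreover have "s x < e" using d(2)[of x] that by (simp add: dist_commute)
      ultimately show ?thesis by simp
    qed
    then show "\<exists>d>0. \<forall>x. dist a x < d \<longrightarrow> onorm (\<lambda>v. D x *v v - D a *v v) < e"
      using d(1) by blast
  qed (use der in auto)
  then show ?thesis by (intro exI[of _ "ball a r"]) auto
qed

text \<open>
  By Lindelof's theorem the regular points are covered by countably many open sets on which \<open>g\<close> is
  injective; made disjoint, these pieces each contribute at most one preimage to every value, and
  the change of variables theorem applies to each of them.  By Sard's theorem the critical values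
  form a null set, and critical points contribute nothing to the right-hand side.
\<close>

lemma area_formula_wellorder:
  fixes g :: "real^'k::{finite,wellorder} \<Rightarrow> real^'k::_" and \<psi> :: "real^'k::_ \<Rightarrow> real"
  assumes der: "\<And>x. (g has_derivative (\<lambda>h. D x *v h)) (at x)"
    and cont: "continuous_on UNIV D" and \<Omega>: "\<Omega> \<in> sets borel"
    and psi: "\<And>y. 0 \<le> \<psi> y" "integrable lborel \<psi>"
  shows "(\<integral>\<^sup>+y. ennreal (\<psi> y) * emeasure (count_space UNIV) {x \<in> \<Omega>. g x = y} \<partial>lborel)
       = (\<integral>\<^sup>+x. indicator \<Omega> x * ennreal (\<bar>det (D x)\<bar> * \<psi> (g x)) \<partial>lborel)"
proof -
  define G where "G = {x. det (D x) \<noteq> 0}"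
  have contdet: "continuous_on UNIV (\<lambda>x. det (D x))"
    unfolding det_def by (intro continuous_intros cont)
  have "open G"
  proof -
    have "G = UNIV - (\<lambda>x. det (D x)) -` {0}" by (auto simp: G_def)
    then show ?thesis
      using continuous_closed_vimage[of "{0}" "\<lambda>x. det (D x)"] contdet
      by (simp add: continuous_on_eq_continuous_at open_Diff)
  qed
  have gcont: "continuous_on UNIV g"
    using has_derivative_continuous[OF der] by (simp add: continuous_on_eq_continuous_at)
  define F where "F = {U. open U \<and> inj_on g U}"
  obtain F' where F': "F' \<subseteq> F" "countable F'" "\<Union>F' = \<Union>F"
    using Lindelof[of F] by (auto simp: F_def)
  define U where "U = from_nat_into (insert {} F')"
  have ranU: "range U = insert {} F'"
    unfolding U_def using F'(2) by (intro range_from_nat_into) auto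
  then have U: "open (U i) \<and> inj_on g (U i)" for i
    using F'(1) by (metis (mono_tags) F_def UNIV_I image_eqI inj_on_empty insert_iff mem_Collect_eq open_empty subsetD)
  have "G \<subseteq> \<Union>F"
    using locally_injective_at_regular_point[OF der cont] by (fastforce simp: F_def G_def)
  then have GU: "G \<subseteq> (\<Union>i. U i)" using F'(3) ranU by auto
  define S where "S i = \<Omega> \<inter> G \<inter> disjointed U i" for i
  have S_borel: "S i \<in> sets borel" for i
  proof -
    have "range (disjointed U) \<subseteq> sets borel"
      by (rule sets.range_disjointed_sets) (use U in auto)
    then have [measurable]: "disjointed U i \<in> sets borel" by auto
    have [measurable]: "G \<in> sets borel" using \<open>open G\<close> by simp
    show ?thesis unfolding S_def using \<Omega> by measurable
  qed
  have S_inj: "inj_on g (S i)" for i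
    using U[of i] disjointed_subset[of U i] by (auto simp: S_def intro: inj_on_subset)
  have S_disj: "disjoint_family S"
    using disjoint_family_disjointed[of U] by (auto simp: S_def disjoint_family_on_def)
  have S_Un: "(\<Union>i. S i) = \<Omega> \<inter> G"
    using GU UN_disjointed_eq[of U] by (auto simp: S_def)
  have "negligible (g ` (\<Omega> - G))"
  proof (rule baby_Sard)
    fix x assume x: "x \<in> \<Omega> - G"
    show "(g has_derivative (\<lambda>h. D x *v h)) (at x within \<Omega> - G)"
      by (rule has_derivative_at_withinI[OF der])
    from x show "rank (matrix (\<lambda>h. D x *v h)) < CARD('k)"
      by (simp add: G_def det_eq_0_rank)
  qed simp
  then have AE1: "AE y in lebesgue. y \<notin> g ` (\<Omega> - G)"
    by (intro AE_not_in) (simp add: negligible_iff_null_sets)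
  have count: "emeasure (count_space UNIV) {x \<in> \<Omega>. g x = y} = (\<Sum>i. indicator (g ` S i) y)"
    if "y \<notin> g ` (\<Omega> - G)" for y
  proof -
    have "{x \<in> \<Omega>. g x = y} = (\<Union>i. {x \<in> S i. g x = y})"
      using that S_Un by auto
    moreover have "disjoint_family (\<lambda>i. {x \<in> S i. g x = y})"
      using S_disj by (auto simp: disjoint_family_on_def)
    ultimately have "emeasure (count_space UNIV) {x \<in> \<Omega>. g x = y}
        = (\<Sum>i. emeasure (count_space UNIV) {x \<in> S i. g x = y})"
      by (simp add: suminf_emeasure)
    moreover have "emeasure (count_space UNIV) {x \<in> S i. g x = y} = indicator (g ` S i) y" for i
    proof (cases "y \<in> g ` S i")
      case True
      then obtain x where "x \<in> S i" "g x = y" by auto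
      then have "{x \<in> S i. g x = y} = {x}" using S_inj[of i] by (auto simp: inj_on_def)
      with True show ?thesis by simp
    next
      case False
      then have e: "{x \<in> S i. g x = y} = {}" by auto
      show ?thesis unfolding e using False by simp
    qed
    ultimately show ?thesis by (simp only:)
  qed
  have meas_psi: "\<psi> \<in> borel_measurable borel" using psi(2) by simp
  have "(\<integral>\<^sup>+y. ennreal (\<psi> y) * emeasure (count_space UNIV) {x \<in> \<Omega>. g x = y} \<partial>lborel)
      = (\<integral>\<^sup>+y. ennreal (\<psi> y) * emeasure (count_space UNIV) {x \<in> \<Omega>. g x = y} \<partial>lebesgue)"
    by (simp add: nn_integral_completion)
  also have "\<dots> = (\<integral>\<^sup>+y. (\<Sum>i. indicator (g ` S i) y * ennreal (\<psi> y)) \<partial>lebesgue)"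
    by (rule nn_integral_cong_AE, rule AE_mp[OF AE1])
       (auto simp: count ennreal_suminf_multc mult.commute)
  also have "\<dots> = (\<Sum>i. \<integral>\<^sup>+y. indicator (g ` S i) y * ennreal (\<psi> y) \<partial>lebesgue)"
  proof (rule nn_integral_suminf)
    fix i
    have [measurable]: "g ` S i \<in> sets lebesgue"
      by (rule area_formula_piece(2)[OF der S_inj S_borel psi])
    have [measurable]: "\<psi> \<in> borel_measurable lebesgue"
      using meas_psi by (intro measurable_completion) simp
    show "(\<lambda>y. indicator (g ` S i) y * ennreal (\<psi> y)) \<in> borel_measurable lebesgue"
      by measurable
  qed
  also have "\<dots> = (\<Sum>i. \<integral>\<^sup>+x. indicator (S i) x * ennreal (\<bar>det (D x)\<bar> * \<psi> (g x)) \<partial>lborel)"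
    using area_formula_piece(1)[OF der S_inj S_borel psi] by (simp add: nn_integral_completion)
  also have "\<dots> = (\<integral>\<^sup>+x. (\<Sum>i. indicator (S i) x * ennreal (\<bar>det (D x)\<bar> * \<psi> (g x))) \<partial>lborel)"
  proof (rule nn_integral_suminf[symmetric])
    fix i
    have [measurable]: "(\<lambda>x. det (D x)) \<in> borel_measurable borel" "g \<in> borel_measurable borel"
      using contdet gcont by (auto intro: borel_measurable_continuous_onI)
    note [measurable] = meas_psi S_borel
    show "(\<lambda>x. indicator (S i) x * ennreal (\<bar>det (D x)\<bar> * \<psi> (g x))) \<in> borel_measurable lborel"
      by measurable
  qed
  also have "\<dots> = (\<integral>\<^sup>+x. indicator \<Omega> x * ennreal (\<bar>det (D x)\<bar> * \<psi> (g x)) \<partial>lborel)"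
  proof (rule nn_integral_cong)
    fix x
    have "(\<Sum>i. indicator (S i) x * ennreal (\<bar>det (D x)\<bar> * \<psi> (g x)))
        = indicator (\<Union>i. S i) x * ennreal (\<bar>det (D x)\<bar> * \<psi> (g x))"
      by (simp add: ennreal_suminf_multc suminf_indicator[OF S_disj])
    then show "(\<Sum>i. indicator (S i) x * ennreal (\<bar>det (D x)\<bar> * \<psi> (g x)))
        = indicator \<Omega> x * ennreal (\<bar>det (D x)\<bar> * \<psi> (g x))"
      unfolding S_Un by (auto simp: indicator_def G_def)
  qed
  finally show ?thesis .
qed

text \<open>
  The area formula for maps between spaces of equal dimension: the number of preimages in \<open>\<Omega>\<close>,
  integrated against a density, is the integral over \<open>\<Omega>\<close> of the absolute Jacobian times the density.
  The wellordered case is conjugated by a renaming \<open>\<phi>\<close> of the coordinates.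
\<close>

theorem area_formula:
  fixes g :: "real^'k::finite \<Rightarrow> real^'k" and \<psi> :: "real^'k \<Rightarrow> real"
  assumes der: "\<And>x. (g has_derivative (\<lambda>h. D x *v h)) (at x)"
    and cont: "continuous_on UNIV D" and \<Omega>: "\<Omega> \<in> sets borel"
    and psi: "\<And>y. 0 \<le> \<psi> y" "integrable lborel \<psi>"
    and count: "(\<lambda>y. emeasure (count_space UNIV) {x \<in> \<Omega>. g x = y}) \<in> borel_measurable borel"
  shows "(\<integral>\<^sup>+y. ennreal (\<psi> y) * emeasure (count_space UNIV) {x \<in> \<Omega>. g x = y} \<partial>lborel)
       = (\<integral>\<^sup>+x. indicator \<Omega> x * ennreal (\<bar>det (D x)\<bar> * \<psi> (g x)) \<partial>lborel)"
proof -
  let ?e = "un_wo :: 'k wo \<Rightarrow> 'k"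
  define \<phi> :: "real^'k wo \<Rightarrow> real^'k" where "\<phi> x = (\<chi> i. x $ Wo i)" for x
  define \<phi>' :: "real^'k \<Rightarrow> real^'k wo" where "\<phi>' x = (\<chi> i. x $ un_wo i)" for x
  have inv: "\<phi> (\<phi>' x) = x" "\<phi>' (\<phi> y) = y" for x y
    by (simp_all add: \<phi>_def \<phi>'_def vec_eq_iff un_wo_inverse Wo_inverse)
  have bijWo: "bij (Wo :: 'k \<Rightarrow> 'k wo)"
    by (metis bij_betw_def UNIV_I Wo_inverse injI surjI un_wo_inverse)
  have d: "distr lborel borel \<phi> = lborel" "distr lborel borel \<phi>' = lborel"
    unfolding \<phi>_def[abs_def] \<phi>'_def[abs_def]
    by (rule distr_lborel_reindex[OF bijWo], rule distr_lborel_reindex[OF bij_un_wo])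
  have bl: "bounded_linear \<phi>" "bounded_linear \<phi>'"
    by (auto simp: \<phi>_def \<phi>'_def vec_eq_iff intro!: linear_conv_bounded_linear[THEN iffD1] linearI)
  have [measurable]: "\<phi> \<in> borel_measurable borel" "\<phi>' \<in> borel_measurable borel"
    using bl by (auto intro!: borel_measurable_continuous_onI linear_continuous_on)
  define g' where "g' = \<phi>' \<circ> g \<circ> \<phi>"
  define D' :: "real^'k wo \<Rightarrow> real^'k wo^'k wo" where
    "D' x = (\<chi> i j. D (\<phi> x) $ un_wo i $ un_wo j)" for x
  have D'v: "D' x *v h = \<phi>' (D (\<phi> x) *v \<phi> h)" for x h
  proof -
    have "(\<Sum>j\<in>UNIV. D (\<phi> x) $ un_wo i $ un_wo j * h $ j)
        = (\<Sum>j\<in>UNIV. D (\<phi> x) $ un_wo i $ j * h $ Wo j)" for i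
      by (rule sum.reindex_bij_witness[of _ Wo un_wo]) (auto simp: un_wo_inverse Wo_inverse)
    then show ?thesis
      by (simp add: D'_def \<phi>'_def \<phi>_def matrix_vector_mult_def vec_eq_iff)
  qed
  have der': "(g' has_derivative (\<lambda>h. D' x *v h)) (at x)" for x
    unfolding g'_def D'v
    using diff_chain_at[OF diff_chain_at[OF bounded_linear_imp_has_derivative[OF bl(1)] der]
        bounded_linear_imp_has_derivative[OF bl(2)], of x]
    by (simp add: comp_def)
  have cont': "continuous_on UNIV D'"
    unfolding D'_def
    by (intro continuous_intros continuous_on_compose2[OF cont] linear_continuous_on bl) auto
  have det': "det (D' x) = det (D (\<phi> x))" for x
    by (rule det_block_embed[where e=Wo, symmetric, THEN sym])
       (use bijWo in \<open>auto simp: bij_def D'_def Wo_inverse\<close>)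
  have m\<psi>: "\<psi> \<in> borel_measurable borel" using psi(2) by simp
  have psi': "integrable lborel (\<lambda>y. \<psi> (\<phi> y))"
  proof -
    have "integrable (distr lborel borel \<phi>) \<psi>" using psi(2) d(1) by simp
    then show ?thesis by (subst (asm) integrable_distr_eq) (use m\<psi> in auto)
  qed
  have \<Omega>': "\<phi> -` \<Omega> \<in> sets borel"
    using measurable_sets[OF _ \<Omega>, of \<phi> borel] by simp
  have cnt: "emeasure (count_space UNIV) {x \<in> \<phi> -` \<Omega>. g' x = y}
      = emeasure (count_space UNIV) {x \<in> \<Omega>. g x = \<phi> y}" for y
  proof -
    have "bij_betw \<phi> {x \<in> \<phi> -` \<Omega>. g' x = y} {x \<in> \<Omega>. g x = \<phi> y}"
      by (rule bij_betw_byWitness[of _ \<phi>']) (auto simp: inv g'_def)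
    then show ?thesis
      by (simp add: emeasure_count_space bij_betw_same_card bij_betw_finite)
  qed
  note [measurable] = count m\<psi> \<Omega>
  have "(\<integral>\<^sup>+y. ennreal (\<psi> y) * emeasure (count_space UNIV) {x \<in> \<Omega>. g x = y} \<partial>lborel)
      = (\<integral>\<^sup>+y. ennreal (\<psi> (\<phi> y)) * emeasure (count_space UNIV) {x \<in> \<Omega>. g x = \<phi> y} \<partial>lborel)"
    unfolding d(1)[symmetric]
    by (subst nn_integral_distr) (use d(1) in auto)
  also have "\<dots> = (\<integral>\<^sup>+y. ennreal (\<psi> (\<phi> y)) * emeasure (count_space UNIV) {x \<in> \<phi> -` \<Omega>. g' x = y} \<partial>lborel)"
    by (simp only: cnt)
  also have "\<dots> = (\<integral>\<^sup>+x. indicator (\<phi> -` \<Omega>) x * ennreal (\<bar>det (D' x)\<bar> * \<psi> (\<phi> (g' x))) \<partial>lborel)"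
    by (rule area_formula_wellorder[OF der' cont' \<Omega>' _ psi']) (rule psi(1))
  also have "\<dots> = (\<integral>\<^sup>+x. indicator \<Omega> (\<phi> x) * ennreal (\<bar>det (D (\<phi> x))\<bar> * \<psi> (g (\<phi> x))) \<partial>lborel)"
    by (simp add: det' g'_def inv indicator_def)
  also have "\<dots> = (\<integral>\<^sup>+x. indicator \<Omega> x * ennreal (\<bar>det (D x)\<bar> * \<psi> (g x)) \<partial>lborel)"
  proof -
    have [measurable]: "(\<lambda>x. det (D x)) \<in> borel_measurable borel"
      unfolding det_def by (intro borel_measurable_continuous_onI continuous_intros cont)
    have [measurable]: "g \<in> borel_measurable borel"
      using has_derivative_continuous[OF der]
      by (intro borel_measurable_continuous_onI) (simp add: continuous_on_eq_continuous_at)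
    show ?thesis
      unfolding d(1)[symmetric]
      by (subst nn_integral_distr) (use d(1) in auto)
  qed
  finally show ?thesis .
qed

section \<open>Linear changes of variables in finite products of Lebesgue measure\<close>

lemma product_sigma_finite_lborel:
  "product_sigma_finite (\<lambda>_::'i. lborel :: 'a::euclidean_space measure)"
  by standard

text \<open>
  The area formula for an invertible affine map, where every value has exactly one preimage.
\<close>

lemma nn_integral_affine_vec:
  fixes A :: "real^'k^'k" and f :: "real^'k \<Rightarrow> ennreal"
  assumes A: "det A \<noteq> 0" and f[measurable]: "f \<in> borel_measurable borel"
  shows "(\<integral>\<^sup>+y. f y \<partial>lborel) = ennreal \<bar>det A\<bar> * (\<integral>\<^sup>+x. f (A *v x + b) \<partial>lborel)"
proof -
  let ?g = "\<lambda>x. A *v x + b"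
  have inv: "invertible A" using A by (simp add: invertible_det_nz)
  note mi = matrix_inv_works[OF inv]
  have gm[measurable]: "?g \<in> borel_measurable borel"
    by (intro borel_measurable_continuous_onI continuous_intros
        linear_continuous_on matrix_vector_mul_bounded_linear)
  have fib: "{x \<in> UNIV. ?g x = y} = {matrix_inv A *v (y - b)}" for y
  proof -
    have "?g x = y \<longleftrightarrow> x = matrix_inv A *v (y - b)" for x
    proof
      assume "?g x = y"
      then have "y - b = A *v x" by auto
      then show "x = matrix_inv A *v (y - b)"
        by (simp add: matrix_vector_mul_assoc mi)
    next
      assume "x = matrix_inv A *v (y - b)"
      then show "?g x = y" by (simp add: matrix_vector_mul_assoc mi)
    qed
    then show ?thesis by auto
  qed
  let ?D = "scale_measure (ennreal \<bar>det A\<bar>) (distr lborel borel ?g)"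
  have "lborel = ?D"
  proof (rule lborel_eqI)
    fix l u :: "real^'k"
    assume le: "\<And>b. b \<in> Basis \<Longrightarrow> l \<bullet> b \<le> u \<bullet> b"
    let ?\<psi> = "indicator (box l u) :: real^'k \<Rightarrow> real"
    have der: "(?g has_derivative (\<lambda>h. A *v h)) (at x)" for x
      by (rule derivative_eq_intros bounded_linear.has_derivative[OF matrix_vector_mul_bounded_linear] | simp)+
    have "(\<integral>\<^sup>+y. ennreal (?\<psi> y) * emeasure (count_space UNIV) {x \<in> UNIV. ?g x = y} \<partial>lborel)
       = (\<integral>\<^sup>+x. indicator UNIV x * ennreal (\<bar>det A\<bar> * ?\<psi> (?g x)) \<partial>lborel)"
    proof (rule area_formula[OF der])
      show "integrable lborel ?\<psi>"
        by (rule integrable_real_indicator) (auto simp: emeasure_lborel_box_eq)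
      show "(\<lambda>y. emeasure (count_space UNIV) {x \<in> UNIV. ?g x = y}) \<in> borel_measurable borel"
        unfolding fib by simp
    qed auto
    then have "(\<integral>\<^sup>+y. indicator (box l u) y \<partial>lborel)
        = (\<integral>\<^sup>+x. ennreal \<bar>det A\<bar> * indicator (box l u) (?g x) \<partial>lborel)"
      unfolding fib by (simp add: ennreal_mult ennreal_indicator)
    also have "\<dots> = ennreal \<bar>det A\<bar> * (\<integral>\<^sup>+x. indicator (?g -` box l u) x \<partial>lborel)"
      by (subst nn_integral_cmult[symmetric]) (auto simp: indicator_def)
    also have "\<dots> = ennreal \<bar>det A\<bar> * emeasure lborel (?g -` box l u)"
      using measurable_sets[OF gm, of "box l u"] by (subst nn_integral_indicator) auto
    also have "\<dots> = emeasure ?D (box l u)"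
      by (simp add: emeasure_distr)
    finally show "emeasure ?D (box l u) = (\<Prod>b\<in>Basis. (u - l) \<bullet> b)"
      using le by simp
  qed simp
  then have "(\<integral>\<^sup>+y. f y \<partial>lborel) = (\<integral>\<^sup>+y. f y \<partial>?D)" by simp
  also have "\<dots> = ennreal \<bar>det A\<bar> * (\<integral>\<^sup>+x. f (?g x) \<partial>lborel)"
    by (simp add: nn_integral_scale_measure nn_integral_distr)
  finally show ?thesis .
qed

text \<open>
  A vector with coordinates named by \<open>'k\<close>, as a family over the range of \<open>e\<close>.  It is undefined off
  the range, as elements of a product space are.
\<close>

definition vec_coords :: "('k \<Rightarrow> 'i) \<Rightarrow> real^'k::finite \<Rightarrow> 'i \<Rightarrow> real" where
  "vec_coords e x = (\<lambda>i\<in>range e. x $ inv e i)"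

lemma distr_PiM_vec:
  fixes e :: "'k::finite \<Rightarrow> 'i"
  assumes e: "inj e"
  shows "distr (\<Pi>\<^sub>M i\<in>range e. lborel) borel (\<lambda>\<omega>. \<chi> k. \<omega> (e k)) = (lborel :: (real^'k) measure)"
proof (rule lborel_eqI[symmetric])
  fix l u :: "real^'k"
  assume le: "\<And>b. b \<in> Basis \<Longrightarrow> l \<bullet> b \<le> u \<bullet> b"
  have le': "l $ k \<le> u $ k" for k
    using le[of "axis k 1"] by (simp add: inner_axis axis_in_Basis_iff)
  interpret product_sigma_finite "\<lambda>_::'i. lborel :: real measure"
    by (rule product_sigma_finite_lborel)
  let ?R = "\<Pi>\<^sub>M i\<in>range e. (lborel :: real measure)"
  let ?f = "\<lambda>\<omega>. (\<chi> k. \<omega> (e k)) :: real^'k"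
  have m: "?f \<in> borel_measurable ?R"
    by (subst borel_measurable_euclidean_space)
       (auto simp: Basis_vec_def inner_axis intro!: measurable_component_singleton[where M="\<lambda>_. lborel", simplified])
  have vim: "?f -` box l u \<inter> space ?R = (\<Pi>\<^sub>E i\<in>range e. {l $ inv e i <..< u $ inv e i})"
    using e by (auto simp: mem_box_cart space_PiM PiE_iff)
  have "emeasure (distr ?R borel ?f) (box l u) = emeasure ?R (\<Pi>\<^sub>E i\<in>range e. {l $ inv e i <..< u $ inv e i})"
    using m by (subst emeasure_distr) (auto simp: vim)
  also have "\<dots> = (\<Prod>i\<in>range e. emeasure lborel {l $ inv e i <..< u $ inv e i})"
    by (rule emeasure_PiM) auto
  also have "\<dots> = (\<Prod>k\<in>UNIV. ennreal (u $ k - l $ k))"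
    using e le' by (subst prod.reindex) auto
  also have "\<dots> = ennreal (\<Prod>k\<in>UNIV. u $ k - l $ k)"
    using le' by (subst prod_ennreal) auto
  also have "(\<Prod>k\<in>UNIV. u $ k - l $ k) = (\<Prod>b\<in>Basis. (u - l) \<bullet> b)"
    by (simp add: prod_Basis_vec inner_axis)
  finally show "emeasure (distr ?R borel ?f) (box l u) = (\<Prod>b\<in>Basis. (u - l) \<bullet> b)" .
qed simp

lemma measurable_vec_coords:
  assumes "inj e"
  shows "vec_coords e \<in> borel \<rightarrow>\<^sub>M (\<Pi>\<^sub>M i\<in>range e. lborel)"
  unfolding vec_coords_def
  by (rule measurable_restrict) (auto intro!: borel_measurable_continuous_onI continuous_intros)

lemma nn_integral_PiM_vec:
  fixes e :: "'k::finite \<Rightarrow> 'i"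
  assumes e: "inj e" and f: "f \<in> borel_measurable (\<Pi>\<^sub>M i\<in>range e. lborel)"
  shows "(\<integral>\<^sup>+\<omega>. f \<omega> \<partial>(\<Pi>\<^sub>M i\<in>range e. lborel)) = (\<integral>\<^sup>+x. f (vec_coords e x) \<partial>lborel)"
proof -
  let ?R = "\<Pi>\<^sub>M i\<in>range e. (lborel :: real measure)"
  let ?v = "\<lambda>\<omega>. (\<chi> k. \<omega> (e k)) :: real^'k"
  have m: "?v \<in> borel_measurable ?R"
    by (subst borel_measurable_euclidean_space)
       (auto simp: Basis_vec_def inner_axis intro!: measurable_component_singleton[where M="\<lambda>_. lborel", simplified])
  have "(\<integral>\<^sup>+x. f (vec_coords e x) \<partial>lborel) = (\<integral>\<^sup>+x. f (vec_coords e x) \<partial>distr ?R borel ?v)"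
    by (simp add: distr_PiM_vec[OF e])
  also have "\<dots> = (\<integral>\<^sup>+\<omega>. f (vec_coords e (?v \<omega>)) \<partial>?R)"
    by (rule nn_integral_distr[OF m])
       (use measurable_comp[OF measurable_vec_coords[OF e] f] in \<open>simp add: comp_def\<close>)
  also have "\<dots> = (\<integral>\<^sup>+\<omega>. f \<omega> \<partial>?R)"
  proof (rule nn_integral_cong)
    fix \<omega> assume "\<omega> \<in> space ?R"
    then have "vec_coords e (?v \<omega>) = \<omega>"
      using e by (auto simp: vec_coords_def space_PiM PiE_def extensional_def fun_eq_iff f_inv_into_f)
    then show "f (vec_coords e (?v \<omega>)) = f \<omega>" by simp
  qed
  finally show ?thesis by simp
qed

text \<open>
  A change of variables in each component separately, as for rotations (\<open>c = 1\<close>) and homotheties;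
  \<open>c\<close> is the factor by which taking preimages multiplies the measure.
\<close>

lemma nn_integral_PiM_componentwise:
  fixes T :: "'i \<Rightarrow> 'a::euclidean_space \<Rightarrow> 'a" and c :: real
  assumes I: "finite I" and c: "c > 0"
    and T: "\<And>i. i \<in> I \<Longrightarrow> T i \<in> borel_measurable borel"
    and em: "\<And>i A. i \<in> I \<Longrightarrow> A \<in> sets borel \<Longrightarrow> emeasure lborel (T i -` A) = ennreal c * emeasure lborel A"
    and f: "f \<in> borel_measurable (\<Pi>\<^sub>M i\<in>I. (lborel :: 'a measure))"
  shows "(\<integral>\<^sup>+\<omega>. f (\<lambda>i\<in>I. T i (\<omega> i)) \<partial>(\<Pi>\<^sub>M i\<in>I. lborel))
       = ennreal c ^ card I * (\<integral>\<^sup>+\<omega>. f \<omega> \<partial>(\<Pi>\<^sub>M i\<in>I. lborel))"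
proof -
  interpret product_sigma_finite "\<lambda>_::'i. lborel :: 'a measure"
    by (rule product_sigma_finite_lborel)
  let ?R = "\<Pi>\<^sub>M i\<in>I. (lborel :: 'a measure)"
  let ?m = "\<lambda>\<omega>. \<lambda>i\<in>I. T i (\<omega> i)"
  have m: "?m \<in> ?R \<rightarrow>\<^sub>M ?R"
  proof (rule measurable_restrict)
    fix i assume i: "i \<in> I"
    show "(\<lambda>\<omega>. T i (\<omega> i)) \<in> ?R \<rightarrow>\<^sub>M lborel"
      using measurable_comp[OF measurable_component_singleton[OF i, of "\<lambda>_. lborel"], of "T i" borel] T[OF i]
      by (simp add: comp_def)
  qed
  let ?P = "scale_measure (ennreal (1 / c) ^ card I) (distr ?R ?R ?m)"
  have "?P = ?R"
  proof (rule PiM_eqI[OF I])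
    fix A :: "'i \<Rightarrow> 'a set" assume A: "\<And>i. i \<in> I \<Longrightarrow> A i \<in> sets lborel"
    have vim: "?m -` Pi\<^sub>E I A \<inter> space ?R = Pi\<^sub>E I (\<lambda>i. T i -` A i)"
      by (auto simp: space_PiM PiE_iff)
    have "emeasure (distr ?R ?R ?m) (Pi\<^sub>E I A) = emeasure ?R (Pi\<^sub>E I (\<lambda>i. T i -` A i))"
      using A I by (subst emeasure_distr[OF m]) (auto simp: vim intro!: sets_PiM_I_finite)
    also have "\<dots> = (\<Prod>i\<in>I. emeasure lborel (T i -` A i))"
      using A T measurable_sets[of _ borel borel] by (intro emeasure_PiM I) fastforce
    also have "\<dots> = ennreal c ^ card I * (\<Prod>i\<in>I. emeasure lborel (A i))"
      using A em by (simp add: prod.distrib)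
    finally have "emeasure ?P (Pi\<^sub>E I A)
        = (ennreal (1/c) ^ card I * ennreal c ^ card I) * (\<Prod>i\<in>I. emeasure lborel (A i))"
      by (simp add: mult.assoc)
    also have "ennreal (1/c) ^ card I * ennreal c ^ card I = 1"
      using c by (simp add: power_mult_distrib[symmetric] ennreal_mult[symmetric])
    finally show "emeasure ?P (Pi\<^sub>E I A) = (\<Prod>i\<in>I. emeasure lborel (A i))" by (simp only: mult_1)
  qed simp
  then have "(\<integral>\<^sup>+\<omega>. f \<omega> \<partial>?R) = (\<integral>\<^sup>+\<omega>. f \<omega> \<partial>?P)" by simp
  also have "\<dots> = ennreal (1/c) ^ card I * (\<integral>\<^sup>+\<omega>. f (?m \<omega>) \<partial>?R)"
    using f by (simp add: nn_integral_scale_measure nn_integral_distr[OF m])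
  finally have "ennreal c ^ card I * (\<integral>\<^sup>+\<omega>. f \<omega> \<partial>?R)
      = (ennreal c ^ card I * ennreal (1/c) ^ card I) * (\<integral>\<^sup>+\<omega>. f (?m \<omega>) \<partial>?R)"
    by (simp add: mult.assoc)
  also have "ennreal c ^ card I * ennreal (1/c) ^ card I = 1"
    using c by (simp add: power_mult_distrib[symmetric] ennreal_mult[symmetric])
  finally show ?thesis by (simp only: mult_1)
qed

lemma emeasure_lborel_scaleR_vimage:
  fixes A :: "'a::euclidean_space set"
  assumes "t \<noteq> 0" "A \<in> sets borel"
  shows "emeasure lborel ((\<lambda>v. t *\<^sub>R v) -` A) = ennreal (1 / \<bar>t\<bar> ^ DIM('a)) * emeasure lborel A"
proof -
  let ?g = "\<lambda>v::'a. t *\<^sub>R v"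
  have "lborel = density (distr lborel borel ?g) (\<lambda>_. ennreal (\<bar>t\<bar> ^ DIM('a)))"
    using lborel_affine[OF assms(1), of 0] by simp
  then have "emeasure lborel A = emeasure (density (distr lborel borel ?g) (\<lambda>_. ennreal (\<bar>t\<bar> ^ DIM('a)))) A"
    by simp
  also have "\<dots> = ennreal (\<bar>t\<bar> ^ DIM('a)) * emeasure lborel (?g -` A)"
    using assms(2) by (simp add: emeasure_density_const emeasure_distr)
  finally have "ennreal (1 / \<bar>t\<bar> ^ DIM('a)) * emeasure lborel A
      = (ennreal (1 / \<bar>t\<bar> ^ DIM('a)) * ennreal (\<bar>t\<bar> ^ DIM('a))) * emeasure lborel (?g -` A)"
    by (simp add: mult.assoc)
  also have "ennreal (1 / \<bar>t\<bar> ^ DIM('a)) * ennreal (\<bar>t\<bar> ^ DIM('a)) = 1"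
    using assms(1) by (simp add: ennreal_mult[symmetric])
  finally show ?thesis by simp
qed

text \<open>
  Rotation of the coefficient pair of a mode by a phase \<open>t\<close>.  The first component is the value of
  the mode with coefficients \<open>p\<close> at phase \<open>t\<close>, and the second component is the derivative of that
  value with respect to \<open>t\<close>.
\<close>

definition rot2 :: "real \<Rightarrow> real \<times> real \<Rightarrow> real \<times> real" where
  "rot2 t p = (fst p * cos t + snd p * sin t, snd p * cos t - fst p * sin t)"

lemma rot2_minus: "rot2 t (rot2 (- t) p) = p"
proof -
  obtain a b where p: "p = (a, b)" by (cases p)
  have sc: "sin t * sin t = 1 - cos t * cos t"
    using sin_cos_squared_add[of t] by (simp add: power2_eq_square)
  show ?thesis by (simp add: p rot2_def algebra_simps sc)
qed

lemma nn_integral_shear_fst: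
  fixes f :: "real \<times> real \<Rightarrow> ennreal"
  assumes f: "f \<in> borel_measurable borel"
  shows "(\<integral>\<^sup>+p. f (fst p + t * snd p, snd p) \<partial>lborel) = (\<integral>\<^sup>+p. f p \<partial>lborel)"
proof -
  have [measurable]: "f \<in> borel_measurable (borel \<Otimes>\<^sub>M borel)"
    using f unfolding borel_prod .
  have "(\<integral>\<^sup>+p. f (fst p + t * snd p, snd p) \<partial>lborel)
      = (\<integral>\<^sup>+b. \<integral>\<^sup>+a. f (a + t * b, b) \<partial>lborel \<partial>lborel)"
    unfolding lborel_prod[symmetric] by (subst lborel_pair.nn_integral_snd[symmetric]) auto
  also have "\<dots> = (\<integral>\<^sup>+b. \<integral>\<^sup>+a. f (a, b) \<partial>lborel \<partial>lborel)"
  proof (rule nn_integral_cong)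
    fix b :: real
    have "(\<integral>\<^sup>+a. f (a, b) \<partial>lborel) = (\<integral>\<^sup>+a. f (a, b) \<partial>distr lborel borel ((+) (t * b)))"
      by (simp add: lborel_distr_plus)
    also have "\<dots> = (\<integral>\<^sup>+a. f (t * b + a, b) \<partial>lborel)"
      by (subst nn_integral_distr) auto
    finally show "(\<integral>\<^sup>+a. f (a + t * b, b) \<partial>lborel) = (\<integral>\<^sup>+a. f (a, b) \<partial>lborel)"
      by (simp add: add.commute)
  qed
  also have "\<dots> = (\<integral>\<^sup>+p. f p \<partial>lborel)"
    unfolding lborel_prod[symmetric] by (subst lborel_pair.nn_integral_snd[symmetric]) auto
  finally show ?thesis .
qed

lemma nn_integral_shear_snd:
  fixes f :: "real \<times> real \<Rightarrow> ennreal"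
  assumes f: "f \<in> borel_measurable borel"
  shows "(\<integral>\<^sup>+p. f (fst p, snd p + t * fst p) \<partial>lborel) = (\<integral>\<^sup>+p. f p \<partial>lborel)"
proof -
  have [measurable]: "f \<in> borel_measurable (borel \<Otimes>\<^sub>M borel)"
    using f unfolding borel_prod .
  have "(\<integral>\<^sup>+p. f (fst p, snd p + t * fst p) \<partial>lborel)
      = (\<integral>\<^sup>+a. \<integral>\<^sup>+b. f (a, b + t * a) \<partial>lborel \<partial>lborel)"
    unfolding lborel_prod[symmetric] by (subst lborel.nn_integral_fst[symmetric]) auto
  also have "\<dots> = (\<integral>\<^sup>+a. \<integral>\<^sup>+b. f (a, b) \<partial>lborel \<partial>lborel)"
  proof (rule nn_integral_cong)
    fix a :: real
    have "(\<integral>\<^sup>+b. f (a, b) \<partial>lborel) = (\<integral>\<^sup>+b. f (a, b) \<partial>distr lborel borel ((+) (t * a)))"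
      by (simp add: lborel_distr_plus)
    also have "\<dots> = (\<integral>\<^sup>+b. f (a, t * a + b) \<partial>lborel)"
      by (subst nn_integral_distr) auto
    finally show "(\<integral>\<^sup>+b. f (a, b + t * a) \<partial>lborel) = (\<integral>\<^sup>+b. f (a, b) \<partial>lborel)"
      by (simp add: add.commute)
  qed
  also have "\<dots> = (\<integral>\<^sup>+p. f p \<partial>lborel)"
    unfolding lborel_prod[symmetric] by (subst lborel.nn_integral_fst[symmetric]) auto
  finally show ?thesis .
qed

lemma measurable_rot2[measurable]: "rot2 t \<in> borel_measurable borel"
  unfolding rot2_def by (intro borel_measurable_continuous_onI continuous_intros)

text \<open>
  Shears preserve Lebesgue measure by translation invariance in one variable, and a rotation by an
  angle that is not a multiple of \<open>\<pi>\<close> is a product of three shears.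
\<close>

lemma nn_integral_rot2:
  fixes f :: "real \<times> real \<Rightarrow> ennreal"
  assumes f[measurable]: "f \<in> borel_measurable borel"
  shows "(\<integral>\<^sup>+p. f (rot2 \<theta> p) \<partial>lborel) = (\<integral>\<^sup>+p. f p \<partial>lborel)"
proof (cases "sin \<theta> = 0")
  case False
  (* t is the tangent of half the angle. *)
  define t where "t = (1 - cos \<theta>) / sin \<theta>"
  have ts: "t * sin \<theta> = 1 - cos \<theta>" using False by (simp add: t_def)
  have "t * (1 + cos \<theta>) * sin \<theta> = (t * sin \<theta>) * (1 + cos \<theta>)" by simp
  also have "\<dots> = (1 - cos \<theta>) * (1 + cos \<theta>)" unfolding ts ..
  also have "\<dots> = sin \<theta> * sin \<theta>"
    using sin_cos_squared_add[of \<theta>] by (simp add: algebra_simps power2_eq_square)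
  finally have t2: "t * (1 + cos \<theta>) = sin \<theta>" using False by simp
  define S1 where "S1 p = (fst p + t * snd p, snd p)" for p :: "real \<times> real"
  define S2 where "S2 p = (fst p, snd p + (- sin \<theta>) * fst p)" for p :: "real \<times> real"
  have [measurable]: "S1 \<in> borel_measurable borel" "S2 \<in> borel_measurable borel"
    unfolding S1_def[abs_def] S2_def[abs_def]
    by (intro borel_measurable_continuous_onI continuous_intros)+
  have comp: "rot2 \<theta> p = S1 (S2 (S1 p))" for p
  proof -
    obtain a b where p: "p = (a, b)" by (cases p)
    have "b - sin \<theta> * (a + t * b) = b * (1 - t * sin \<theta>) - a * sin \<theta>"
      by (simp add: algebra_simps)
    then have 2: "b - sin \<theta> * (a + t * b) = b * cos \<theta> - a * sin \<theta>"
      using ts by simp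
    have "a + t * b + t * (b * cos \<theta> - a * sin \<theta>) = a * (1 - t * sin \<theta>) + b * (t * (1 + cos \<theta>))"
      by (simp add: algebra_simps)
    then have 1: "a + t * b + t * (b * cos \<theta> - a * sin \<theta>) = a * cos \<theta> + b * sin \<theta>"
      using ts t2 by simp
    show ?thesis using 1 2 by (simp add: p rot2_def S1_def S2_def)
  qed
  have "(\<integral>\<^sup>+p. f (rot2 \<theta> p) \<partial>lborel) = (\<integral>\<^sup>+p. (\<lambda>q. f (S1 (S2 q))) (fst p + t * snd p, snd p) \<partial>lborel)"
    by (simp add: comp S1_def)
  also have "\<dots> = (\<integral>\<^sup>+q. f (S1 (S2 q)) \<partial>lborel)"
    by (rule nn_integral_shear_fst) measurable
  also have "\<dots> = (\<integral>\<^sup>+q. (\<lambda>r. f (S1 r)) (fst q, snd q + (- sin \<theta>) * fst q) \<partial>lborel)"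
    by (simp add: S2_def)
  also have "\<dots> = (\<integral>\<^sup>+q. f (S1 q) \<partial>lborel)"
    by (rule nn_integral_shear_snd) measurable
  also have "\<dots> = (\<integral>\<^sup>+q. f q \<partial>lborel)"
    unfolding S1_def by (rule nn_integral_shear_fst) measurable
  finally show ?thesis .
next
  case True
  then have "cos \<theta> = 1 \<or> cos \<theta> = -1"
    using sin_cos_squared_add[of \<theta>] by (simp add: power2_eq_1_iff)
  then show ?thesis
  proof
    assume "cos \<theta> = 1" with True show ?thesis by (simp add: rot2_def)
  next
    assume c: "cos \<theta> = -1"
    have eq: "rot2 \<theta> = (\<lambda>p. (-1) *\<^sub>R p)" using True c by (auto simp: rot2_def fun_eq_iff)
    have "distr lborel borel (\<lambda>p::real\<times>real. (-1) *\<^sub>R p) = lborel"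
      using lborel_affine[of "-1" "0::real\<times>real"] by (simp add: density_1)
    then have "(\<integral>\<^sup>+p. f p \<partial>lborel) = (\<integral>\<^sup>+p. f p \<partial>distr lborel borel (\<lambda>p::real\<times>real. (-1) *\<^sub>R p))"
      by simp
    also have "\<dots> = (\<integral>\<^sup>+p. f (rot2 \<theta> p) \<partial>lborel)"
      unfolding eq by (subst nn_integral_distr) auto
    finally show ?thesis by simp
  qed
qed

lemma nn_integral_PiM_rot2:
  assumes I: "finite I" and f: "f \<in> borel_measurable (\<Pi>\<^sub>M i\<in>I. (lborel :: (real \<times> real) measure))"
  shows "(\<integral>\<^sup>+\<omega>. f (\<lambda>i\<in>I. rot2 (\<theta> i) (\<omega> i)) \<partial>(\<Pi>\<^sub>M i\<in>I. lborel)) = (\<integral>\<^sup>+\<omega>. f \<omega> \<partial>(\<Pi>\<^sub>M i\<in>I. lborel))"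
proof -
  have "emeasure lborel (rot2 t -` A) = ennreal 1 * emeasure lborel A" if A: "A \<in> sets borel" for t A
  proof -
    have "rot2 t -` A \<in> sets borel" using measurable_sets[OF measurable_rot2 A, of t] by simp
    then have "emeasure lborel (rot2 t -` A) = (\<integral>\<^sup>+p. indicator (rot2 t -` A) p \<partial>lborel)"
      by (intro nn_integral_indicator[symmetric]) simp
    also have "\<dots> = (\<integral>\<^sup>+p. indicator A (rot2 t p) \<partial>lborel)"
      by (simp only: indicator_vimage)
    also have "\<dots> = (\<integral>\<^sup>+p. indicator A p \<partial>lborel)"
      by (rule nn_integral_rot2) (use A in auto)
    also have "\<dots> = emeasure lborel A" using A by simp
    finally show ?thesis by simp
  qed
  from nn_integral_PiM_componentwise[where T="\<lambda>i. rot2 (\<theta> i)" and c=1, OF I _ _ this f]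
  show ?thesis by simp
qed

text \<open>
  Integrating over families of pairs is integrating over pairs of families.  It serves to separate
  the sine coefficients from the cosine coefficients.
\<close>

lemma nn_integral_PiM_pairs:
  assumes I: "finite I" and f: "f \<in> borel_measurable (\<Pi>\<^sub>M i\<in>I. (lborel :: (real \<times> real) measure))"
  shows "(\<integral>\<^sup>+\<omega>. f \<omega> \<partial>(\<Pi>\<^sub>M i\<in>I. lborel))
       = (\<integral>\<^sup>+a. \<integral>\<^sup>+b. f (\<lambda>i\<in>I. (a i, b i)) \<partial>(\<Pi>\<^sub>M i\<in>I. lborel) \<partial>(\<Pi>\<^sub>M i\<in>I. lborel))"
proof -
  interpret R: product_sigma_finite "\<lambda>_::'a. lborel :: real measure"
    by (rule product_sigma_finite_lborel)
  interpret P: product_sigma_finite "\<lambda>_::'a. lborel :: (real \<times> real) measure"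
    by (rule product_sigma_finite_lborel)
  let ?R = "\<Pi>\<^sub>M i\<in>I. (lborel :: real measure)"
  let ?P = "\<Pi>\<^sub>M i\<in>I. (lborel :: (real \<times> real) measure)"
  interpret RI: sigma_finite_measure ?R using R.sigma_finite[OF I] .
  let ?m = "\<lambda>(a, b). \<lambda>i\<in>I. (a i :: real, b i :: real)"
  have m: "?m \<in> ?R \<Otimes>\<^sub>M ?R \<rightarrow>\<^sub>M ?P"
    unfolding case_prod_beta
  proof (rule measurable_restrict)
    fix i assume i: "i \<in> I"
    note [measurable] = measurable_component_singleton[OF i, of "\<lambda>_. lborel :: real measure"]
    have "(\<lambda>x. (fst x i, snd x i)) \<in> ?R \<Otimes>\<^sub>M ?R \<rightarrow>\<^sub>M (lborel \<Otimes>\<^sub>M lborel)"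
      by measurable
    then show "(\<lambda>x. (fst x i, snd x i)) \<in> ?R \<Otimes>\<^sub>M ?R \<rightarrow>\<^sub>M lborel"
      unfolding lborel_prod .
  qed
  have "distr (?R \<Otimes>\<^sub>M ?R) ?P ?m = ?P"
  proof (rule P.PiM_eqI[OF I])
    fix A :: "'a \<Rightarrow> (real \<times> real) set" assume A: "\<And>i. i \<in> I \<Longrightarrow> A i \<in> sets lborel"
    have A': "A i \<in> sets (lborel \<Otimes>\<^sub>M lborel)" if "i \<in> I" for i
      unfolding lborel_prod using A[OF that] .
    have PA: "Pi\<^sub>E I A \<in> sets ?P" using A I by (intro sets_PiM_I_finite) auto
    have "emeasure (distr (?R \<Otimes>\<^sub>M ?R) ?P ?m) (Pi\<^sub>E I A) = emeasure (?R \<Otimes>\<^sub>M ?R) (?m -` Pi\<^sub>E I A \<inter> space (?R \<Otimes>\<^sub>M ?R))"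
      by (rule emeasure_distr[OF m PA])
    also have "\<dots> = (\<integral>\<^sup>+a. emeasure ?R (Pair a -` (?m -` Pi\<^sub>E I A \<inter> space (?R \<Otimes>\<^sub>M ?R))) \<partial>?R)"
      by (rule RI.emeasure_pair_measure_alt) (rule measurable_sets[OF m PA])
    also have "\<dots> = (\<integral>\<^sup>+a. (\<Prod>i\<in>I. emeasure lborel (Pair (a i) -` A i)) \<partial>?R)"
    proof (rule nn_integral_cong)
      fix a assume a: "a \<in> space ?R"
      have "Pair a -` (?m -` Pi\<^sub>E I A \<inter> space (?R \<Otimes>\<^sub>M ?R)) = Pi\<^sub>E I (\<lambda>i. Pair (a i) -` A i)"
        using a by (auto simp: space_PiM space_pair_measure PiE_def Pi_def)
      moreover have "emeasure ?R (Pi\<^sub>E I (\<lambda>i. Pair (a i) -` A i)) = (\<Prod>i\<in>I. emeasure lborel (Pair (a i) -` A i))"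
        using sets_Pair1[OF A'] by (intro R.emeasure_PiM I) auto
      ultimately show "emeasure ?R (Pair a -` (?m -` Pi\<^sub>E I A \<inter> space (?R \<Otimes>\<^sub>M ?R)))
          = (\<Prod>i\<in>I. emeasure lborel (Pair (a i) -` A i))"
        by simp
    qed
    also have "\<dots> = (\<Prod>i\<in>I. \<integral>\<^sup>+x. emeasure lborel (Pair x -` A i) \<partial>lborel)"
      by (rule R.product_nn_integral_prod[OF I])
         (use lborel.measurable_emeasure_Pair[OF A'] in auto)
    also have "\<dots> = (\<Prod>i\<in>I. emeasure lborel (A i))"
      using lborel.emeasure_pair_measure_alt[OF A'] unfolding lborel_prod by simp
    finally show "emeasure (distr (?R \<Otimes>\<^sub>M ?R) ?P ?m) (Pi\<^sub>E I A) = (\<Prod>i\<in>I. emeasure lborel (A i))" .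
  qed simp
  then have "(\<integral>\<^sup>+\<omega>. f \<omega> \<partial>?P) = (\<integral>\<^sup>+x. f (?m x) \<partial>(?R \<Otimes>\<^sub>M ?R))"
    using nn_integral_distr[OF m, of f] f by simp
  also have "\<dots> = (\<integral>\<^sup>+a. \<integral>\<^sup>+b. f (?m (a, b)) \<partial>?R \<partial>?R)"
    by (rule RI.nn_integral_fst[symmetric]) (use measurable_comp[OF m f] in \<open>simp add: comp_def\<close>)
  finally show ?thesis by simp
qed

section \<open>Gaussian densities and rank one updates of the covariance\<close>

text \<open>
  Completing the square.
\<close>

lemma nn_integral_gauss_quadratic:
  fixes p q :: real
  assumes p: "p > 0"
  shows "(\<integral>\<^sup>+t. ennreal (exp (- (p * t\<^sup>2 - 2 * q * t) / 2)) \<partial>lborel)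
       = ennreal (sqrt (2 * pi / p) * exp (q\<^sup>2 / (2 * p)))"
proof -
  define \<sigma> where "\<sigma> = 1 / sqrt p"
  have \<sigma>: "\<sigma> > 0" "\<sigma>\<^sup>2 = 1 / p" using p by (auto simp: \<sigma>_def power_divide)
  have eq: "exp (- (p * t\<^sup>2 - 2 * q * t) / 2)
      = (sqrt (2 * pi / p) * exp (q\<^sup>2 / (2 * p))) * normal_density (q / p) \<sigma> t" for t
  proof -
    have "- (p * t\<^sup>2 - 2 * q * t) / 2 = q\<^sup>2 / (2 * p) + - (t - q / p)\<^sup>2 / (2 * \<sigma>\<^sup>2)"
      using p unfolding \<sigma>(2) by (simp add: power2_eq_square field_simps)
    then have "exp (- (p * t\<^sup>2 - 2 * q * t) / 2)
        = exp (q\<^sup>2 / (2 * p)) * exp (- (t - q / p)\<^sup>2 / (2 * \<sigma>\<^sup>2))"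
      by (simp only: exp_add)
    moreover have "sqrt (2 * pi / p) * (1 / sqrt (2 * pi * \<sigma>\<^sup>2)) = 1"
      using p unfolding \<sigma>(2) by simp
    ultimately show ?thesis
      using p unfolding normal_density_def by (simp add: mult_ac)
  qed
  have "(\<integral>\<^sup>+t. ennreal (normal_density (q / p) \<sigma> t) \<partial>lborel) = 1"
    using prob_space.emeasure_space_1[OF prob_space_normal_density[OF \<sigma>(1), of "q / p"]]
    by (simp add: emeasure_density)
  then show ?thesis
    unfolding eq using p by (subst ennreal_mult) (auto simp: nn_integral_cmult)
qed

definition outer :: "real^'k \<Rightarrow> real^'k^'k" where
  "outer q = (\<chi> i j. q $ i * q $ j)"

lemma rank_one_mult_vec:
  fixes p r x :: "real^'k"
  shows "(\<chi> i j. p $ i * r $ j) *v x = (r \<bullet> x) *\<^sub>R p"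
  by (simp add: matrix_vector_mult_def vec_eq_iff inner_vec_def sum_distrib_left mult_ac)

lemma outer_mult_vec: "outer q *v x = (q \<bullet> x) *\<^sub>R q"
  unfolding outer_def by (rule rank_one_mult_vec)

lemma det_scaleR: "det (c *\<^sub>R A) = c ^ CARD('n) * det A" for A :: "real^'n::finite^'n"
proof -
  have "c *\<^sub>R A = mat c ** A"
    by (simp add: vec_eq_iff matrix_matrix_mult_def mat_def if_distrib if_distribR cong: if_cong)
  moreover have "det (mat c :: real^'n^'n) = c ^ CARD('n)"
    by (subst det_diagonal) (auto simp: mat_def)
  ultimately show ?thesis by (simp add: det_mul)
qed

text \<open>
  An orthogonal change of coordinates makes \<open>u\<close> a multiple of a coordinate vector; then the matrix
  differs from the identity in a single row.
\<close>

lemma det_rank_one_update: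
  fixes u v :: "real^'k"
  shows "det (mat 1 + (\<chi> i j. u $ i * v $ j)) = 1 + u \<bullet> v"
proof (cases "u = 0")
  case True
  then have "mat 1 + (\<chi> i j. u $ i * v $ j) = (mat 1 :: real^'k^'k)"
    by (simp add: vec_eq_iff)
  then show ?thesis using True by simp
next
  case False
  define a where "a = u /\<^sub>R norm u"
  have "norm a = 1" using False by (simp add: a_def)
  fix k :: 'k
  (* k is an arbitrary coordinate; A carries its axis to the direction of u. *)
  obtain A where A: "orthogonal_matrix A" "A *v (axis k 1) = a"
    using orthogonal_matrix_exists_basis[OF \<open>norm a = 1\<close>] by metis
  have AA: "transpose A ** A = mat 1" "A ** transpose A = mat 1"
    using A(1) by (auto simp: orthogonal_matrix_def)
  define v' where "v' = transpose A *v v"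
  define B where "B = mat 1 + (\<chi> i j. (norm u *\<^sub>R axis k 1 :: real^'k) $ i * v' $ j)"
  have 1: "mat 1 + (\<chi> i j. u $ i * v $ j) = A ** B ** transpose A"
  proof (rule matrix_eq[THEN iffD2], rule allI)
    fix x
    let ?z = "transpose A *v x"
    have "v' \<bullet> ?z = v \<bullet> x"
      unfolding v'_def by (metis AA(2) dot_lmul_matrix matrix_vector_mul_assoc matrix_vector_mul_lid transpose_matrix_vector)
    then have "B *v ?z = ?z + (v \<bullet> x) *\<^sub>R (norm u *\<^sub>R axis k 1)"
      by (simp only: B_def matrix_vector_mult_add_rdistrib rank_one_mult_vec matrix_vector_mul_lid)
    then have "A *v (B *v ?z) = A *v ?z + (v \<bullet> x) *\<^sub>R (norm u *\<^sub>R a)"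
      by (simp only: matrix_vector_right_distrib matrix_vector_mult_scaleR A(2))
    also have "A *v ?z = x"
      by (simp only: matrix_vector_mul_assoc AA matrix_vector_mul_lid)
    also have "norm u *\<^sub>R a = u" using False by (simp add: a_def)
    finally have "(A ** B ** transpose A) *v x = x + (v \<bullet> x) *\<^sub>R u"
      by (simp only: matrix_vector_mul_assoc matrix_mul_assoc)
    moreover have "(mat 1 + (\<chi> i j. u $ i * v $ j)) *v x = x + (v \<bullet> x) *\<^sub>R u"
      by (simp only: matrix_vector_mult_add_rdistrib rank_one_mult_vec matrix_vector_mul_lid)
    ultimately show "(mat 1 + (\<chi> i j. u $ i * v $ j)) *v x = (A ** B ** transpose A) *v x" by simp
  qed
  define c :: "real^'k" where "c = (\<chi> i. (if i = k then 1 else 0) + norm u * v' $ i)"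
  have row: "(\<Sum>l\<in>UNIV. c $ l *s row l (mat 1 :: real^'k^'k)) $ j = c $ j" for j
  proof -
    have "(\<Sum>l\<in>UNIV. c $ l *s row l (mat 1 :: real^'k^'k)) $ j = (\<Sum>l\<in>UNIV. c $ l * (if l = j then 1 else 0))"
      by (simp add: row_def mat_def)
    also have "\<dots> = (\<Sum>l\<in>UNIV. if l = j then c $ l else 0)"
      by (rule sum.cong) auto
    finally show ?thesis by simp
  qed
  have "B = (\<chi> i. if i = k then (\<Sum>i\<in>UNIV. c $ i *s row i (mat 1)) else row i (mat 1))"
  proof (rule vec_eq_iff[THEN iffD2], rule allI, rule vec_eq_iff[THEN iffD2], rule allI)
    fix i j
    show "B $ i $ j = (\<chi> i. if i = k then (\<Sum>i\<in>UNIV. c $ i *s row i (mat 1)) else row i (mat 1)) $ i $ j"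
    proof (cases "i = k")
      case True
      have "B $ k $ j = c $ j" by (auto simp: B_def c_def mat_def axis_def)
      then show ?thesis unfolding True by (simp only: vec_lambda_beta if_True simp_thms row)
    next
      case False
      then show ?thesis by (simp add: B_def row_def axis_def)
    qed
  qed
  then have "det B = c $ k"
    using cramer_lemma_transpose[of k c "mat 1 :: real^'k^'k"] by simp
  moreover have "c $ k = 1 + u \<bullet> v"
  proof -
    have "v' $ k = v' \<bullet> axis k 1" by (simp add: inner_axis)
    also have "\<dots> = v \<bullet> a"
      unfolding v'_def A(2)[symmetric] by (metis dot_lmul_matrix transpose_matrix_vector inner_commute)
    finally show ?thesis using False by (simp add: c_def a_def inner_commute)
  qed
  moreover have "det (A ** B ** transpose A) = det B * (det A * det A)"
    by (simp add: det_mul)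
  moreover have "det A * det A = 1"
    using arg_cong[OF AA(2), of det] by (simp add: det_mul)
  ultimately show ?thesis unfolding 1 by simp
qed

text \<open>
  Symmetric positive definite matrices.  The determinant is part of the definition so that it can be
  carried through an induction over rank one updates.
\<close>

definition covariance_matrix :: "real^'k^'k \<Rightarrow> bool" where
  "covariance_matrix D \<longleftrightarrow> transpose D = D \<and> (\<forall>x. x \<noteq> 0 \<longrightarrow> 0 < x \<bullet> (D *v x)) \<and> 0 < det D"

text \<open>
  The centred Gaussian density with covariance \<open>D\<close>, multiplied by \<open>(2 \<pi>)\<^bsup>k/2\<^esup>\<close>.
\<close>

definition gauss_kernel :: "real^'k^'k \<Rightarrow> real^'k \<Rightarrow> real" where
  "gauss_kernel D y = exp (- (1 / 2) * ((matrix_inv D *v y) \<bullet> y)) / sqrt (det D)"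

lemma sym_inner:
  fixes D :: "real^'k^'k"
  assumes "transpose D = D"
  shows "(D *v x) \<bullet> y = x \<bullet> (D *v y)"
  using assms by (metis dot_lmul_matrix transpose_matrix_vector)

lemma covariance_matrix_one: "covariance_matrix (mat 1 :: real^'k^'k)"
  by (simp add: covariance_matrix_def)

lemma matrix_inv_eqI:
  fixes D :: "real^'k^'k"
  assumes "det D \<noteq> 0" "D *v z = y"
  shows "matrix_inv D *v y = z"
proof -
  have "invertible D" using assms(1) by (simp add: invertible_det_nz)
  from matrix_inv_works(2)[OF this] show ?thesis
    by (simp add: assms(2)[symmetric] matrix_vector_mul_assoc)
qed

text \<open>
  The matrix determinant lemma and the Sherman-Morrison formula for adding \<open>q q\<^sup>T\<close> to a covariance
  matrix.
\<close>

lemma covariance_matrix_add_outer: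
  fixes D :: "real^'k^'k"
  assumes D: "covariance_matrix D"
  defines "E \<equiv> matrix_inv D"
  shows "covariance_matrix (D + outer q)"
    and "det (D + outer q) = det D * (1 + q \<bullet> (E *v q))"
    and "0 \<le> q \<bullet> (E *v q)"
    and "(matrix_inv (D + outer q) *v y) \<bullet> y = (E *v y) \<bullet> y - ((E *v y) \<bullet> q)\<^sup>2 / (1 + q \<bullet> (E *v q))"
    and "(E *v x) \<bullet> y = (E *v y) \<bullet> x"
proof -
  have inv: "invertible D" and det: "det D > 0" and sym: "transpose D = D"
    and pos: "\<And>x. x \<noteq> 0 \<Longrightarrow> 0 < x \<bullet> (D *v x)"
    using D by (auto simp: covariance_matrix_def invertible_det_nz)
  have DE: "D *v (E *v x) = x" for x
    using matrix_inv_works(1)[OF inv] by (simp add: E_def matrix_vector_mul_assoc)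
  have E_sym: "(E *v x) \<bullet> y = (E *v y) \<bullet> x" for x y
    using sym_inner[OF sym, of "E *v x" "E *v y"] by (simp add: DE inner_commute)
  then show "(E *v x) \<bullet> y = (E *v y) \<bullet> x" .
  let ?r = "q \<bullet> (E *v q)"
  have "?r = (E *v q) \<bullet> (D *v (E *v q))" by (simp add: DE inner_commute)
  also have "\<dots> \<ge> 0" using pos[of "E *v q"] by (cases "E *v q = 0") auto
  finally show r: "0 \<le> ?r" .
  have "D + outer q = D ** (mat 1 + (\<chi> i j. (E *v q) $ i * q $ j))"
  proof (rule matrix_eq[THEN iffD2], rule allI)
    fix x
    have "(\<chi> i j. (E *v q) $ i * q $ j) *v x = (q \<bullet> x) *\<^sub>R (E *v q)"
      by (rule rank_one_mult_vec)
    then show "(D + outer q) *v x = (D ** (mat 1 + (\<chi> i j. (E *v q) $ i * q $ j))) *v x"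
      by (simp add: matrix_vector_mul_assoc[symmetric] matrix_vector_mult_add_rdistrib
          matrix_vector_right_distrib matrix_vector_mult_scaleR DE outer_mult_vec)
  qed
  then show det': "det (D + outer q) = det D * (1 + ?r)"
    by (simp add: det_mul det_rank_one_update inner_commute)
  have "transpose (D + outer q) = D + outer q"
    using sym by (simp add: transpose_def outer_def vec_eq_iff mult.commute)
  moreover have "0 < x \<bullet> ((D + outer q) *v x)" if "x \<noteq> 0" for x
    using pos[OF that] by (simp add: matrix_vector_mult_add_rdistrib outer_mult_vec inner_add_right
        inner_commute add_pos_nonneg)
  ultimately show "covariance_matrix (D + outer q)"
    using det r by (simp add: covariance_matrix_def det')
  let ?s = "(E *v y) \<bullet> q"
  let ?z = "E *v y - (?s / (1 + ?r)) *\<^sub>R (E *v q)"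
  have "matrix_inv (D + outer q) *v y = ?z"
  proof (rule matrix_inv_eqI)
    show "det (D + outer q) \<noteq> 0" using det r by (simp add: det')
    have "?s - ?s / (1 + ?r) * ?r = ?s / (1 + ?r)" using r by (simp add: field_simps)
    then have qz: "q \<bullet> ?z = ?s / (1 + ?r)" by (simp add: inner_diff_right inner_commute)
    have "(D + outer q) *v ?z = D *v ?z + (q \<bullet> ?z) *\<^sub>R q"
      by (simp only: matrix_vector_mult_add_rdistrib outer_mult_vec)
    also have "\<dots> = y"
      unfolding qz by (simp add: matrix_vector_mult_diff_distrib matrix_vector_mult_scaleR DE)
    finally show "(D + outer q) *v ?z = y" .
  qed
  then show "(matrix_inv (D + outer q) *v y) \<bullet> y = (E *v y) \<bullet> y - ?s\<^sup>2 / (1 + ?r)"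
    by (simp add: inner_diff_left E_sym[of q y] power2_eq_square)
qed

text \<open>
  Adding an independent standard Gaussian multiple of \<open>q\<close> to a Gaussian vector adds \<open>q q\<^sup>T\<close> to its
  covariance.  In densities this is a one-dimensional Gaussian integral whose exponent is quadratic in
  \<open>t\<close> with leading coefficient \<open>1 + q \<bullet> D\<^sup>-\<^sup>1 q\<close>.
\<close>

lemma gauss_kernel_add_mode:
  fixes D :: "real^'k^'k"
  assumes D: "covariance_matrix D"
  shows "(\<integral>\<^sup>+t. ennreal (exp (- t\<^sup>2 / 2) * gauss_kernel D (y - t *\<^sub>R q)) \<partial>lborel)
       = ennreal (sqrt (2 * pi) * gauss_kernel (D + outer q) y)"
proof -
  let ?E = "matrix_inv D"
  let ?r = "q \<bullet> (?E *v q)" and ?s = "(?E *v y) \<bullet> q" and ?w = "(?E *v y) \<bullet> y"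
  note up = covariance_matrix_add_outer[OF D]
  have det: "det D > 0" using D by (simp add: covariance_matrix_def)
  have r: "1 + ?r > 0" using up(3)[of q] by simp
  have quad: "(?E *v (y - t *\<^sub>R q)) \<bullet> (y - t *\<^sub>R q) = ?w - 2 * ?s * t + t\<^sup>2 * ?r" for t
    using up(5)[of q y]
    by (simp add: matrix_vector_mult_diff_distrib matrix_vector_mult_scaleR inner_diff_left inner_diff_right
        power2_eq_square inner_commute algebra_simps)
  have eq: "exp (- t\<^sup>2 / 2) * gauss_kernel D (y - t *\<^sub>R q)
      = (exp (- ?w / 2) / sqrt (det D)) * exp (- ((1 + ?r) * t\<^sup>2 - 2 * ?s * t) / 2)" for t
    unfolding gauss_kernel_def quad
    by (simp add: exp_add[symmetric] mult_exp_exp field_simps)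
  have "(\<integral>\<^sup>+t. ennreal (exp (- t\<^sup>2 / 2) * gauss_kernel D (y - t *\<^sub>R q)) \<partial>lborel)
     = ennreal (exp (- ?w / 2) / sqrt (det D)) * ennreal (sqrt (2 * pi / (1 + ?r)) * exp (?s\<^sup>2 / (2 * (1 + ?r))))"
  proof -
    have "ennreal (exp (- t\<^sup>2 / 2) * gauss_kernel D (y - t *\<^sub>R q))
        = ennreal (exp (- ?w / 2) / sqrt (det D)) * ennreal (exp (- ((1 + ?r) * t\<^sup>2 - 2 * ?s * t) / 2))" for t
      unfolding eq using det by (intro ennreal_mult) auto
    then show ?thesis
      by (simp only: nn_integral_gauss_quadratic[OF r, symmetric]) (rule nn_integral_cmult, measurable)
  qed
  also have "\<dots> = ennreal ((exp (- ?w / 2) / sqrt (det D)) * (sqrt (2 * pi / (1 + ?r)) * exp (?s\<^sup>2 / (2 * (1 + ?r)))))"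
    using det r by (subst ennreal_mult[symmetric]) auto
  also have "(exp (- ?w / 2) / sqrt (det D)) * (sqrt (2 * pi / (1 + ?r)) * exp (?s\<^sup>2 / (2 * (1 + ?r))))
     = sqrt (2 * pi) * gauss_kernel (D + outer q) y"
  proof -
    have "exp (- (1 / 2) * (?w - ?s\<^sup>2 / (1 + ?r))) = exp (- ?w / 2) * exp (?s\<^sup>2 / (2 * (1 + ?r)))"
      using r by (simp add: exp_add[symmetric] field_simps)
    then show ?thesis
      unfolding gauss_kernel_def up(4) up(2)
      by (simp add: real_sqrt_mult real_sqrt_divide)
  qed
  finally show ?thesis .
qed

lemma borel_measurable_gauss_kernel[measurable]:
  "gauss_kernel D \<in> borel_measurable borel"
proof -
  have [measurable]: "(\<lambda>y. matrix_inv D *v y) \<in> borel_measurable borel"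
    by (intro borel_measurable_continuous_onI linear_continuous_on matrix_vector_mul_bounded_linear)
  show ?thesis
    unfolding gauss_kernel_def by measurable
qed

lemma borel_measurable_PiM_component:
  "m \<in> I \<Longrightarrow> (\<lambda>u. u m) \<in> borel_measurable (\<Pi>\<^sub>M i\<in>I. (lborel :: 'a::euclidean_space measure))"
  using measurable_component_singleton[of m I "\<lambda>_. lborel :: 'a measure"] by simp

lemma borel_measurable_PiM_sum_squares:
  assumes "J \<subseteq> I"
  shows "(\<lambda>u. \<Sum>m\<in>J. (u m)\<^sup>2) \<in> borel_measurable (\<Pi>\<^sub>M i\<in>I. (lborel :: real measure))"
  using assms by (intro borel_measurable_sum borel_measurable_power borel_measurable_PiM_component) auto

lemma borel_measurable_PiM_lincomb:
  fixes q :: "'i \<Rightarrow> 'b::euclidean_space"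
  assumes "J \<subseteq> I"
  shows "(\<lambda>u. \<Sum>m\<in>J. u m *\<^sub>R q m) \<in> borel_measurable (\<Pi>\<^sub>M i\<in>I. (lborel :: real measure))"
  using assms by (intro borel_measurable_sum borel_measurable_scaleR borel_measurable_PiM_component) auto

lemma gauss_kernel_nonneg: "0 \<le> det D \<Longrightarrow> 0 \<le> gauss_kernel D y"
  by (simp add: gauss_kernel_def)

lemma gauss_kernel_add_modes:
  fixes D :: "real^'k^'k" and q :: "'i \<Rightarrow> real^'k"
  assumes J: "finite J" and D: "covariance_matrix D"
  shows "covariance_matrix (D + (\<Sum>m\<in>J. outer (q m)))
    \<and> (\<integral>\<^sup>+u. ennreal (exp (- (\<Sum>m\<in>J. (u m)\<^sup>2) / 2) * gauss_kernel D (y - (\<Sum>m\<in>J. u m *\<^sub>R q m)))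
          \<partial>(\<Pi>\<^sub>M m\<in>J. lborel))
       = ennreal (sqrt (2 * pi) ^ card J * gauss_kernel (D + (\<Sum>m\<in>J. outer (q m))) y)"
  using J D
proof (induction J arbitrary: D rule: finite_induct)
  case empty
  interpret product_sigma_finite "\<lambda>_::'i. lborel :: real measure"
    by (rule product_sigma_finite_lborel)
  show ?case using empty by (subst nn_integral_empty) auto
next
  case (insert i J)
  interpret product_sigma_finite "\<lambda>_::'i. lborel :: real measure"
    by (rule product_sigma_finite_lborel)
  let ?D = "D + outer (q i)"
  have D': "covariance_matrix ?D" by (rule covariance_matrix_add_outer(1)[OF insert.prems])
  have sumD: "?D + (\<Sum>m\<in>J. outer (q m)) = D + (\<Sum>m\<in>insert i J. outer (q m))"
    using insert by (simp add: algebra_simps)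
  let ?f = "\<lambda>u. ennreal (exp (- (\<Sum>m\<in>insert i J. (u m)\<^sup>2) / 2) * gauss_kernel D (y - (\<Sum>m\<in>insert i J. u m *\<^sub>R q m)))"
  have meas: "?f \<in> borel_measurable (\<Pi>\<^sub>M m\<in>insert i J. lborel)"
  proof -
    note [measurable] = borel_measurable_PiM_sum_squares[OF subset_refl, of "insert i J"]
      borel_measurable_PiM_lincomb[OF subset_refl, where I="insert i J" and q=q]
    show ?thesis by measurable
  qed
  have "(\<integral>\<^sup>+u. ?f u \<partial>(\<Pi>\<^sub>M m\<in>insert i J. lborel)) = (\<integral>\<^sup>+x. \<integral>\<^sup>+t. ?f (x(i := t)) \<partial>lborel \<partial>(\<Pi>\<^sub>M m\<in>J. lborel))"
    by (rule product_nn_integral_insert[OF insert.hyps meas])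
  also have "\<dots> = (\<integral>\<^sup>+x. ennreal (sqrt (2 * pi)) * ennreal (exp (- (\<Sum>m\<in>J. (x m)\<^sup>2) / 2)
        * gauss_kernel ?D (y - (\<Sum>m\<in>J. x m *\<^sub>R q m))) \<partial>(\<Pi>\<^sub>M m\<in>J. lborel))"
  proof (rule nn_integral_cong)
    fix x :: "'i \<Rightarrow> real"
    let ?U = "\<Sum>m\<in>J. (x m)\<^sup>2" and ?Y = "y - (\<Sum>m\<in>J. x m *\<^sub>R q m)"
    have s1: "(\<Sum>m\<in>insert i J. ((x(i := t)) m)\<^sup>2) = t\<^sup>2 + ?U" for t
      using insert.hyps by (simp add: sum.insert) (intro sum.cong, auto)
    have s2: "y - (\<Sum>m\<in>insert i J. (x(i := t)) m *\<^sub>R q m) = ?Y - t *\<^sub>R q i" for t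
    proof -
      have "(\<Sum>m\<in>J. (x(i := t)) m *\<^sub>R q m) = (\<Sum>m\<in>J. x m *\<^sub>R q m)"
        using insert.hyps by (intro sum.cong) auto
      then show ?thesis using insert.hyps by (simp add: algebra_simps)
    qed
    have "?f (x(i := t)) = ennreal (exp (- ?U / 2)) * ennreal (exp (- t\<^sup>2 / 2) * gauss_kernel D (?Y - t *\<^sub>R q i))" for t
    proof -
      have "- (t\<^sup>2 + ?U) / 2 = - ?U / 2 + - t\<^sup>2 / 2" by (simp add: field_simps)
      then have "exp (- (t\<^sup>2 + ?U) / 2) = exp (- ?U / 2) * exp (- t\<^sup>2 / 2)"
        by (simp only: exp_add)
      then show ?thesis
        unfolding s1 s2 by (simp only: mult.assoc) (rule ennreal_mult', simp)
    qed
    then have "(\<integral>\<^sup>+t. ?f (x(i := t)) \<partial>lborel)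
        = ennreal (exp (- ?U / 2)) * ennreal (sqrt (2 * pi) * gauss_kernel ?D ?Y)"
      by (simp only: gauss_kernel_add_mode[OF insert.prems, symmetric]) (rule nn_integral_cmult, measurable)
    then show "(\<integral>\<^sup>+t. ?f (x(i := t)) \<partial>lborel)
        = ennreal (sqrt (2 * pi)) * ennreal (exp (- ?U / 2) * gauss_kernel ?D ?Y)"
      using gauss_kernel_nonneg[of ?D ?Y] D'
      by (simp add: ennreal_mult covariance_matrix_def mult_ac)
  qed
  also have "\<dots> = ennreal (sqrt (2 * pi)) * ennreal (sqrt (2 * pi) ^ card J * gauss_kernel (?D + (\<Sum>m\<in>J. outer (q m))) y)"
  proof (subst nn_integral_cmult)
    note [measurable] = borel_measurable_PiM_sum_squares[OF subset_refl, of J]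
      borel_measurable_PiM_lincomb[OF subset_refl, where I=J and q=q]
    show "(\<lambda>x. ennreal (exp (- (\<Sum>m\<in>J. (x m)\<^sup>2) / 2)
        * gauss_kernel ?D (y - (\<Sum>m\<in>J. x m *\<^sub>R q m)))) \<in> borel_measurable (\<Pi>\<^sub>M m\<in>J. lborel)"
      by measurable
  qed (use insert.IH[OF D'] in simp)
  also have "\<dots> = ennreal (sqrt (2 * pi) ^ card (insert i J) * gauss_kernel (?D + (\<Sum>m\<in>J. outer (q m))) y)"
    using insert.hyps by (subst ennreal_mult'[symmetric]) (auto simp: mult_ac)
  finally show ?case
    using insert.IH[OF D'] unfolding sumD by blast
qed

section \<open>Linear images of the standard Gaussian measure\<close>

definition frame_matrix :: "('i \<Rightarrow> real^'k) \<Rightarrow> ('k \<Rightarrow> 'i) \<Rightarrow> real^'k^'k" where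
  "frame_matrix w e = (\<chi> i k. w (e k) $ i)"

lemma frame_matrix_mult: "frame_matrix w e *v s = (\<Sum>k\<in>UNIV. (s $ k) *\<^sub>R w (e k))"
  by (simp add: frame_matrix_def matrix_vector_mult_def vec_eq_iff mult.commute)

lemma transpose_frame_matrix_mult: "(transpose (frame_matrix w e) *v x) $ k = w (e k) \<bullet> x"
  by (simp add: frame_matrix_def matrix_vector_mult_def transpose_def inner_vec_def del: transpose_matrix_vector)

text \<open>
  A finite family that spans the space contains a basis.  Spanning is expressed by duality: only the
  zero vector is orthogonal to the family.
\<close>

lemma exists_frame:
  fixes w :: "'i \<Rightarrow> real^'k"
  assumes I: "finite I" and spans: "\<And>x. (\<And>m. m \<in> I \<Longrightarrow> w m \<bullet> x = 0) \<Longrightarrow> x = 0"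
  obtains e :: "'k \<Rightarrow> 'i" where "inj e" "range e \<subseteq> I" "det (frame_matrix w e) \<noteq> 0"
proof -
  obtain B where B: "B \<subseteq> w ` I" "independent B" "w ` I \<subseteq> span B"
    using maximal_independent_subset[of "w ` I"] by auto
  have perp: "x = 0" if "\<And>b. b \<in> B \<Longrightarrow> b \<bullet> x = 0" for x
  proof (rule spans)
    fix m assume "m \<in> I"
    then have "w m \<in> span B" using B(3) by auto
    then show "w m \<bullet> x = 0"
      by (induction rule: span_induct_alt) (auto simp: inner_add_left that)
  qed
  have "span B = UNIV"
  proof (rule ccontr)
    assume "span B \<noteq> UNIV"
    then have "dim B < DIM(real^'k)"
      by (metis dim_eq_full dim_subset_UNIV order_le_imp_less_or_eq)
    then obtain x where "x \<noteq> 0" "\<And>y. y \<in> span B \<Longrightarrow> orthogonal x y"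
      using orthogonal_to_subspace_exists by blast
    then show False using perp[of x] by (auto simp: orthogonal_def inner_commute span_base)
  qed
  then have "card B = CARD('k)"
    using B(2) by (metis DIM_cart DIM_real dim_UNIV dim_eq_card_independent dim_span mult.right_neutral)
  moreover have "finite B" using B(2) by (rule independent_imp_finite)
  ultimately obtain f :: "'k \<Rightarrow> real^'k" where f: "bij_betw f UNIV B"
    by (metis finite_class.finite_UNIV finite_same_card_bij)
  define e where "e k = (SOME m. m \<in> I \<and> w m = f k)" for k
  have e: "e k \<in> I \<and> w (e k) = f k" for k
  proof -
    have "f k \<in> B" using f by (auto simp: bij_betw_def)
    with B(1) obtain m where "m \<in> I" "f k = w m" by blast
    then have "\<exists>m. m \<in> I \<and> w m = f k" by metis
    then show ?thesis unfolding e_def by (rule someI_ex)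
  qed
  have "inj e"
  proof (rule injI)
    fix k l assume "e k = e l"
    then have "f k = f l" using e by metis
    then show "k = l" using bij_betw_imp_inj_on[OF f] by (simp add: inj_eq)
  qed
  moreover have "range e \<subseteq> I" using e by auto
  moreover have "det (frame_matrix w e) \<noteq> 0"
  proof -
    have ker: "x = 0" if "transpose (frame_matrix w e) *v x = 0" for x
    proof (rule perp)
      fix b assume "b \<in> B"
      then obtain k where "b = f k" using f by (auto simp: bij_betw_def)
      then show "b \<bullet> x = 0"
        using transpose_frame_matrix_mult[of w e x k] that e[of k] by (simp del: transpose_matrix_vector)
    qed
    obtain B' where "B' ** transpose (frame_matrix w e) = mat 1"
      using matrix_left_invertible_ker[of "transpose (frame_matrix w e)"] ker by blast
    from arg_cong[OF this, of det] show ?thesis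
      by (auto simp: det_mul)
  qed
  ultimately show ?thesis by (rule that)
qed

lemma covariance_conjugate:
  fixes P :: "real^'k^'k"
  assumes P: "det P \<noteq> 0" and D: "det D > 0"
  defines "C \<equiv> P ** D ** transpose P"
  shows "det C = (det P)\<^sup>2 * det D"
    and "gauss_kernel C y = gauss_kernel D (matrix_inv P *v y) / \<bar>det P\<bar>"
proof -
  show det: "det C = (det P)\<^sup>2 * det D"
    by (simp add: C_def det_mul power2_eq_square)
  have C0: "det C \<noteq> 0" using P D by (simp add: det)
  let ?z = "matrix_inv C *v y" and ?x = "matrix_inv P *v y"
  have inv: "invertible P" "invertible D" "invertible C"
    using P D C0 by (auto simp: invertible_det_nz)
  have Px: "P *v ?x = y"
    by (simp only: matrix_vector_mul_assoc matrix_inv_works(1)[OF inv(1)] matrix_vector_mul_lid)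
  have "C *v ?z = y"
    by (simp only: matrix_vector_mul_assoc matrix_inv_works(1)[OF inv(3)] matrix_vector_mul_lid)
  then have "P *v (D *v (transpose P *v ?z)) = y"
    by (simp only: C_def matrix_vector_mul_assoc matrix_mul_assoc)
  then have "D *v (transpose P *v ?z) = ?x"
    using matrix_inv_eqI[OF P] by metis
  then have "matrix_inv D *v ?x = transpose P *v ?z"
    using D by (intro matrix_inv_eqI) auto
  then have "(matrix_inv D *v ?x) \<bullet> ?x = ?z \<bullet> (P *v ?x)"
    by (metis dot_lmul_matrix transpose_matrix_vector)
  then have "(matrix_inv C *v y) \<bullet> y = (matrix_inv D *v ?x) \<bullet> ?x"
    by (simp only: Px)
  then show "gauss_kernel C y = gauss_kernel D ?x / \<bar>det P\<bar>"
    by (simp add: gauss_kernel_def det real_sqrt_mult)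
qed

text \<open>
  Written in the basis selected by \<open>e\<close>, the basis vectors contribute the identity matrix to the
  covariance and the other vectors are added as rank one updates.
\<close>

lemma frame_conjugate:
  fixes w :: "'i \<Rightarrow> real^'k"
  assumes I: "finite I" and e: "inj e" "range e \<subseteq> I" and P: "det (frame_matrix w e) \<noteq> 0"
  shows "(\<Sum>m\<in>I. outer (w m)) = frame_matrix w e
      ** (mat 1 + (\<Sum>m\<in>I - range e. outer (matrix_inv (frame_matrix w e) *v w m)))
      ** transpose (frame_matrix w e)"
proof (rule matrix_eq[THEN iffD2], rule allI)
  fix x
  let ?P = "frame_matrix w e"
  let ?q = "\<lambda>m. matrix_inv ?P *v w m"
  let ?z = "transpose ?P *v x"
  have sum_mult: "(\<Sum>m\<in>J. outer (f m)) *v z = (\<Sum>m\<in>J. (f m \<bullet> z) *\<^sub>R f m)"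
    for J :: "'i set" and f :: "'i \<Rightarrow> real^'k" and z
    by (induction J rule: infinite_finite_induct)
       (simp_all add: matrix_vector_mult_add_rdistrib outer_mult_vec)
  have inv: "invertible ?P" using P by (simp add: invertible_det_nz)
  have Pq: "?P *v ?q m = w m" for m
    by (simp only: matrix_vector_mul_assoc matrix_inv_works(1)[OF inv] matrix_vector_mul_lid)
  have qz: "?q m \<bullet> ?z = w m \<bullet> x" for m
    by (metis Pq dot_lmul_matrix inner_commute transpose_matrix_vector)
  have lin: "?P *v (\<Sum>m\<in>J. g m) = (\<Sum>m\<in>J. ?P *v g m)" for J :: "'i set" and g
    by (rule linear_sum) simp
  have "(?P ** (mat 1 + (\<Sum>m\<in>I - range e. outer (?q m))) ** transpose ?P) *v x
      = ?P *v (?z + (\<Sum>m\<in>I - range e. (?q m \<bullet> ?z) *\<^sub>R ?q m))"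
    by (simp only: matrix_vector_mul_assoc[symmetric] matrix_vector_mult_add_rdistrib
        matrix_vector_mul_lid sum_mult)
  also have "\<dots> = ?P *v ?z + (\<Sum>m\<in>I - range e. (w m \<bullet> x) *\<^sub>R w m)"
    by (simp only: matrix_vector_right_distrib lin matrix_vector_mult_scaleR Pq qz)
  also have "?P *v ?z = (\<Sum>k\<in>UNIV. (w (e k) \<bullet> x) *\<^sub>R w (e k))"
    by (simp only: frame_matrix_mult transpose_frame_matrix_mult)
  also have "\<dots> = (\<Sum>m\<in>range e. (w m \<bullet> x) *\<^sub>R w m)"
    using e(1) by (simp add: sum.reindex)
  also have "\<dots> + (\<Sum>m\<in>I - range e. (w m \<bullet> x) *\<^sub>R w m) = (\<Sum>m\<in>I. (w m \<bullet> x) *\<^sub>R w m)"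
    using sum.subset_diff[OF e(2) I, of "\<lambda>m. (w m \<bullet> x) *\<^sub>R w m"] by simp
  finally show "(\<Sum>m\<in>I. outer (w m)) *v x
      = (?P ** (mat 1 + (\<Sum>m\<in>I - range e. outer (?q m))) ** transpose ?P) *v x"
    by (simp only: sum_mult)
qed

lemma gauss_kernel_one: "gauss_kernel (mat 1) y = exp (- (norm y)\<^sup>2 / 2)"
proof -
  have "matrix_inv (mat 1) *v y = y" by (rule matrix_inv_eqI) auto
  then show ?thesis by (simp add: gauss_kernel_def power2_norm_eq_inner)
qed

lemma det_frame_covariance:
  fixes w :: "'i \<Rightarrow> real^'k"
  assumes I: "finite I" and e: "inj e" "range e \<subseteq> I" and P: "det (frame_matrix w e) \<noteq> 0"
  defines "D \<equiv> mat 1 + (\<Sum>m\<in>I - range e. outer (matrix_inv (frame_matrix w e) *v w m))"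
  shows "covariance_matrix D"
    and "det (\<Sum>m\<in>I. outer (w m)) = (det (frame_matrix w e))\<^sup>2 * det D"
    and "det (\<Sum>m\<in>I. outer (w m)) > 0"
    and "gauss_kernel (\<Sum>m\<in>I. outer (w m)) y
       = gauss_kernel D (matrix_inv (frame_matrix w e) *v y) / \<bar>det (frame_matrix w e)\<bar>"
proof -
  show D: "covariance_matrix D"
    unfolding D_def by (rule conjunct1[OF gauss_kernel_add_modes[OF finite_Diff[OF I] covariance_matrix_one]])
  then have "det D > 0" by (simp add: covariance_matrix_def)
  note c = covariance_conjugate[OF P this]
  have C: "(\<Sum>m\<in>I. outer (w m)) = frame_matrix w e ** D ** transpose (frame_matrix w e)"
    unfolding D_def by (rule frame_conjugate[OF I e P])
  show "det (\<Sum>m\<in>I. outer (w m)) = (det (frame_matrix w e))\<^sup>2 * det D"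
    unfolding C by (rule c(1))
  with P \<open>det D > 0\<close> show "det (\<Sum>m\<in>I. outer (w m)) > 0" by simp
  show "gauss_kernel (\<Sum>m\<in>I. outer (w m)) y
       = gauss_kernel D (matrix_inv (frame_matrix w e) *v y) / \<bar>det (frame_matrix w e)\<bar>"
    unfolding C by (rule c(2))
qed

text \<open>
  The integral of the standard Gaussian density over the subspace \<open>\<Sum> u\<^sub>m w\<^sub>m = 0\<close>.  The coefficients
  off the frame parametrise the subspace, the coefficients on the frame being minus the
  coordinates of the remaining sum in the basis \<open>w (e k)\<close>.  The value is that of the density of
  \<open>\<Sum> u\<^sub>m w\<^sub>m\<close> at \<open>0\<close>, up to the constants.
\<close>

lemma gaussian_on_constraint:
  fixes w :: "'i \<Rightarrow> real^'k"
  assumes I: "finite I" and e: "inj e" "range e \<subseteq> I" and P: "det (frame_matrix w e) \<noteq> 0"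
  shows "(\<integral>\<^sup>+u. ennreal (exp (- (\<Sum>m\<in>I - range e. (u m)\<^sup>2) / 2
              - (norm (\<Sum>m\<in>I - range e. u m *\<^sub>R (matrix_inv (frame_matrix w e) *v w m)))\<^sup>2 / 2))
            \<partial>(\<Pi>\<^sub>M m\<in>I - range e. lborel))
       = ennreal (sqrt (2 * pi) ^ card (I - range e) * \<bar>det (frame_matrix w e)\<bar> / sqrt (det (\<Sum>m\<in>I. outer (w m))))"
proof -
  let ?J = "I - range e" and ?q = "\<lambda>m. matrix_inv (frame_matrix w e) *v w m"
  let ?D = "mat 1 + (\<Sum>m\<in>?J. outer (?q m))"
  have D: "det ?D > 0"
    using det_frame_covariance(1)[OF I e P] by (simp add: covariance_matrix_def)
  have eq: "exp (- (\<Sum>m\<in>?J. (u m)\<^sup>2) / 2 - (norm (\<Sum>m\<in>?J. u m *\<^sub>R ?q m))\<^sup>2 / 2)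
      = exp (- (\<Sum>m\<in>?J. (u m)\<^sup>2) / 2) * gauss_kernel (mat 1) (0 - (\<Sum>m\<in>?J. u m *\<^sub>R ?q m))" for u
    by (simp add: gauss_kernel_one exp_add[symmetric] del: exp_add)
  have "gauss_kernel ?D 0 = \<bar>det (frame_matrix w e)\<bar> / sqrt (det (\<Sum>m\<in>I. outer (w m)))"
    unfolding det_frame_covariance(2)[OF I e P] using P D by (simp add: gauss_kernel_def real_sqrt_mult)
  then show ?thesis
    unfolding eq
    using gauss_kernel_add_modes[OF finite_Diff[OF I, of "range e"] covariance_matrix_one, of ?q 0]
    by simp
qed

text \<open>
  A linear image of a standard Gaussian vector is Gaussian, and it has a density when the images
  \<open>w\<^sub>m\<close> of the basis vectors span.  The coefficients on the frame are traded for the value \<open>y\<close> of the sum by an affine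
  change of variables, and the remaining coefficients are then integrated out one by one.
\<close>

theorem gaussian_pushforward:
  fixes w :: "'i \<Rightarrow> real^'k" and h :: "real^'k \<Rightarrow> ennreal"
  assumes I: "finite I" and e: "inj e" "range e \<subseteq> I" and P: "det (frame_matrix w e) \<noteq> 0"
    and h[measurable]: "h \<in> borel_measurable borel"
  shows "(\<integral>\<^sup>+u. ennreal (exp (- (\<Sum>m\<in>I. (u m)\<^sup>2) / 2)) * h (\<Sum>m\<in>I. u m *\<^sub>R w m) \<partial>(\<Pi>\<^sub>M m\<in>I. lborel))
       = ennreal (sqrt (2 * pi) ^ card (I - range e))
         * (\<integral>\<^sup>+y. ennreal (gauss_kernel (\<Sum>m\<in>I. outer (w m)) y) * h y \<partial>lborel)"
proof -
  interpret product_sigma_finite "\<lambda>_::'i. lborel :: real measure"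
    by (rule product_sigma_finite_lborel)
  let ?P = "frame_matrix w e"
  let ?J = "I - range e" and ?q = "\<lambda>m. matrix_inv ?P *v w m"
  let ?D = "mat 1 + (\<Sum>m\<in>?J. outer (?q m))"
  let ?C = "\<Sum>m\<in>I. outer (w m)"
  let ?MJ = "\<Pi>\<^sub>M m\<in>?J. (lborel :: real measure)"
  have J: "finite ?J" using I by simp
  interpret MJ: sigma_finite_measure ?MJ using sigma_finite[OF J] .
  interpret pair_sigma_finite ?MJ "lborel :: (real^'k) measure" ..
  have inv: "invertible ?P" using P by (simp add: invertible_det_nz)
  have IJ: "?J \<union> range e = I" "?J \<inter> range e = {}" using e(2) by auto
  let ?F = "\<lambda>u. ennreal (exp (- (\<Sum>m\<in>I. (u m)\<^sup>2) / 2)) * h (\<Sum>m\<in>I. u m *\<^sub>R w m)"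
  have F: "?F \<in> borel_measurable (\<Pi>\<^sub>M m\<in>I. lborel)"
  proof -
    note [measurable] = borel_measurable_PiM_sum_squares[OF subset_refl, of I]
      borel_measurable_PiM_lincomb[OF subset_refl, where I=I and q=w]
    show ?thesis by measurable
  qed
  define U where "U u = (\<Sum>m\<in>?J. (u m)\<^sup>2)" for u :: "'i \<Rightarrow> real"
  define b where "b u = (\<Sum>m\<in>?J. u m *\<^sub>R w m)" for u
  have [measurable]: "U \<in> borel_measurable ?MJ" "b \<in> borel_measurable ?MJ"
    unfolding U_def[abs_def] b_def[abs_def]
    by (rule borel_measurable_PiM_sum_squares borel_measurable_PiM_lincomb; simp)+
  have Pm[measurable]: "(\<lambda>y. matrix_inv ?P *v y) \<in> borel_measurable borel"
    by (intro borel_measurable_continuous_onI linear_continuous_on matrix_vector_mul_bounded_linear)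
  (* The joint density of the remaining coefficients u and of the value y of the whole sum. *)
  define K where "K u y = ennreal (exp (- U u / 2) * gauss_kernel (mat 1) (matrix_inv ?P *v (y - b u))) * h y" for u y
  have split: "(\<Sum>m\<in>I. f m) = (\<Sum>m\<in>?J. f m) + (\<Sum>k\<in>UNIV. f (e k))" for f :: "'i \<Rightarrow> 'z::comm_monoid_add"
    using sum.subset_diff[OF e(2) I, of f] e(1) by (simp add: sum.reindex)
  have merge: "?F (merge ?J (range e) (u, vec_coords e s)) = K u (?P *v s + b u)" for u s
  proof -
    let ?m = "merge ?J (range e) (u, vec_coords e s)"
    have m1: "?m m = u m" if "m \<in> ?J" for m using that by (simp add: merge_def)
    have m2: "?m (e k) = s $ k" for k using e(1) by (simp add: merge_def vec_coords_def)
    have "(norm s)\<^sup>2 = (\<Sum>k\<in>UNIV. (s $ k)\<^sup>2)"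
      unfolding power2_norm_eq_inner by (simp add: inner_vec_def power2_eq_square)
    moreover have "(\<Sum>m\<in>?J. (?m m)\<^sup>2) = U u"
      unfolding U_def by (rule sum.cong) (simp_all only: m1)
    ultimately have "(\<Sum>m\<in>I. (?m m)\<^sup>2) = U u + (norm s)\<^sup>2"
      unfolding split m2 by simp
    moreover have "(\<Sum>m\<in>I. ?m m *\<^sub>R w m) = ?P *v s + b u"
    proof -
      have "(\<Sum>m\<in>?J. ?m m *\<^sub>R w m) = b u"
        unfolding b_def by (rule sum.cong) (simp_all only: m1)
      then show ?thesis unfolding split m2 frame_matrix_mult by simp
    qed
    moreover have "matrix_inv ?P *v (?P *v s + b u - b u) = s"
      by (simp add: matrix_vector_mul_assoc matrix_inv_works(2)[OF inv])
    moreover have "exp (- (U u + (norm s)\<^sup>2) / 2) = exp (- U u / 2) * exp (- (norm s)\<^sup>2 / 2)"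
      by (simp add: exp_add[symmetric] add_divide_distrib)
    ultimately show ?thesis
      unfolding K_def gauss_kernel_one by (simp only:)
  qed
  have Km: "(\<lambda>(u, y). K u y) \<in> borel_measurable (?MJ \<Otimes>\<^sub>M lborel)"
    unfolding K_def by measurable
  have "(\<integral>\<^sup>+u. ?F u \<partial>(\<Pi>\<^sub>M m\<in>I. lborel))
      = (\<integral>\<^sup>+u. \<integral>\<^sup>+\<omega>. ?F (merge ?J (range e) (u, \<omega>)) \<partial>(\<Pi>\<^sub>M m\<in>range e. lborel) \<partial>?MJ)"
    using product_nn_integral_fold[OF IJ(2) J _ , of ?F] F unfolding IJ(1) by simp
  also have "\<dots> = (\<integral>\<^sup>+u. ennreal (1 / \<bar>det ?P\<bar>) * (\<integral>\<^sup>+y. K u y \<partial>lborel) \<partial>?MJ)"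
  proof (rule nn_integral_cong)
    fix u assume u: "u \<in> space ?MJ"
    have "(\<lambda>\<omega>. merge ?J (range e) (u, \<omega>)) \<in> (\<Pi>\<^sub>M m\<in>range e. lborel) \<rightarrow>\<^sub>M (\<Pi>\<^sub>M m\<in>?J \<union> range e. lborel)"
      using u by measurable
    from measurable_comp[OF this, of ?F borel] F
    have "(\<integral>\<^sup>+\<omega>. ?F (merge ?J (range e) (u, \<omega>)) \<partial>(\<Pi>\<^sub>M m\<in>range e. lborel))
        = (\<integral>\<^sup>+s. K u (?P *v s + b u) \<partial>lborel)"
      unfolding IJ(1) merge[symmetric] by (intro nn_integral_PiM_vec e(1)) (simp add: comp_def)
    also have "\<dots> = ennreal (1 / \<bar>det ?P\<bar>) * (ennreal \<bar>det ?P\<bar> * (\<integral>\<^sup>+s. K u (?P *v s + b u) \<partial>lborel))"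
      using P by (simp add: mult.assoc[symmetric] ennreal_mult[symmetric])
    also have "ennreal \<bar>det ?P\<bar> * (\<integral>\<^sup>+s. K u (?P *v s + b u) \<partial>lborel) = (\<integral>\<^sup>+y. K u y \<partial>lborel)"
      by (rule nn_integral_affine_vec[OF P, symmetric]) (unfold K_def, measurable)
    finally show "(\<integral>\<^sup>+\<omega>. ?F (merge ?J (range e) (u, \<omega>)) \<partial>(\<Pi>\<^sub>M m\<in>range e. lborel))
        = ennreal (1 / \<bar>det ?P\<bar>) * (\<integral>\<^sup>+y. K u y \<partial>lborel)" .
  qed
  also have "\<dots> = ennreal (1 / \<bar>det ?P\<bar>) * (\<integral>\<^sup>+u. \<integral>\<^sup>+y. K u y \<partial>lborel \<partial>?MJ)"
    by (rule nn_integral_cmult) (use lborel.borel_measurable_nn_integral[OF Km] in simp)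
  also have "(\<integral>\<^sup>+u. \<integral>\<^sup>+y. K u y \<partial>lborel \<partial>?MJ) = (\<integral>\<^sup>+y. \<integral>\<^sup>+u. K u y \<partial>?MJ \<partial>lborel)"
    by (rule Fubini'[symmetric]) (rule Km)
  also have "\<dots> = (\<integral>\<^sup>+y. ennreal (sqrt (2 * pi) ^ card ?J * \<bar>det ?P\<bar>) * (ennreal (gauss_kernel ?C y) * h y) \<partial>lborel)"
  proof (rule nn_integral_cong)
    fix y
    have arg: "matrix_inv ?P *v (y - b u) = matrix_inv ?P *v y - (\<Sum>m\<in>?J. u m *\<^sub>R ?q m)" for u
    proof -
      have "matrix_inv ?P *v (\<Sum>m\<in>?J. u m *\<^sub>R w m) = (\<Sum>m\<in>?J. matrix_inv ?P *v (u m *\<^sub>R w m))"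
        by (rule linear_sum) simp
      then show ?thesis by (simp add: b_def matrix_vector_mult_diff_distrib matrix_vector_mult_scaleR)
    qed
    have "(\<integral>\<^sup>+u. K u y \<partial>?MJ)
        = (\<integral>\<^sup>+u. ennreal (exp (- U u / 2) * gauss_kernel (mat 1) (matrix_inv ?P *v (y - b u))) \<partial>?MJ) * h y"
      unfolding K_def by (rule nn_integral_multc) measurable
    also have "(\<integral>\<^sup>+u. ennreal (exp (- U u / 2) * gauss_kernel (mat 1) (matrix_inv ?P *v (y - b u))) \<partial>?MJ)
        = ennreal (sqrt (2 * pi) ^ card ?J * gauss_kernel ?D (matrix_inv ?P *v y))"
      unfolding arg U_def by (rule conjunct2[OF gauss_kernel_add_modes[OF J covariance_matrix_one]])
    also have "gauss_kernel ?D (matrix_inv ?P *v y) = \<bar>det ?P\<bar> * gauss_kernel ?C y"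
      unfolding det_frame_covariance(4)[OF I e P] using P by simp
    finally show "(\<integral>\<^sup>+u. K u y \<partial>?MJ) = ennreal (sqrt (2 * pi) ^ card ?J * \<bar>det ?P\<bar>) * (ennreal (gauss_kernel ?C y) * h y)"
      using det_frame_covariance(3)[OF I e P]
      by (simp add: ennreal_mult gauss_kernel_nonneg mult.assoc)
  qed
  also have "\<dots> = ennreal (sqrt (2 * pi) ^ card ?J * \<bar>det ?P\<bar>) * (\<integral>\<^sup>+y. ennreal (gauss_kernel ?C y) * h y \<partial>lborel)"
    by (rule nn_integral_cmult) measurable
  also have "ennreal (1 / \<bar>det ?P\<bar>) * (ennreal (sqrt (2 * pi) ^ card ?J * \<bar>det ?P\<bar>) * (\<integral>\<^sup>+y. ennreal (gauss_kernel ?C y) * h y \<partial>lborel))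
      = ennreal (sqrt (2 * pi) ^ card ?J) * (\<integral>\<^sup>+y. ennreal (gauss_kernel ?C y) * h y \<partial>lborel)"
    using P by (simp add: mult.assoc[symmetric] ennreal_mult[symmetric])
  finally show ?thesis .
qed

section \<open>Counting critical points\<close>

text \<open>
  Measurability of the number of zeros of a continuous function depending measurably on a
  parameter.  For compact \<open>S\<close>, whether \<open>F c\<close> vanishes somewhere on \<open>S\<close> is a countable condition, because by
  compactness it suffices that \<open>\<bar>F c\<bar>\<close> takes arbitrarily small values on a countable dense subset.  The number of zeros
  in \<open>T\<close> is the supremum, over finite disjoint families of sets from a countable collection of small
  compact sets, of the number of members of the family on which \<open>F c\<close> vanishes.
\<close>

lemma measurable_count_zeros:
  fixes F :: "'c \<Rightarrow> 'a::euclidean_space \<Rightarrow> 'b::euclidean_space"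
  assumes meas: "\<And>x. (\<lambda>c. F c x) \<in> borel_measurable X"
    and cont: "\<And>c. continuous_on UNIV (F c)"
    and K: "\<And>n::nat. compact (K n)" and T: "T = (\<Union>n. K n)"
  shows "(\<lambda>c. emeasure (count_space UNIV) {x \<in> T. F c x = 0}) \<in> borel_measurable X"
proof -
  define hit where "hit S c \<longleftrightarrow> (\<exists>x\<in>S. F c x = 0)" for S c
  have hit_meas: "{c \<in> space X. hit S c} \<in> sets X" if S: "compact S" for S
  proof -
    obtain D where D: "countable D" "D \<subseteq> S" "S \<subseteq> closure D"
      using separable by blast
    have "hit S c \<longleftrightarrow> (\<forall>i::nat. \<exists>d\<in>D. norm (F c d) < 1 / Suc i)" for c
    proof
      assume "hit S c"
      then obtain x where x: "x \<in> S" "F c x = 0" by (auto simp: hit_def)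
      show "\<forall>i::nat. \<exists>d\<in>D. norm (F c d) < 1 / Suc i"
      proof
        fix i :: nat
        have "continuous (at x) (F c)" using cont by (simp add: continuous_on_eq_continuous_at)
        then obtain r where r: "r > 0" "\<forall>y. dist y x < r \<longrightarrow> dist (F c y) (F c x) < 1 / Suc i"
          unfolding continuous_at_eps_delta by (metis of_nat_0_less_iff zero_less_Suc zero_less_divide_1_iff)
        obtain d where "d \<in> D" "dist d x < r"
          using D(3) x(1) r(1) by (auto simp: closure_approachable subset_iff)
        then show "\<exists>d\<in>D. norm (F c d) < 1 / Suc i" using r(2) x(2) by auto
      qed
    next
      assume *: "\<forall>i::nat. \<exists>d\<in>D. norm (F c d) < 1 / Suc i"
      then have "S \<noteq> {}" using D(2) by blast
      then obtain x where x: "x \<in> S" "\<And>y. y \<in> S \<Longrightarrow> norm (F c x) \<le> norm (F c y)"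
        using continuous_attains_inf[OF S, of "\<lambda>x. norm (F c x)"]
          continuous_on_norm[OF continuous_on_subset[OF cont]] by blast
      have "norm (F c x) = 0"
      proof (rule ccontr)
        assume "norm (F c x) \<noteq> 0"
        then obtain i :: nat where "1 / Suc i < norm (F c x)"
          using nat_approx_posE[of "norm (F c x)"] by auto
        moreover obtain d where "d \<in> D" "norm (F c d) < 1 / Suc i" using * by blast
        ultimately show False using x(2)[of d] D(2) by auto
      qed
      then show "hit S c" using x(1) by (auto simp: hit_def)
    qed
    then have "{c \<in> space X. hit S c} = {c \<in> space X. \<forall>i::nat. \<exists>d\<in>D. norm (F c d) < 1 / Suc i}"
      by auto
    also have "\<dots> \<in> sets X"
    proof (rule sets.sets_Collect_countable_All)
      fix i :: nat
      have "{c \<in> space X. \<exists>d\<in>D. norm (F c d) < 1 / Suc i} = (\<Union>d\<in>D. {c \<in> space X. norm (F c d) < 1 / Suc i})"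
        by auto
      also have "\<dots> \<in> sets X"
      proof (rule sets.countable_UN''[OF D(1)])
        fix d
        note [measurable] = meas[of d]
        show "{c \<in> space X. norm (F c d) < 1 / real (Suc i)} \<in> sets X" by measurable
      qed
      finally show "{c \<in> space X. \<exists>d\<in>D. norm (F c d) < 1 / Suc i} \<in> sets X" .
    qed
    finally show ?thesis .
  qed
  obtain Q :: "'a set" where Q: "countable Q" "\<And>U. open U \<Longrightarrow> U \<noteq> {} \<Longrightarrow> \<exists>q\<in>Q. q \<in> U"
    using countable_dense_exists by blast
  define \<K> where "\<K> = (\<lambda>(n, i, q). K n \<inter> cball q (1 / real (Suc i))) ` (UNIV \<times> UNIV \<times> Q)"
  have "countable \<K>" unfolding \<K>_def using Q(1) by simp
  have \<K>_compact: "compact S" if "S \<in> \<K>" for S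
    using that K by (auto simp: \<K>_def intro!: compact_Int_closed)
  have \<K>_sub: "S \<subseteq> T" if "S \<in> \<K>" for S using that by (auto simp: \<K>_def T)
  define \<F> where "\<F> = {G. finite G \<and> G \<subseteq> \<K> \<and> disjoint G}"
  have "countable \<F>"
    by (rule countable_subset[OF _ countable_Collect_finite_subset[OF \<open>countable \<K>\<close>]]) (auto simp: \<F>_def)
  define h where "h G c = (\<Sum>S\<in>G. indicator {c. hit S c} c :: ennreal)" for G c
  have eq: "emeasure (count_space UNIV) {x \<in> T. F c x = 0} = (SUP G\<in>\<F>. h G c)" for c
  proof (rule antisym)
    let ?A = "{x \<in> T. F c x = 0}"
    have fin: "of_nat (card Z) \<le> (SUP G\<in>\<F>. h G c)" if Z: "finite Z" "Z \<subseteq> ?A" for Z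
    proof -
      have "\<exists>d>0. \<forall>x\<in>Z. x \<noteq> z \<longrightarrow> d \<le> dist z x" for z
        using finite_set_avoid[OF Z(1)] .
      then obtain d where d: "\<And>z. d z > 0" "\<And>z x. x \<in> Z \<Longrightarrow> x \<noteq> z \<Longrightarrow> d z \<le> dist z x" by metis
      define \<epsilon> where "\<epsilon> = Min (insert 1 (d ` Z))"
      have \<epsilon>: "\<epsilon> > 0" "\<And>z. z \<in> Z \<Longrightarrow> \<epsilon> \<le> d z"
        using Z(1) d(1) by (auto simp: \<epsilon>_def)
      (* Two sets of diameter at most 2/(i+1) around zeros at distance \<epsilon> are then disjoint. *)
      obtain i :: nat where i: "1 / Suc i < \<epsilon> / 4" using \<epsilon>(1) nat_approx_posE[of "\<epsilon> / 4"] by auto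
      let ?r = "1 / real (Suc i)"
      have "\<exists>S\<in>\<K>. z \<in> S \<and> S \<subseteq> cball z (2 * ?r)" if z: "z \<in> Z" for z
      proof -
        obtain n where n: "z \<in> K n" using z Z(2) T by auto
        obtain q where q: "q \<in> Q" "q \<in> ball z ?r" using Q(2)[of "ball z ?r"] by auto
        have "K n \<inter> cball q ?r \<in> \<K>" using q(1) by (auto simp: \<K>_def)
        moreover have "z \<in> K n \<inter> cball q ?r" using n q(2) by (auto simp: dist_commute)
        moreover have "K n \<inter> cball q ?r \<subseteq> cball z (2 * ?r)"
        proof
          fix y assume "y \<in> K n \<inter> cball q ?r"
          then have "dist q y \<le> ?r" by simp
          moreover have "dist z q < ?r" using q(2) by simp
          ultimately show "y \<in> cball z (2 * ?r)" using dist_triangle[of z y q] by simp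
        qed
        ultimately show ?thesis by blast
      qed
      then obtain S where S: "\<And>z. z \<in> Z \<Longrightarrow> S z \<in> \<K> \<and> z \<in> S z \<and> S z \<subseteq> cball z (2 * ?r)" by metis
      have disj: "S z \<inter> S z' = {}" if "z \<in> Z" "z' \<in> Z" "z \<noteq> z'" for z z'
      proof (rule ccontr)
        assume "S z \<inter> S z' \<noteq> {}"
        then obtain y where "y \<in> S z" "y \<in> S z'" by auto
        then have "dist z y \<le> 2 * ?r" "dist z' y \<le> 2 * ?r" using S that by force+
        then have "dist z z' \<le> 4 * ?r" using dist_triangle[of z z' y] by (simp add: dist_commute)
        also have "\<dots> < \<epsilon>" using i by simp
        finally show False using d(2)[of z' z] \<epsilon>(2)[of z] that by auto
      qed
      have inj: "inj_on S Z"
        using disj S by (intro inj_onI) blast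
      have "disjoint (S ` Z)"
      proof (rule disjointI)
        fix A B assume "A \<in> S ` Z" "B \<in> S ` Z" and AB: "A \<noteq> B"
        then obtain z z' where z: "z \<in> Z" "z' \<in> Z" "A = S z" "B = S z'" by blast
        with AB have "z \<noteq> z'" by blast
        from disj[OF z(1,2) this] z show "A \<inter> B = {}" by simp
      qed
      moreover have "S ` Z \<subseteq> \<K>" using S by blast
      ultimately have "S ` Z \<in> \<F>"
        using Z(1) by (simp add: \<F>_def)
      moreover have "h (S ` Z) c = of_nat (card Z)"
      proof -
        have "h (S ` Z) c = (\<Sum>z\<in>Z. indicator {c. hit (S z) c} c)"
          unfolding h_def using inj by (simp add: sum.reindex)
        also have "\<dots> = (\<Sum>z\<in>Z. 1)"
        proof (rule sum.cong)
          fix z assume "z \<in> Z"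
          then have "hit (S z) c" using S Z(2) by (auto simp: hit_def)
          then show "(indicator {c. hit (S z) c} c :: ennreal) = 1" by simp
        qed simp
        finally show ?thesis by simp
      qed
      ultimately show ?thesis by (metis SUP_upper)
    qed
    show "emeasure (count_space UNIV) ?A \<le> (SUP G\<in>\<F>. h G c)"
    proof (cases "finite ?A")
      case True
      then show ?thesis using fin[of ?A] by (simp add: emeasure_count_space)
    next
      case False
      have "(SUP G\<in>\<F>. h G c) = top"
      proof (rule ccontr)
        assume "(SUP G\<in>\<F>. h G c) \<noteq> top"
        then obtain n where n: "(SUP G\<in>\<F>. h G c) < of_nat n"
          using ennreal_Ex_less_of_nat[of "SUP G\<in>\<F>. h G c"] unfolding top.not_eq_extremum by blast
        obtain Z where Z: "finite Z" "card Z = n" "Z \<subseteq> ?A"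
          using infinite_arbitrarily_large[OF False] by blast
        from fin[OF Z(1,3)] n show False unfolding Z(2) by (simp only: leD)
      qed
      then show ?thesis by (simp only: top_greatest)
    qed
    show "(SUP G\<in>\<F>. h G c) \<le> emeasure (count_space UNIV) ?A"
    proof (rule SUP_least)
      fix G assume G: "G \<in> \<F>"
      define G' where "G' = {S \<in> G. hit S c}"
      have finG: "finite G" "finite G'" using G by (auto simp: \<F>_def G'_def)
      have "\<exists>x. x \<in> S \<and> F c x = 0" if "S \<in> G'" for S using that by (auto simp: G'_def hit_def)
      then obtain x where x: "\<And>S. S \<in> G' \<Longrightarrow> x S \<in> S \<and> F c (x S) = 0" by metis
      have "inj_on x G'"
      proof (rule inj_onI)
        fix S S' assume S: "S \<in> G'" "S' \<in> G'" "x S = x S'"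
        have a: "x S \<in> S" by (rule conjunct1[OF x[OF S(1)]])
        have "x S' \<in> S'" by (rule conjunct1[OF x[OF S(2)]])
        then have b: "x S \<in> S'" by (simp only: S(3))
        have G3: "S \<in> G" "S' \<in> G" using S(1,2) by (simp_all add: G'_def)
        have dG: "disjoint G" using G by (simp add: \<F>_def)
        show "S = S'"
        proof (rule ccontr)
          assume "S \<noteq> S'"
          have "S \<inter> S' = {}" by (rule disjointD[OF dG G3 \<open>S \<noteq> S'\<close>])
          then show False using IntI[OF a b] by simp
        qed
      qed
      have "h G c = (\<Sum>S\<in>G. if hit S c then 1 else 0)"
        unfolding h_def by (rule sum.cong) auto
      also have "\<dots> = (\<Sum>S\<in>G'. 1)"
        unfolding G'_def by (rule sum.inter_filter[OF finG(1), symmetric])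
      also have "\<dots> = of_nat (card (x ` G'))" using \<open>inj_on x G'\<close> by (simp add: card_image)
      also have "\<dots> = emeasure (count_space UNIV) (x ` G')" using finG by (simp add: emeasure_count_space_finite)
      also have "\<dots> \<le> emeasure (count_space UNIV) ?A"
        using x G \<K>_sub by (intro emeasure_mono) (auto simp: G'_def \<F>_def)
      finally show "h G c \<le> emeasure (count_space UNIV) ?A" .
    qed
  qed
  have "(\<lambda>c. SUP G\<in>\<F>. h G c) \<in> borel_measurable X"
  proof (rule borel_measurable_SUP[OF \<open>countable \<F>\<close>])
    fix G assume G: "G \<in> \<F>"
    show "h G \<in> borel_measurable X"
      unfolding h_def[abs_def]
    proof (rule borel_measurable_sum)
      fix S assume "S \<in> G"
      then have "{c \<in> space X. hit S c} \<in> sets X" using G \<K>_compact by (intro hit_meas) (auto simp: \<F>_def)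
      then have "(indicator {c \<in> space X. hit S c} :: _ \<Rightarrow> ennreal) \<in> borel_measurable X" by simp
      then show "(\<lambda>c. indicator {c. hit S c} c :: ennreal) \<in> borel_measurable X"
        by (rule measurable_cong[THEN iffD1, rotated]) (auto simp: indicator_def)
    qed
  qed
  then show ?thesis unfolding eq .
qed

lemma torus_sigma_compact:
  "(torus :: (real^'n::finite) set) = (\<Union>n::nat. cbox 0 (\<chi> j. 2 * pi - 1 / Suc n))"
proof (intro equalityI subsetI)
  fix x :: "real^'n" assume x: "x \<in> torus"
  have "finite (range (\<lambda>j. 2 * pi - x $ j))" by simp
  define m where "m = Min (range (\<lambda>j. 2 * pi - x $ j))"
  have "m > 0" using x by (simp add: m_def torus_def)
  then obtain n :: nat where n: "1 / Suc n < m" using nat_approx_posE by blast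
  have "m \<le> 2 * pi - x $ j" for j unfolding m_def by (rule Min_le) auto
  then have "x $ j \<le> 2 * pi - 1 / Suc n" for j
    using n by (smt (verit))
  then have "x \<in> cbox 0 (\<chi> j. 2 * pi - 1 / Suc n)"
    using x unfolding mem_box_cart torus_def by simp
  then show "x \<in> (\<Union>n::nat. cbox 0 (\<chi> j. 2 * pi - 1 / Suc n))" by blast
next
  fix x :: "real^'n" assume "x \<in> (\<Union>n::nat. cbox 0 (\<chi> j. 2 * pi - 1 / Suc n))"
  then obtain n :: nat where n: "\<And>j. 0 \<le> x $ j \<and> x $ j \<le> 2 * pi - 1 / Suc n" by (auto simp: mem_box_cart)
  have "1 / real (Suc n) > 0" by simp
  then show "x \<in> torus" using n unfolding torus_def by (smt (verit, best) mem_Collect_eq)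
qed

lemma torus_borel[measurable]: "torus \<in> sets borel"
  unfolding torus_sigma_compact by measurable

lemma emeasure_torus: "emeasure lborel (torus :: (real^'n::finite) set) = ennreal ((2 * pi) ^ CARD('n))"
proof -
  let ?b = "(\<chi> j. 2 * pi) :: real^'n"
  have "box 0 ?b \<subseteq> torus" "torus \<subseteq> cbox 0 ?b"
    by (auto simp: torus_def mem_box_cart less_imp_le)
  have "emeasure lborel (box 0 ?b) \<le> emeasure lborel (torus :: (real^'n) set)"
    by (rule emeasure_mono) (use \<open>box 0 ?b \<subseteq> torus\<close> in simp_all)
  moreover have "emeasure lborel (torus :: (real^'n) set) \<le> emeasure lborel (cbox 0 ?b)"
    by (rule emeasure_mono) (use \<open>torus \<subseteq> cbox 0 ?b\<close> in simp_all)
  ultimately have bounds: "emeasure lborel (box 0 ?b) \<le> emeasure lborel (torus :: (real^'n) set)"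
    "emeasure lborel (torus :: (real^'n) set) \<le> emeasure lborel (cbox 0 ?b)" by auto
  have le: "0 \<bullet> b \<le> ?b \<bullet> b" if "b \<in> Basis" for b
    using that by (auto simp: Basis_vec_def inner_axis)
  have prod: "(\<Prod>b\<in>Basis. (?b - 0) \<bullet> b) = (2 * pi) ^ CARD('n)"
    by (simp add: prod_Basis_vec inner_axis)
  have "emeasure lborel (box 0 ?b) = ennreal ((2 * pi) ^ CARD('n))"
    unfolding prod[symmetric] by (rule emeasure_lborel_box) (rule le)
  moreover have "emeasure lborel (cbox 0 ?b) = ennreal ((2 * pi) ^ CARD('n))"
    unfolding prod[symmetric] by (rule emeasure_lborel_cbox) (rule le)
  ultimately show ?thesis using bounds by (intro antisym) simp_all
qed

definition rvec :: "int^'n \<Rightarrow> real^'n" where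
  "rvec m = (\<chi> j. of_int (m $ j))"

text \<open>
  The common factor of the normalised modes.  It depends on \<open>M\<close> only through the dimension, which
  is carried by the type.
\<close>

definition amp :: "(int^'n::finite) set \<Rightarrow> real" where
  "amp M = sqrt 2 / (2 * pi) powr (real CARD('n) / 2)"

lemma amp_pos: "amp M > 0"
  by (simp add: amp_def)

lemma amp_square: "(amp (M :: (int^'n::finite) set))\<^sup>2 = 2 / (2 * pi) ^ CARD('n)"
proof -
  have "((2 * pi) powr (real CARD('n) / 2))\<^sup>2 = (2 * pi) powr real CARD('n)"
    by (simp add: power2_eq_square powr_add[symmetric])
  then show ?thesis by (simp add: amp_def power_divide powr_realpow)
qed

lemma phase_eq: "(\<Sum>j\<in>UNIV. of_int (m $ j) * x $ j) = rvec m \<bullet> x"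
  by (simp add: rvec_def inner_vec_def)

text \<open>
  The sum of the first components of the rotated pairs; the derivative is accordingly expressed by
  the second components.
\<close>

lemma trig_comb_eq:
  "trig_comb M c x = amp M * (\<Sum>m\<in>M. fst (rot2 (rvec m \<bullet> x) (c m)))"
  unfolding trig_comb_def A_fun_def B_fun_def phase_eq amp_def[symmetric, where M=M] sum_distrib_left
  by (rule sum.cong) (auto simp: rot2_def algebra_simps)

text \<open>
  The gradient of \<open>trig_comb M c\<close> at \<open>x\<close> without the factor \<open>amp M\<close>.
\<close>

definition crit_field :: "(int^'n::finite) set \<Rightarrow> (int^'n \<Rightarrow> real \<times> real) \<Rightarrow> real^'n \<Rightarrow> real^'n" where
  "crit_field M c x = (\<Sum>m\<in>M. snd (rot2 (rvec m \<bullet> x) (c m)) *\<^sub>R rvec m)"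

lemma trig_comb_has_derivative:
  "(trig_comb M c has_derivative (\<lambda>h. amp M * (crit_field M c x \<bullet> h))) (at x)"
proof -
  have 1: "((\<lambda>x. fst (rot2 (rvec m \<bullet> x) (c m))) has_derivative
      (\<lambda>h. snd (rot2 (rvec m \<bullet> x) (c m)) * (rvec m \<bullet> h))) (at x)" for m
    unfolding rot2_def by (auto intro!: derivative_eq_intros simp: algebra_simps)
  have "((\<lambda>x. amp M * (\<Sum>m\<in>M. fst (rot2 (rvec m \<bullet> x) (c m)))) has_derivative
      (\<lambda>h. amp M * (\<Sum>m\<in>M. snd (rot2 (rvec m \<bullet> x) (c m)) * (rvec m \<bullet> h)))) (at x)"
    by (intro has_derivative_mult_right has_derivative_sum 1)
  then show ?thesis
    unfolding trig_comb_eq[abs_def] crit_field_def inner_sum_left inner_scaleR_left .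
qed

lemma critical_points_trig_comb:
  "critical_points (trig_comb M c) = {x \<in> torus. crit_field M c x = 0}"
proof -
  have "(trig_comb M c has_derivative (\<lambda>h. 0)) (at x) \<longleftrightarrow> crit_field M c x = 0" for x
  proof
    assume "(trig_comb M c has_derivative (\<lambda>h. 0)) (at x)"
    then have "(\<lambda>h. amp M * (crit_field M c x \<bullet> h)) = (\<lambda>h. 0)"
      using trig_comb_has_derivative has_derivative_unique by blast
    then have "amp M * (crit_field M c x \<bullet> crit_field M c x) = 0" by metis
    then show "crit_field M c x = 0" using amp_pos[of M] by auto
  next
    assume "crit_field M c x = 0"
    then show "(trig_comb M c has_derivative (\<lambda>h. 0)) (at x)"
      using trig_comb_has_derivative[of M c x] by simp
  qed
  then show ?thesis by (auto simp: critical_points_def)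
qed

lemma borel_measurable_PiM_fst_snd:
  assumes "m \<in> I"
  shows "(\<lambda>u. fst (u m)) \<in> borel_measurable (\<Pi>\<^sub>M i\<in>I. (lborel :: (real \<times> real) measure))"
    and "(\<lambda>u. snd (u m)) \<in> borel_measurable (\<Pi>\<^sub>M i\<in>I. (lborel :: (real \<times> real) measure))"
proof -
  have 1: "fst \<in> borel_measurable (borel :: (real \<times> real) measure)"
    and 2: "snd \<in> borel_measurable (borel :: (real \<times> real) measure)"
    by (intro borel_measurable_continuous_onI continuous_intros)+
  show "(\<lambda>u. fst (u m)) \<in> borel_measurable (\<Pi>\<^sub>M i\<in>I. (lborel :: (real \<times> real) measure))"
    using measurable_comp[OF borel_measurable_PiM_component[OF assms] 1] by (simp add: comp_def)
  show "(\<lambda>u. snd (u m)) \<in> borel_measurable (\<Pi>\<^sub>M i\<in>I. (lborel :: (real \<times> real) measure))"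
    using measurable_comp[OF borel_measurable_PiM_component[OF assms] 2] by (simp add: comp_def)
qed

lemma borel_measurable_num_critical:
  fixes M :: "(int^'n::finite) set"
  shows "(\<lambda>c. num_critical (trig_comb M c)) \<in> borel_measurable (\<Pi>\<^sub>M m\<in>M. lborel)"
  unfolding num_critical_def critical_points_trig_comb
proof (rule measurable_count_zeros[OF _ _ _ torus_sigma_compact])
  show "continuous_on UNIV (crit_field M c)" for c :: "int^'n \<Rightarrow> real \<times> real"
    unfolding crit_field_def[abs_def] rot2_def by (simp, intro continuous_intros)
  show "(\<lambda>c. crit_field M c x) \<in> borel_measurable (\<Pi>\<^sub>M m\<in>M. lborel)" for x
    unfolding crit_field_def rot2_def snd_conv
    by (intro borel_measurable_sum borel_measurable_scaleR borel_measurable_diff borel_measurable_times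
        borel_measurable_PiM_fst_snd borel_measurable_const)
qed simp

section \<open>The Kac-Rice formula\<close>

lemma sum_UNIV_Plus: "(\<Sum>i\<in>UNIV. f i) = (\<Sum>k\<in>UNIV. f (Inl k)) + (\<Sum>k\<in>UNIV. f (Inr k))"
  for f :: "'a::finite + 'b::finite \<Rightarrow> 'c::comm_monoid_add"
  by (simp add: UNIV_Plus_UNIV[symmetric] sum.Plus comp_def del: UNIV_Plus_UNIV)

lemma prod_UNIV_Plus: "(\<Prod>i\<in>UNIV. f i) = (\<Prod>k\<in>UNIV. f (Inl k)) * (\<Prod>k\<in>UNIV. f (Inr k))"
  for f :: "'a::finite + 'b::finite \<Rightarrow> 'c::comm_monoid_mult"
  by (simp add: UNIV_Plus_UNIV[symmetric] prod.Plus comp_def del: UNIV_Plus_UNIV)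

text \<open>
  \<open>real ^ ('a + 'b)\<close> serves as the product of \<open>real ^ 'a\<close> and \<open>real ^ 'b\<close>: the area formula is about
  maps of a space of the form \<open>real ^ 'k\<close> into itself.
\<close>

definition vjoin :: "real^'a::finite \<Rightarrow> real^'b::finite \<Rightarrow> real^('a + 'b)" where
  "vjoin s x = (\<chi> i. case i of Inl k \<Rightarrow> s $ k | Inr k \<Rightarrow> x $ k)"

definition lpart :: "real^('a::finite + 'b::finite) \<Rightarrow> real^'a" where
  "lpart z = (\<chi> k. z $ Inl k)"

definition rpart :: "real^('a::finite + 'b::finite) \<Rightarrow> real^'b" where
  "rpart z = (\<chi> k. z $ Inr k)"

lemma vjoin_nth[simp]: "vjoin s x $ Inl k = s $ k" "vjoin s x $ Inr l = x $ l"
  by (simp_all add: vjoin_def)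

lemma part_nth[simp]: "lpart z $ k = z $ Inl k" "rpart z $ l = z $ Inr l"
  by (simp_all add: lpart_def rpart_def)

lemma parts_vjoin[simp]: "lpart (vjoin s x) = s" "rpart (vjoin s x) = x"
  by (simp_all add: vec_eq_iff)

lemma vjoin_parts[simp]: "vjoin (lpart z) (rpart z) = z"
  by (simp add: vec_eq_iff vjoin_def split: sum.split)

lemma bounded_linear_parts:
  "bounded_linear (lpart :: real^('a::finite + 'b::finite) \<Rightarrow> real^'a)"
  "bounded_linear (rpart :: real^('a::finite + 'b::finite) \<Rightarrow> real^'b)"
  by (auto simp: vec_eq_iff intro!: linear_conv_bounded_linear[THEN iffD1] linearI)

lemma measurable_vjoin:
  "(\<lambda>p. vjoin (snd p) (fst p)) \<in> borel_measurable (borel \<Otimes>\<^sub>M borel :: ((real^'b::finite) \<times> (real^'a::finite)) measure)"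
proof -
  have lin: "linear (\<lambda>p :: (real^'b) \<times> (real^'a). vjoin (snd p) (fst p))"
    by (rule linearI) (auto simp: vec_eq_iff vjoin_def split: sum.split)
  show ?thesis
    unfolding borel_prod
    by (intro borel_measurable_continuous_onI linear_continuous_on linear_conv_bounded_linear[THEN iffD1] lin)
qed

lemma emeasure_box_vec:
  fixes l u :: "real^'k::finite"
  assumes "\<And>k. l $ k \<le> u $ k"
  shows "emeasure lborel (box l u) = ennreal (\<Prod>k\<in>UNIV. u $ k - l $ k)"
proof -
  have "l \<bullet> b \<le> u \<bullet> b" if "b \<in> Basis" for b
    using that assms by (auto simp: Basis_vec_def inner_axis)
  from emeasure_lborel_box[OF this] show ?thesis
    by (simp add: prod_Basis_vec inner_axis)
qed

lemma distr_vjoin: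
  "distr (lborel \<Otimes>\<^sub>M lborel) borel (\<lambda>p. vjoin (snd p) (fst p)) = (lborel :: (real^('a::finite + 'b::finite)) measure)"
proof (rule lborel_eqI[symmetric])
  fix l u :: "real^('a + 'b)"
  assume le: "\<And>b. b \<in> Basis \<Longrightarrow> l \<bullet> b \<le> u \<bullet> b"
  have le': "l $ i \<le> u $ i" for i
    using le[of "axis i 1"] by (simp add: inner_axis axis_in_Basis_iff)
  have vim: "(\<lambda>p. vjoin (snd p) (fst p)) -` box l u = box (rpart l) (rpart u) \<times> box (lpart l) (lpart u)"
    by (auto simp: mem_box_cart) (metis old.sum.exhaust vjoin_nth)+
  note c = emeasure_box_vec
  have "emeasure (distr (lborel \<Otimes>\<^sub>M lborel) borel (\<lambda>p. vjoin (snd p) (fst p))) (box l u)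
      = emeasure (lborel \<Otimes>\<^sub>M lborel) (box (rpart l) (rpart u) \<times> box (lpart l) (lpart u))"
    by (subst emeasure_distr) (use measurable_vjoin in \<open>simp_all add: vim space_pair_measure cong: measurable_cong_sets\<close>)
  also have "\<dots> = emeasure lborel (box (rpart l) (rpart u)) * emeasure lborel (box (lpart l) (lpart u))"
    by (rule lborel.emeasure_pair_measure_Times) auto
  also have "\<dots> = ennreal (\<Prod>i\<in>UNIV. u $ i - l $ i)"
    using le' by (simp add: c prod_UNIV_Plus ennreal_mult[symmetric] prod_nonneg mult.commute)
  also have "(\<Prod>i\<in>UNIV. u $ i - l $ i) = (\<Prod>b\<in>Basis. (u - l) \<bullet> b)"
    by (simp add: prod_Basis_vec inner_axis)
  finally show "emeasure (distr (lborel \<Otimes>\<^sub>M lborel) borel (\<lambda>p. vjoin (snd p) (fst p))) (box l u) = (\<Prod>b\<in>Basis. (u - l) \<bullet> b)" .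
qed simp

lemma nn_integral_vjoin:
  fixes f :: "real^('a::finite + 'b::finite) \<Rightarrow> ennreal"
  assumes f: "f \<in> borel_measurable borel"
  shows "(\<integral>\<^sup>+z. f z \<partial>lborel) = (\<integral>\<^sup>+x. \<integral>\<^sup>+s. f (vjoin s x) \<partial>lborel \<partial>lborel)"
proof -
  have m: "(\<lambda>p. vjoin (snd p) (fst p)) \<in> lborel \<Otimes>\<^sub>M lborel \<rightarrow>\<^sub>M (borel :: (real^('a + 'b)) measure)"
    using measurable_vjoin by (simp cong: measurable_cong_sets sets_pair_measure_cong)
  have "(\<integral>\<^sup>+z. f z \<partial>lborel) = (\<integral>\<^sup>+p. f (vjoin (snd p) (fst p)) \<partial>(lborel \<Otimes>\<^sub>M lborel))"
    unfolding distr_vjoin[symmetric] using f by (intro nn_integral_distr[OF m]) simp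
  also have "\<dots> = (\<integral>\<^sup>+x. \<integral>\<^sup>+s. f (vjoin s x) \<partial>lborel \<partial>lborel)"
    using lborel.nn_integral_fst[symmetric, OF measurable_comp[OF m f]] by (simp add: comp_def)
  finally show ?thesis .
qed

text \<open>
  The left half of \<open>w\<close> holds the cosine coefficients and the right half the sine coefficients.
\<close>

definition pair_coords :: "('k::finite \<Rightarrow> 'i) \<Rightarrow> real^('k + 'k) \<Rightarrow> 'i \<Rightarrow> real \<times> real" where
  "pair_coords e w = (\<lambda>i\<in>range e. (w $ Inl (inv e i), w $ Inr (inv e i)))"

lemma pair_coords_vjoin: "pair_coords e (vjoin a b) = (\<lambda>i\<in>range e. (vec_coords e a i, vec_coords e b i))"
  by (auto simp: pair_coords_def vec_coords_def fun_eq_iff)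

lemma measurable_pair_coords:
  "pair_coords e \<in> borel \<rightarrow>\<^sub>M (\<Pi>\<^sub>M i\<in>range e. (lborel :: (real \<times> real) measure))"
  unfolding pair_coords_def
  by (rule measurable_restrict) (auto intro!: borel_measurable_continuous_onI continuous_intros)

lemma nn_integral_PiM_pair_vec:
  fixes e :: "'k::finite \<Rightarrow> 'i"
  assumes e: "inj e" and f: "f \<in> borel_measurable (\<Pi>\<^sub>M i\<in>range e. (lborel :: (real \<times> real) measure))"
  shows "(\<integral>\<^sup>+\<omega>. f \<omega> \<partial>(\<Pi>\<^sub>M i\<in>range e. lborel)) = (\<integral>\<^sup>+w. f (pair_coords e w) \<partial>lborel)"
proof -
  interpret R: product_sigma_finite "\<lambda>_::'i. lborel :: real measure"
    by (rule product_sigma_finite_lborel)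
  let ?R = "\<Pi>\<^sub>M i\<in>range e. (lborel :: real measure)"
  interpret RI: sigma_finite_measure ?R by (rule R.sigma_finite) simp
  have fp: "(\<lambda>w. f (pair_coords e w)) \<in> borel_measurable borel"
    using measurable_comp[OF measurable_pair_coords f] by (simp add: comp_def)
  have pm: "(\<lambda>p. \<lambda>i\<in>range e. (fst p i, snd p i)) \<in> ?R \<Otimes>\<^sub>M ?R \<rightarrow>\<^sub>M (\<Pi>\<^sub>M i\<in>range e. lborel)"
  proof (rule measurable_restrict)
    fix i assume i: "i \<in> range e"
    note [measurable] = measurable_component_singleton[OF i, of "\<lambda>_. lborel :: real measure"]
    have "(\<lambda>x. (fst x i, snd x i)) \<in> ?R \<Otimes>\<^sub>M ?R \<rightarrow>\<^sub>M (lborel \<Otimes>\<^sub>M lborel)"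
      by measurable
    then show "(\<lambda>x. (fst x i, snd x i)) \<in> ?R \<Otimes>\<^sub>M ?R \<rightarrow>\<^sub>M lborel"
      unfolding lborel_prod .
  qed
  have fpm: "(\<lambda>p. f (\<lambda>i\<in>range e. (fst p i, snd p i))) \<in> borel_measurable (?R \<Otimes>\<^sub>M ?R)"
    using measurable_comp[OF pm f] by (simp add: comp_def)
  have "(\<integral>\<^sup>+\<omega>. f \<omega> \<partial>(\<Pi>\<^sub>M i\<in>range e. lborel)) = (\<integral>\<^sup>+a. \<integral>\<^sup>+b. f (\<lambda>i\<in>range e. (a i, b i)) \<partial>?R \<partial>?R)"
    by (rule nn_integral_PiM_pairs) (simp_all add: f)
  also have "\<dots> = (\<integral>\<^sup>+b. \<integral>\<^sup>+a. f (\<lambda>i\<in>range e. (a i, b i)) \<partial>?R \<partial>?R)"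
  proof -
    interpret pair_sigma_finite ?R ?R ..
    show ?thesis using Fubini'[of "\<lambda>a b. f (\<lambda>i\<in>range e. (a i, b i))"] fpm
      by (simp add: case_prod_beta')
  qed
  also have "\<dots> = (\<integral>\<^sup>+b. \<integral>\<^sup>+s. f (\<lambda>i\<in>range e. (vec_coords e s i, b i)) \<partial>lborel \<partial>?R)"
  proof (rule nn_integral_cong)
    fix b assume b: "b \<in> space ?R"
    have "(\<lambda>a. f (\<lambda>i\<in>range e. (a i, b i))) \<in> borel_measurable ?R"
      using measurable_comp[OF measurable_Pair2'[OF b] fpm] by (simp add: comp_def)
    then show "(\<integral>\<^sup>+a. f (\<lambda>i\<in>range e. (a i, b i)) \<partial>?R) = (\<integral>\<^sup>+s. f (\<lambda>i\<in>range e. (vec_coords e s i, b i)) \<partial>lborel)"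
      by (rule nn_integral_PiM_vec[OF e])
  qed
  also have "\<dots> = (\<integral>\<^sup>+x. \<integral>\<^sup>+s. f (\<lambda>i\<in>range e. (vec_coords e s i, vec_coords e x i)) \<partial>lborel \<partial>lborel)"
  proof (rule nn_integral_PiM_vec[OF e])
    have v: "vec_coords e \<in> lborel \<rightarrow>\<^sub>M ?R"
      using measurable_vec_coords[OF e] by simp
    have "(\<lambda>p. (vec_coords e (snd p), fst p)) \<in> ?R \<Otimes>\<^sub>M lborel \<rightarrow>\<^sub>M ?R \<Otimes>\<^sub>M ?R"
      by (intro measurable_Pair measurable_compose[OF measurable_snd v] measurable_fst)
    from measurable_comp[OF this fpm]
    have "(\<lambda>(b, s). f (\<lambda>i\<in>range e. (vec_coords e s i, b i))) \<in> borel_measurable (?R \<Otimes>\<^sub>M lborel)"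
      by (simp add: comp_def case_prod_beta')
    then show "(\<lambda>b. \<integral>\<^sup>+s. f (\<lambda>i\<in>range e. (vec_coords e s i, b i)) \<partial>lborel) \<in> borel_measurable ?R"
      by (rule lborel.borel_measurable_nn_integral)
  qed
  also have "\<dots> = (\<integral>\<^sup>+x. \<integral>\<^sup>+s. f (pair_coords e (vjoin s x)) \<partial>lborel \<partial>lborel)"
    by (simp only: pair_coords_vjoin)
  also have "\<dots> = (\<integral>\<^sup>+w. f (pair_coords e w) \<partial>lborel)"
    by (rule nn_integral_vjoin[OF fp, symmetric])
  finally show ?thesis .
qed

lemma sum_squares_rotation:
  fixes a b c s :: real
  assumes "s\<^sup>2 + c\<^sup>2 = 1"
  shows "(a * c - b * s)\<^sup>2 + (a * s + b * c)\<^sup>2 = a\<^sup>2 + b\<^sup>2"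
proof -
  have "(a * c - b * s)\<^sup>2 + (a * s + b * c)\<^sup>2 = (a\<^sup>2 + b\<^sup>2) * (s\<^sup>2 + c\<^sup>2)"
    by (simp only: power2_eq_square) (simp add: algebra_simps)
  then show ?thesis using assms by simp
qed

lemma norm_rot2: "(norm (rot2 t p))\<^sup>2 = (norm p)\<^sup>2"
proof -
  obtain a b where p: "p = (a, b)" by (cases p)
  show ?thesis
    using sum_squares_rotation[of "sin t" "cos t" b a] sin_cos_squared_add[of t]
    by (simp add: p rot2_def norm_prod_def add.commute)
qed

lemma rot2_inverse: "a * cos t - b * sin t = c \<and> a * sin t + b * cos t = d
    \<longleftrightarrow> (a, b) = rot2 t (c, d)"
proof -
  have sc: "sin t * sin t = 1 - cos t * cos t"
    using sin_cos_squared_add[of t] by (simp add: power2_eq_square)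
  show ?thesis
  proof
    assume h: "a * cos t - b * sin t = c \<and> a * sin t + b * cos t = d"
    then have cd: "c = a * cos t - b * sin t" "d = a * sin t + b * cos t" by simp_all
    have "c * cos t + d * sin t = a * (cos t * cos t + sin t * sin t)"
      "d * cos t - c * sin t = b * (cos t * cos t + sin t * sin t)"
      unfolding cd by (simp_all add: algebra_simps sc)
    then show "(a, b) = rot2 t (c, d)" by (simp add: rot2_def sc)
  next
    assume "(a, b) = rot2 t (c, d)"
    then have ab: "a = c * cos t + d * sin t" "b = d * cos t - c * sin t"
      by (simp_all add: rot2_def)
    have "a * cos t - b * sin t = c * (cos t * cos t + sin t * sin t)"
      "a * sin t + b * cos t = d * (cos t * cos t + sin t * sin t)"
      unfolding ab by (simp_all add: algebra_simps sc)
    then show "a * cos t - b * sin t = c \<and> a * sin t + b * cos t = d" by (simp add: sc)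
  qed
qed

lemma norm_vec_sum_squares: "(norm w)\<^sup>2 = (\<Sum>i\<in>UNIV. (w $ i)\<^sup>2)" for w :: "real^'k"
  unfolding power2_norm_eq_inner by (simp add: inner_vec_def power2_eq_square)

lemma integrable_gauss_norm: "integrable lborel (\<lambda>w. exp (- (norm (w::real^'k))\<^sup>2 / 2))"
proof -
  interpret product_sigma_finite "\<lambda>_::'k. lborel :: real measure"
    by (rule product_sigma_finite_lborel)
  have "(\<integral>\<^sup>+w. ennreal (exp (- (norm (w::real^'k))\<^sup>2 / 2)) \<partial>lborel) < \<infinity>"
  proof -
    have "(\<integral>\<^sup>+w. ennreal (exp (- (norm (w::real^'k))\<^sup>2 / 2)) \<partial>lborel)
        = (\<integral>\<^sup>+w. (\<Prod>b\<in>Basis. ennreal (exp (- ((w::real^'k) \<bullet> b)\<^sup>2 / 2))) \<partial>lborel)"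
    proof (rule nn_integral_cong)
      fix w :: "real^'k"
      have "(norm w)\<^sup>2 = (\<Sum>b\<in>Basis. (w \<bullet> b)\<^sup>2)"
        unfolding power2_norm_eq_inner by (subst euclidean_inner) (simp add: power2_eq_square)
      then have "exp (- (norm w)\<^sup>2 / 2) = (\<Prod>b\<in>Basis. exp (- (w \<bullet> b)\<^sup>2 / 2))"
        by (simp add: exp_sum[symmetric] sum_negf sum_divide_distrib)
      then show "ennreal (exp (- (norm w)\<^sup>2 / 2)) = (\<Prod>b\<in>Basis. ennreal (exp (- (w \<bullet> b)\<^sup>2 / 2)))"
        by (simp add: prod_ennreal)
    qed
    also have "\<dots> = (\<Prod>b\<in>(Basis::(real^'k) set). (\<integral>\<^sup>+t. ennreal (exp (- t\<^sup>2 / 2)) \<partial>lborel))"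
      by (rule nn_integral_lborel_prod) auto
    also have "(\<integral>\<^sup>+t. ennreal (exp (- t\<^sup>2 / 2)) \<partial>lborel) = ennreal (sqrt (2 * pi))"
      using nn_integral_gauss_quadratic[of 1 0] by simp
    also have "(\<Prod>b\<in>(Basis::(real^'k) set). ennreal (sqrt (2 * pi))) < \<infinity>"
      by (simp add: ennreal_power less_top[symmetric])
    finally show ?thesis .
  qed
  then show ?thesis by (intro integrableI_nonneg) auto
qed

lemma borel_measurable_gaussian_hessian:
  fixes M :: "(int^'n::finite) set"
  shows "(\<lambda>\<alpha>. ennreal (exp (- (\<Sum>m\<in>M. (\<alpha> m)\<^sup>2) / 2) * \<bar>det (\<Sum>m\<in>M. \<alpha> m *\<^sub>R outer (rvec m))\<bar>))
    \<in> borel_measurable (\<Pi>\<^sub>M m\<in>M. lborel)"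
proof -
  note [measurable] = borel_measurable_PiM_sum_squares[OF subset_refl, of M]
  have h: "(\<lambda>\<alpha>. (\<Sum>m\<in>M. \<alpha> m *\<^sub>R outer (rvec m)) $ i $ j) \<in> borel_measurable (\<Pi>\<^sub>M m\<in>M. lborel)" for i j
    unfolding sum_component vector_scaleR_component
    by (intro borel_measurable_sum borel_measurable_scaleR borel_measurable_PiM_component borel_measurable_const)
  have [measurable]: "(\<lambda>\<alpha>. det (\<Sum>m\<in>M. \<alpha> m *\<^sub>R outer (rvec m))) \<in> borel_measurable (\<Pi>\<^sub>M m\<in>M. lborel)"
    unfolding det_def by (intro borel_measurable_sum borel_measurable_times borel_measurable_prod h borel_measurable_const)
  show ?thesis by measurable
qed

text \<open>
  \<open>e\<close> selects modes that form a basis of \<open>\<real>\<^sup>L\<close>.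
\<close>

locale mode_frame =
  fixes M :: "(int^'n::finite) set" and e :: "'n \<Rightarrow> int^'n"
  assumes finM: "finite M" and inj_e: "inj e" and e_sub: "range e \<subseteq> M"
    and detP: "det (frame_matrix rvec e) \<noteq> 0"
begin

text \<open>
  \<open>J\<close> is the set of the other modes, and \<open>q m\<close> consists of the coordinates of the mode \<open>m\<close> in the
  selected basis.
\<close>

definition J where "J = M - range e"
definition P where "P = frame_matrix rvec e"
definition q where "q m = matrix_inv P *v rvec m"
text \<open>
  The rotated sine coefficients which the selected modes must have in order that the gradient
  vanish, when the other modes have rotated coefficients \<open>v\<close>.
\<close>

definition forced_sine :: "(int^'n \<Rightarrow> real \<times> real) \<Rightarrow> real^'n" where
  "forced_sine v = - (\<Sum>m\<in>J. snd (v m) *\<^sub>R q m)"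
definition rotate_rest :: "real^'n \<Rightarrow> (int^'n \<Rightarrow> real \<times> real) \<Rightarrow> int^'n \<Rightarrow> real \<times> real" where
  "rotate_rest x u = (\<lambda>m\<in>J. rot2 (rvec m \<bullet> x) (u m))"
text \<open>
  The negative Hessian, without the factor \<open>amp M\<close>, at a point where the selected modes have rotated
  cosine coefficients \<open>s\<close> and the other modes have rotated coefficients \<open>v\<close>.
\<close>

definition hessian_form :: "real^'n \<Rightarrow> (int^'n \<Rightarrow> real \<times> real) \<Rightarrow> real^'n^'n" where
  "hessian_form s v = (\<Sum>k\<in>UNIV. (s $ k) *\<^sub>R outer (rvec (e k))) + (\<Sum>m\<in>J. fst (v m) *\<^sub>R outer (rvec m))"
definition forced_sine_at :: "(int^'n \<Rightarrow> real \<times> real) \<Rightarrow> real^'n \<Rightarrow> real^'n" where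
  "forced_sine_at u x = forced_sine (rotate_rest x u)"
definition frame_phase :: "real^('n + 'n) \<Rightarrow> 'n \<Rightarrow> real" where
  "frame_phase z k = rvec (e k) \<bullet> rpart z"

text \<open>
  For fixed coefficients \<open>u\<close> of the other modes, this parametrises the pairs of a coefficient vector
  of the selected modes and a critical point of the resulting function.  The parameter \<open>z\<close> consists
  of the rotated cosine coefficients and of the point \<open>x\<close>; the rotated sine coefficients are forced, and
  the value consists of the coefficients obtained by rotating back.
\<close>

definition critical_param :: "(int^'n \<Rightarrow> real \<times> real) \<Rightarrow> real^('n + 'n) \<Rightarrow> real^('n + 'n)" where
  "critical_param u z = vjoin (\<chi> k. z $ Inl k * cos (frame_phase z k) - forced_sine_at u (rpart z) $ k * sin (frame_phase z k))
                 (\<chi> k. z $ Inl k * sin (frame_phase z k) + forced_sine_at u (rpart z) $ k * cos (frame_phase z k))"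

text \<open>
  The derivative with respect to the point, after undoing the rotation, of the component that carries
  the sine coefficients.
\<close>

definition gradient_block :: "(int^'n \<Rightarrow> real \<times> real) \<Rightarrow> real^('n + 'n) \<Rightarrow> real^'n^'n" where
  "gradient_block u z = (\<chi> k j. z $ Inl k * rvec (e k) $ j + (\<Sum>m\<in>J. fst (rotate_rest (rpart z) u m) * q m $ k * rvec m $ j))"

definition frame_rotation :: "real^('n + 'n) \<Rightarrow> real^('n + 'n)^('n + 'n)" where
  "frame_rotation z = (\<chi> i j. case i of
      Inl k \<Rightarrow> (case j of Inl l \<Rightarrow> if l = k then cos (frame_phase z k) else 0 | Inr l \<Rightarrow> if l = k then - sin (frame_phase z k) else 0)
    | Inr k \<Rightarrow> (case j of Inl l \<Rightarrow> if l = k then sin (frame_phase z k) else 0 | Inr l \<Rightarrow> if l = k then cos (frame_phase z k) else 0))"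

text \<open>
  The derivative of the parametrisation in rotated coordinates.  The cosine coefficients enter the
  cosine components through the identity and do not enter the sine components.
\<close>

definition sheared_block :: "(int^'n \<Rightarrow> real \<times> real) \<Rightarrow> real^('n + 'n) \<Rightarrow> real^('n + 'n)^('n + 'n)" where
  "sheared_block u z = (\<chi> i j. case i of
      Inl k \<Rightarrow> (case j of Inl l \<Rightarrow> if l = k then 1 else 0 | Inr l \<Rightarrow> - (forced_sine_at u (rpart z) $ k * rvec (e k) $ l))
    | Inr k \<Rightarrow> (case j of Inl l \<Rightarrow> 0 | Inr l \<Rightarrow> gradient_block u z $ k $ l))"

lemma finJ: "finite J" and J_sub: "J \<subseteq> M" and MJ: "J \<union> range e = M" "J \<inter> range e = {}"
  using finM e_sub by (auto simp: J_def)

lemma invP: "invertible P"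
  using detP by (simp add: P_def invertible_det_nz)

lemma P_q: "P *v q m = rvec m"
  by (simp only: q_def matrix_vector_mul_assoc matrix_inv_works(1)[OF invP] matrix_vector_mul_lid)

lemma sum_split: "(\<Sum>m\<in>M. f m) = (\<Sum>m\<in>J. f m) + (\<Sum>k\<in>UNIV. f (e k))" for f :: "int^'n \<Rightarrow> 'z::comm_monoid_add"
  using sum.subset_diff[OF e_sub finM, of f] inj_e by (simp add: sum.reindex J_def)

lemma forced_sine_at_eq: "forced_sine_at u x = - (\<Sum>m\<in>J. snd (rot2 (rvec m \<bullet> x) (u m)) *\<^sub>R q m)"
  by (simp add: forced_sine_at_def forced_sine_def rotate_rest_def)

lemma forced_sine_at_has_derivative:
  "(forced_sine_at u has_derivative (\<lambda>d. \<Sum>m\<in>J. (fst (rotate_rest x u m) * (rvec m \<bullet> d)) *\<^sub>R q m)) (at x)"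
proof -
  have 1: "((\<lambda>x. snd (rot2 (rvec m \<bullet> x) (u m))) has_derivative
      (\<lambda>d. - (fst (rot2 (rvec m \<bullet> x) (u m)) * (rvec m \<bullet> d)))) (at x)" for m
    unfolding rot2_def by (auto intro!: derivative_eq_intros simp: algebra_simps)
  have "((\<lambda>x. - (\<Sum>m\<in>J. snd (rot2 (rvec m \<bullet> x) (u m)) *\<^sub>R q m)) has_derivative
      (\<lambda>d. - (\<Sum>m\<in>J. (- (fst (rot2 (rvec m \<bullet> x) (u m)) * (rvec m \<bullet> d))) *\<^sub>R q m))) (at x)"
    by (intro has_derivative_minus has_derivative_sum has_derivative_scaleR_left 1)
  then show ?thesis
    unfolding forced_sine_at_eq[abs_def] rotate_rest_def by (simp add: sum_negf)
qed

lemma continuous_forced_sine_at: "continuous_on UNIV (forced_sine_at u)"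
  using has_derivative_continuous[OF forced_sine_at_has_derivative] by (simp add: continuous_on_eq_continuous_at)

lemma frame_rotation_mult: "frame_rotation z *v w = vjoin (\<chi> k. w $ Inl k * cos (frame_phase z k) - w $ Inr k * sin (frame_phase z k))
                 (\<chi> k. w $ Inl k * sin (frame_phase z k) + w $ Inr k * cos (frame_phase z k))"
proof (rule vec_eq_iff[THEN iffD2], rule allI)
  fix i
  have d: "(\<Sum>l\<in>UNIV. (if l = k then c else 0) * f l) = c * f k" for k :: 'n and c :: real and f
  proof -
    have "(\<Sum>l\<in>UNIV. (if l = k then c else 0) * f l) = (\<Sum>l\<in>UNIV. if l = k then c * f l else 0)"
      by (rule sum.cong) auto
    then show ?thesis by simp
  qed
  show "(frame_rotation z *v w) $ i = vjoin (\<chi> k. w $ Inl k * cos (frame_phase z k) - w $ Inr k * sin (frame_phase z k))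
                 (\<chi> k. w $ Inl k * sin (frame_phase z k) + w $ Inr k * cos (frame_phase z k)) $ i"
    by (cases i) (simp_all add: matrix_vector_mult_def sum_UNIV_Plus frame_rotation_def d)
qed

lemma sheared_block_mult: "sheared_block u z *v w = vjoin (\<chi> k. w $ Inl k - forced_sine_at u (rpart z) $ k * (rvec (e k) \<bullet> rpart w))
    (gradient_block u z *v rpart w)"
proof (rule vec_eq_iff[THEN iffD2], rule allI)
  fix i
  have d: "(\<Sum>l\<in>UNIV. (if l = k then c else 0) * f l) = c * f k" for k :: 'n and c :: real and f
  proof -
    have "(\<Sum>l\<in>UNIV. (if l = k then c else 0) * f l) = (\<Sum>l\<in>UNIV. if l = k then c * f l else 0)"
      by (rule sum.cong) auto
    then show ?thesis by simp
  qed
  show "(sheared_block u z *v w) $ i = vjoin (\<chi> k. w $ Inl k - forced_sine_at u (rpart z) $ k * (rvec (e k) \<bullet> rpart w))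
    (gradient_block u z *v rpart w) $ i"
    by (cases i) (simp_all add: matrix_vector_mult_def sum_UNIV_Plus sheared_block_def d inner_vec_def
        sum_distrib_left sum_negf mult.assoc)
qed

lemma gradient_block_mult: "(gradient_block u z *v d) $ k = z $ Inl k * (rvec (e k) \<bullet> d)
    + (\<Sum>m\<in>J. (fst (rotate_rest (rpart z) u m) * (rvec m \<bullet> d)) *\<^sub>R q m) $ k"
proof -
  have "(gradient_block u z *v d) $ k = (\<Sum>j\<in>UNIV. z $ Inl k * (rvec (e k) $ j * d $ j))
      + (\<Sum>j\<in>UNIV. \<Sum>m\<in>J. fst (rotate_rest (rpart z) u m) * q m $ k * (rvec m $ j * d $ j))"
    by (simp add: matrix_vector_mult_def gradient_block_def distrib_right sum.distrib sum_distrib_right mult.assoc)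
  also have "(\<Sum>j\<in>UNIV. \<Sum>m\<in>J. fst (rotate_rest (rpart z) u m) * q m $ k * (rvec m $ j * d $ j))
      = (\<Sum>m\<in>J. \<Sum>j\<in>UNIV. fst (rotate_rest (rpart z) u m) * q m $ k * (rvec m $ j * d $ j))"
    by (rule sum.swap)
  finally show ?thesis
    by (simp add: sum_distrib_left inner_vec_def mult_ac)
qed

lemma critical_param_has_derivative: "(critical_param u has_derivative (\<lambda>d. (frame_rotation z ** sheared_block u z) *v d)) (at z)"
proof -
  let ?H = "\<lambda>d. \<Sum>m\<in>J. (fst (rotate_rest (rpart z) u m) * (rvec m \<bullet> rpart d)) *\<^sub>R q m"
  have dl: "((\<lambda>z. z $ i) has_derivative (\<lambda>d. d $ i)) (at z)" for i :: "'n + 'n"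
    by (rule bounded_linear_imp_has_derivative[OF bounded_linear_vec_nth])
  have dr: "(rpart has_derivative rpart) (at z)"
    by (rule bounded_linear_imp_has_derivative[OF bounded_linear_parts(2)])
  have da: "((\<lambda>z. frame_phase z k) has_derivative (\<lambda>d. rvec (e k) \<bullet> rpart d)) (at z)" for k
    unfolding frame_phase_def by (rule has_derivative_inner_right[OF dr])
  have "((\<lambda>z. forced_sine_at u (rpart z)) has_derivative ?H) (at z)"
    using diff_chain_at[OF dr forced_sine_at_has_derivative[of u "rpart z"]] by (simp add: comp_def)
  then have dh: "((\<lambda>z. forced_sine_at u (rpart z) $ k) has_derivative (\<lambda>d. ?H d $ k)) (at z)" for k
    by (rule bounded_linear.has_derivative[OF bounded_linear_vec_nth])
  have val: "(frame_rotation z ** sheared_block u z) *v d = frame_rotation z *v (sheared_block u z *v d)" for d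
    by (simp only: matrix_vector_mul_assoc)
  have comp: "((\<lambda>z. critical_param u z $ i) has_derivative (\<lambda>d. ((frame_rotation z ** sheared_block u z) *v d) $ i)) (at z)" for i
  proof (cases i)
    case (Inl k)
    have "((\<lambda>z. z $ Inl k * cos (frame_phase z k) - forced_sine_at u (rpart z) $ k * sin (frame_phase z k)) has_derivative
       (\<lambda>d. ((frame_rotation z ** sheared_block u z) *v d) $ Inl k)) (at z)"
      unfolding val frame_rotation_mult sheared_block_mult vjoin_nth vec_lambda_beta gradient_block_mult
      by (rule derivative_eq_intros dl da dh refl | simp add: algebra_simps)+
    then show ?thesis unfolding Inl critical_param_def by simp
  next
    case (Inr k)
    have "((\<lambda>z. z $ Inl k * sin (frame_phase z k) + forced_sine_at u (rpart z) $ k * cos (frame_phase z k)) has_derivative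
       (\<lambda>d. ((frame_rotation z ** sheared_block u z) *v d) $ Inr k)) (at z)"
      unfolding val frame_rotation_mult sheared_block_mult vjoin_nth vec_lambda_beta gradient_block_mult
      by (rule derivative_eq_intros dl da dh refl | simp add: algebra_simps)+
    then show ?thesis unfolding Inr critical_param_def by simp
  qed
  show ?thesis
    unfolding has_derivative_componentwise_within[of "critical_param u"]
    using comp by (auto simp: Basis_vec_def inner_axis)
qed

lemma continuous_jacobian: "continuous_on UNIV (\<lambda>z. frame_rotation z ** sheared_block u z)"
proof -
  have ca: "continuous_on UNIV (\<lambda>z. frame_phase z k)" for k
    unfolding frame_phase_def by (intro continuous_intros linear_continuous_on bounded_linear_parts)
  have ch: "continuous_on UNIV (\<lambda>z. forced_sine_at u (rpart z) $ k)" for k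
    by (intro continuous_intros continuous_on_compose2[OF continuous_forced_sine_at] linear_continuous_on bounded_linear_parts) auto
  have cA: "continuous_on UNIV (\<lambda>z. gradient_block u z $ k $ l)" for k l
    unfolding gradient_block_def rotate_rest_def rot2_def vec_lambda_beta
    by (simp, intro continuous_intros linear_continuous_on bounded_linear_parts)
  have cif: "continuous_on UNIV (\<lambda>z. if c then f z else 0)" if "continuous_on UNIV f"
    for c and f :: "real^('n + 'n) \<Rightarrow> real"
    using that by (cases c) auto
  have cR: "continuous_on UNIV (\<lambda>z. frame_rotation z $ i $ j)" for i j
    unfolding frame_rotation_def vec_lambda_beta
    by (cases i; cases j; simp; intro cif continuous_intros ca)
  have cB: "continuous_on UNIV (\<lambda>z. sheared_block u z $ i $ j)" for i j
    unfolding sheared_block_def vec_lambda_beta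
    by (cases i; cases j) (auto intro!: continuous_intros ch cA)
  show ?thesis
    unfolding matrix_matrix_mult_def by (intro continuous_intros cR cB)
qed

text \<open>
  The rotation has determinant \<open>\<plusminus>1\<close>, the block triangular factor has the determinant of its lower
  right block, and that block becomes the Hessian when it is written in the standard basis instead
  of the selected basis.
\<close>

lemma det_jacobian: "\<bar>det (frame_rotation z ** sheared_block u z)\<bar> = \<bar>det (hessian_form (lpart z) (rotate_rest (rpart z) u))\<bar> / \<bar>det P\<bar>"
proof -
  have B: "det (sheared_block u z) = det (gradient_block u z)"
  proof (rule det_block_embed[where e = Inr])
    fix i c assume "c \<notin> range (Inr :: 'n \<Rightarrow> 'n + 'n)"
    then obtain l where "c = Inl l" by (cases c) auto
    then show "sheared_block u z $ Inr i $ c = 0" by (simp add: sheared_block_def)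
  next
    fix c d assume "c \<notin> range (Inr :: 'n \<Rightarrow> 'n + 'n)" "d \<notin> range (Inr :: 'n \<Rightarrow> 'n + 'n)"
    then obtain k l where "c = Inl k" "d = Inl l" by (cases c; cases d) auto
    then show "sheared_block u z $ c $ d = (if c = d then 1 else 0)" by (auto simp: sheared_block_def)
  qed (simp_all add: sheared_block_def)
  have "orthogonal_transformation ((*v) (frame_rotation z))"
    unfolding orthogonal_transformation
  proof (intro conjI allI)
    fix w :: "real^('n + 'n)"
    have "(norm (frame_rotation z *v w))\<^sup>2 = (norm w)\<^sup>2"
    proof -
      show ?thesis
        unfolding power2_norm_eq_inner inner_vec_def sum_UNIV_Plus frame_rotation_mult
        using sum_squares_rotation[OF sin_cos_squared_add] by (simp add: power2_eq_square sum.distrib[symmetric])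
    qed
    then show "norm (frame_rotation z *v w) = norm w" by simp
  qed simp
  then have "orthogonal_matrix (frame_rotation z)"
    by (simp add: orthogonal_transformation_matrix)
  then have R: "\<bar>det (frame_rotation z)\<bar> = 1" using det_orthogonal_matrix by fastforce
  have "P ** gradient_block u z = hessian_form (lpart z) (rotate_rest (rpart z) u)"
  proof (rule matrix_eq[THEN iffD2], rule allI)
    fix d
    have sm: "(\<Sum>m\<in>I. c m *\<^sub>R outer (f m)) *v d = (\<Sum>m\<in>I. (c m * (f m \<bullet> d)) *\<^sub>R f m)"
      for I :: "'z set" and c and f :: "'z \<Rightarrow> real^'n"
      by (induction I rule: infinite_finite_induct)
         (simp_all add: matrix_vector_mult_add_rdistrib outer_mult_vec scaleR_matrix_vector_assoc[symmetric])
    have lin: "P *v (\<Sum>m\<in>I. f m) = (\<Sum>m\<in>I. P *v f m)" for I :: "(int^'n) set" and f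
      by (rule linear_sum) simp
    let ?H = "\<Sum>m\<in>J. (fst (rotate_rest (rpart z) u m) * (rvec m \<bullet> d)) *\<^sub>R q m"
    have "gradient_block u z *v d = (\<chi> k. z $ Inl k * (rvec (e k) \<bullet> d)) + ?H"
      by (simp add: vec_eq_iff gradient_block_mult del: sum_component vector_scaleR_component)
    then have "P *v (gradient_block u z *v d) = P *v (\<chi> k. z $ Inl k * (rvec (e k) \<bullet> d)) + P *v ?H"
      by (simp only: matrix_vector_right_distrib)
    also have "P *v (\<chi> k. z $ Inl k * (rvec (e k) \<bullet> d)) = (\<Sum>k\<in>UNIV. (z $ Inl k * (rvec (e k) \<bullet> d)) *\<^sub>R rvec (e k))"
      by (simp add: P_def frame_matrix_mult)
    also have "P *v ?H = (\<Sum>m\<in>J. (fst (rotate_rest (rpart z) u m) * (rvec m \<bullet> d)) *\<^sub>R rvec m)"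
      by (simp only: lin matrix_vector_mult_scaleR P_q)
    finally show "(P ** gradient_block u z) *v d = hessian_form (lpart z) (rotate_rest (rpart z) u) *v d"
      by (simp only: hessian_form_def matrix_vector_mult_add_rdistrib sm matrix_vector_mul_assoc[symmetric] part_nth)
  qed
  from arg_cong[OF this, of det]
  have "det P * det (gradient_block u z) = det (hessian_form (lpart z) (rotate_rest (rpart z) u))"
    by (simp add: det_mul)
  from arg_cong[OF this, of abs]
  have "\<bar>det P\<bar> * \<bar>det (gradient_block u z)\<bar> = \<bar>det (hessian_form (lpart z) (rotate_rest (rpart z) u))\<bar>"
    by (simp only: abs_mult)
  moreover have "det P \<noteq> 0" using detP by (simp add: P_def)
  ultimately show ?thesis using R by (simp add: det_mul abs_mult B field_simps)
qed

lemma norm_critical_param: "(norm (critical_param u z))\<^sup>2 = (norm (lpart z))\<^sup>2 + (norm (forced_sine_at u (rpart z)))\<^sup>2"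
proof -
  show ?thesis
    unfolding power2_norm_eq_inner inner_vec_def sum_UNIV_Plus critical_param_def
    using sum_squares_rotation[OF sin_cos_squared_add] by (simp add: power2_eq_square sum.distrib[symmetric])
qed

text \<open>
  The coefficient family with \<open>u\<close> at the other modes and \<open>w\<close> at the selected modes.
\<close>

definition coefs :: "(int^'n \<Rightarrow> real \<times> real) \<Rightarrow> real^('n + 'n) \<Rightarrow> int^'n \<Rightarrow> real \<times> real" where
  "coefs u w = merge J (range e) (u, pair_coords e w)"

lemma coefs_J: "m \<in> J \<Longrightarrow> coefs u w m = u m"
  by (simp add: coefs_def merge_def)

lemma coefs_e: "coefs u w (e k) = (w $ Inl k, w $ Inr k)"
  using MJ(2) inj_e by (auto simp: coefs_def merge_def pair_coords_def)

text \<open>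
  The rotated sine coefficients of the selected modes minus their forced values, hence the
  coordinates of the gradient at \<open>x\<close> in the selected basis.
\<close>

definition residual :: "(int^'n \<Rightarrow> real \<times> real) \<Rightarrow> real^('n + 'n) \<Rightarrow> real^'n \<Rightarrow> real^'n" where
  "residual u w x = (\<chi> k. snd (rot2 (rvec (e k) \<bullet> x) (w $ Inl k, w $ Inr k)) - forced_sine_at u x $ k)"

lemma crit_field_coefs: "crit_field M (coefs u w) x = P *v residual u w x"
proof -
  have lin: "P *v (\<Sum>m\<in>I. f m) = (\<Sum>m\<in>I. P *v f m)" for I :: "(int^'n) set" and f
    by (rule linear_sum) simp
  have "residual u w x = (\<chi> k. snd (rot2 (rvec (e k) \<bullet> x) (w $ Inl k, w $ Inr k)))
      + (\<Sum>m\<in>J. snd (rot2 (rvec m \<bullet> x) (u m)) *\<^sub>R q m)"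
    by (simp add: residual_def forced_sine_at_eq vec_eq_iff)
  then have "P *v residual u w x = P *v (\<chi> k. snd (rot2 (rvec (e k) \<bullet> x) (w $ Inl k, w $ Inr k)))
      + P *v (\<Sum>m\<in>J. snd (rot2 (rvec m \<bullet> x) (u m)) *\<^sub>R q m)"
    by (simp only: matrix_vector_right_distrib)
  also have "P *v (\<chi> k. snd (rot2 (rvec (e k) \<bullet> x) (w $ Inl k, w $ Inr k)))
      = (\<Sum>k\<in>UNIV. snd (rot2 (rvec (e k) \<bullet> x) (coefs u w (e k))) *\<^sub>R rvec (e k))"
    by (simp add: P_def frame_matrix_mult coefs_e)
  also have "P *v (\<Sum>m\<in>J. snd (rot2 (rvec m \<bullet> x) (u m)) *\<^sub>R q m)
      = (\<Sum>m\<in>J. snd (rot2 (rvec m \<bullet> x) (coefs u w m)) *\<^sub>R rvec m)"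
    unfolding lin by (rule sum.cong) (simp_all add: matrix_vector_mult_scaleR P_q coefs_J)
  finally show ?thesis
    unfolding crit_field_def sum_split by (simp only: add.commute)
qed

lemma crit_field_coefs_zero: "crit_field M (coefs u w) x = 0 \<longleftrightarrow> residual u w x = 0"
proof
  assume "crit_field M (coefs u w) x = 0"
  then have "P *v residual u w x = 0" by (simp only: crit_field_coefs)
  then have "matrix_inv P *v (P *v residual u w x) = 0" by simp
  then show "residual u w x = 0"
    by (simp only: matrix_vector_mul_assoc matrix_inv_works(2)[OF invP] matrix_vector_mul_lid)
qed (simp add: crit_field_coefs)

text \<open>
  A preimage of \<open>w\<close> is determined by its point, which has to be critical, since the cosine
  coefficients at that point are read off from \<open>w\<close>.
\<close>

lemma critical_param_eq_iff: "critical_param u z = w \<longleftrightarrow> residual u w (rpart z) = 0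
    \<and> lpart z = (\<chi> k. fst (rot2 (frame_phase z k) (w $ Inl k, w $ Inr k)))"
proof -
  have "critical_param u z = w \<longleftrightarrow> (\<forall>k. critical_param u z $ Inl k = w $ Inl k \<and> critical_param u z $ Inr k = w $ Inr k)"
  proof
    assume *: "\<forall>k. critical_param u z $ Inl k = w $ Inl k \<and> critical_param u z $ Inr k = w $ Inr k"
    have "critical_param u z $ i = w $ i" for i by (cases i) (use * in auto)
    then show "critical_param u z = w" by (simp add: vec_eq_iff)
  qed auto
  also have "\<dots> \<longleftrightarrow> (\<forall>k. (z $ Inl k, forced_sine_at u (rpart z) $ k) = rot2 (frame_phase z k) (w $ Inl k, w $ Inr k))"
    unfolding rot2_inverse[symmetric] by (simp add: critical_param_def)
  also have "\<dots> \<longleftrightarrow> residual u w (rpart z) = 0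
    \<and> lpart z = (\<chi> k. fst (rot2 (frame_phase z k) (w $ Inl k, w $ Inr k)))"
    by (auto simp: residual_def vec_eq_iff prod_eq_iff frame_phase_def)
  finally show ?thesis .
qed

lemma fibre_count:
  "emeasure (count_space UNIV) {z \<in> rpart -` torus. critical_param u z = w} = num_critical (trig_comb M (coefs u w))"
proof -
  let ?Z = "{z \<in> rpart -` torus. critical_param u z = w}" and ?X = "{x \<in> torus. residual u w x = 0}"
  let ?f = "\<lambda>x. vjoin (\<chi> k. fst (rot2 (rvec (e k) \<bullet> x) (w $ Inl k, w $ Inr k))) x"
  have "bij_betw rpart ?Z ?X"
  proof (rule bij_betw_byWitness[of _ ?f])
    show "\<forall>z\<in>?Z. ?f (rpart z) = z"
    proof
      fix z assume "z \<in> ?Z"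
      then have "lpart z = (\<chi> k. fst (rot2 (rvec (e k) \<bullet> rpart z) (w $ Inl k, w $ Inr k)))"
        unfolding mem_Collect_eq critical_param_eq_iff frame_phase_def by blast
      from this[symmetric] show "?f (rpart z) = z" by (simp only: vjoin_parts)
    qed
    show "\<forall>x\<in>?X. rpart (?f x) = x" by simp
    show "rpart ` ?Z \<subseteq> ?X" by (auto simp: critical_param_eq_iff)
    show "?f ` ?X \<subseteq> ?Z" by (auto simp: critical_param_eq_iff frame_phase_def)
  qed
  then have "emeasure (count_space UNIV) ?Z = emeasure (count_space UNIV) ?X"
    by (simp add: emeasure_count_space bij_betw_same_card bij_betw_finite)
  then show ?thesis
    by (simp add: num_critical_def critical_points_trig_comb crit_field_coefs_zero)
qed

lemma measurable_fibre_count: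
  "(\<lambda>w. num_critical (trig_comb M (coefs u w))) \<in> borel_measurable borel"
  unfolding num_critical_def critical_points_trig_comb crit_field_coefs_zero
proof (rule measurable_count_zeros[OF _ _ _ torus_sigma_compact])
  show "(\<lambda>w. residual u w x) \<in> borel_measurable borel" for x
    unfolding residual_def rot2_def
    by (intro borel_measurable_continuous_onI, simp, intro continuous_intros)
  show "continuous_on UNIV (residual u w)" for w
    unfolding residual_def[abs_def] rot2_def
    by (simp, intro continuous_intros continuous_forced_sine_at)
qed simp

text \<open>
  The Gaussian weight of all rotated coefficients, with the sine coefficients of the selected modes
  forced, times the Jacobian of the parametrisation.  It involves the point only through the rotated
  coefficients.
\<close>

definition hess_weight :: "real^'n \<Rightarrow> (int^'n \<Rightarrow> real \<times> real) \<Rightarrow> ennreal" where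
  "hess_weight s v = ennreal (exp (- ((\<Sum>m\<in>J. (norm (v m))\<^sup>2) + (norm s)\<^sup>2 + (norm (forced_sine v))\<^sup>2) / 2)
      * (\<bar>det (hessian_form s v)\<bar> / \<bar>det P\<bar>))"

lemma fibre_integral:
  "(\<integral>\<^sup>+w. ennreal (exp (- (norm w)\<^sup>2 / 2)) * num_critical (trig_comb M (coefs u w)) \<partial>lborel)
   = (\<integral>\<^sup>+z. indicator torus (rpart z) * ennreal (\<bar>det (hessian_form (lpart z) (rotate_rest (rpart z) u))\<bar> / \<bar>det P\<bar>
        * exp (- ((norm (lpart z))\<^sup>2 + (norm (forced_sine (rotate_rest (rpart z) u)))\<^sup>2) / 2)) \<partial>lborel)"
proof -
  have r: "rpart \<in> borel_measurable (borel :: (real^('n + 'n)) measure)"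
    by (intro borel_measurable_continuous_onI linear_continuous_on bounded_linear_parts)
  have \<Omega>: "(rpart :: real^('n + 'n) \<Rightarrow> real^'n) -` torus \<in> sets borel"
    using measurable_sets[OF r torus_borel] by simp
  have "(\<integral>\<^sup>+w. ennreal (exp (- (norm w)\<^sup>2 / 2)) * emeasure (count_space UNIV) {z \<in> rpart -` torus. critical_param u z = w} \<partial>lborel)
     = (\<integral>\<^sup>+z. indicator (rpart -` torus) z * ennreal (\<bar>det (frame_rotation z ** sheared_block u z)\<bar> * exp (- (norm (critical_param u z))\<^sup>2 / 2)) \<partial>lborel)"
  proof (rule area_formula[OF critical_param_has_derivative continuous_jacobian \<Omega> _ integrable_gauss_norm])
    show "(\<lambda>w. emeasure (count_space UNIV) {z \<in> rpart -` torus. critical_param u z = w}) \<in> borel_measurable borel"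
      unfolding fibre_count by (rule measurable_fibre_count)
  qed simp
  then show ?thesis
    unfolding fibre_count det_jacobian norm_critical_param forced_sine_at_def by (simp add: indicator_def)
qed

abbreviation rest_measure :: "(int^'n \<Rightarrow> real \<times> real) measure" where
  "rest_measure \<equiv> \<Pi>\<^sub>M m\<in>J. lborel"

lemma sigma_finite_rest: "sigma_finite_measure rest_measure"
proof -
  interpret product_sigma_finite "\<lambda>_::int^'n. lborel :: (real \<times> real) measure"
    by (rule product_sigma_finite_lborel)
  show ?thesis by (rule sigma_finite[OF finJ])
qed

lemma measurable_hess_weight: "(\<lambda>p. hess_weight (snd p) (fst p)) \<in> borel_measurable (rest_measure \<Otimes>\<^sub>M borel)"
proof -
  let ?N = "rest_measure \<Otimes>\<^sub>M (borel :: (real^'n) measure)"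
  have c: "(\<lambda>p. fst p m) \<in> borel_measurable ?N" if "m \<in> J" for m
    by (rule measurable_compose[OF measurable_fst borel_measurable_PiM_component[OF that]])
  have cf: "(\<lambda>p. fst (fst p m)) \<in> borel_measurable ?N" if "m \<in> J" for m
    by (rule measurable_compose[OF measurable_fst borel_measurable_PiM_fst_snd(1)[OF that]])
  have cs: "(\<lambda>p. snd (fst p m)) \<in> borel_measurable ?N" if "m \<in> J" for m
    by (rule measurable_compose[OF measurable_fst borel_measurable_PiM_fst_snd(2)[OF that]])
  have s: "(\<lambda>p. snd p $ k) \<in> borel_measurable ?N" for k
    by (rule measurable_compose[OF measurable_snd]) (intro borel_measurable_continuous_onI continuous_intros)
  have [measurable]: "(\<lambda>p. \<Sum>m\<in>J. (norm (fst p m))\<^sup>2) \<in> borel_measurable ?N"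
    by (intro borel_measurable_sum borel_measurable_power measurable_compose[OF c borel_measurable_norm])
  have [measurable]: "(\<lambda>p. forced_sine (fst p)) \<in> borel_measurable ?N"
    unfolding forced_sine_def by (intro borel_measurable_uminus borel_measurable_sum borel_measurable_scaleR cs borel_measurable_const)
  have h: "(\<lambda>p. hessian_form (snd p) (fst p) $ i $ j) \<in> borel_measurable ?N" for i j
    unfolding hessian_form_def vector_add_component sum_component vector_scaleR_component
    by (intro borel_measurable_add borel_measurable_sum borel_measurable_scaleR cf s borel_measurable_const)
  have [measurable]: "(\<lambda>p. det (hessian_form (snd p) (fst p))) \<in> borel_measurable ?N"
    unfolding det_def by (intro borel_measurable_sum borel_measurable_times borel_measurable_prod h borel_measurable_const)
  show ?thesis unfolding hess_weight_def by measurable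
qed

lemma measurable_rotate_rest: "(\<lambda>p. rotate_rest (snd p) (fst p)) \<in> rest_measure \<Otimes>\<^sub>M borel \<rightarrow>\<^sub>M rest_measure"
  unfolding rotate_rest_def
proof (rule measurable_restrict)
  let ?N = "rest_measure \<Otimes>\<^sub>M (borel :: (real^'n) measure)"
  fix m assume m: "m \<in> J"
  have [measurable]: "(\<lambda>p. fst (fst p m)) \<in> borel_measurable ?N"
    by (rule measurable_compose[OF measurable_fst borel_measurable_PiM_fst_snd(1)[OF m]])
  have [measurable]: "(\<lambda>p. snd (fst p m)) \<in> borel_measurable ?N"
    by (rule measurable_compose[OF measurable_fst borel_measurable_PiM_fst_snd(2)[OF m]])
  have [measurable]: "(\<lambda>p. cos (rvec m \<bullet> snd p)) \<in> borel_measurable ?N" "(\<lambda>p. sin (rvec m \<bullet> snd p)) \<in> borel_measurable ?N"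
    by (rule measurable_compose[OF measurable_snd], intro borel_measurable_continuous_onI continuous_intros)+
  have "(\<lambda>p. rot2 (rvec m \<bullet> snd p) (fst p m)) \<in> borel_measurable ?N"
    unfolding rot2_def by (intro borel_measurable_Pair) measurable
  then show "(\<lambda>p. rot2 (rvec m \<bullet> snd p) (fst p m)) \<in> ?N \<rightarrow>\<^sub>M lborel" by simp
qed

definition mean_hess_weight :: "(int^'n \<Rightarrow> real \<times> real) \<Rightarrow> ennreal" where
  "mean_hess_weight v = (\<integral>\<^sup>+s. hess_weight s v \<partial>lborel)"

lemma measurable_mean_hess_weight: "mean_hess_weight \<in> borel_measurable rest_measure"
proof -
  have "(\<lambda>(v, s). hess_weight s v) \<in> borel_measurable (rest_measure \<Otimes>\<^sub>M lborel)"
    using measurable_hess_weight by (simp add: case_prod_beta' cong: measurable_cong_sets sets_pair_measure_cong)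
  from lborel.borel_measurable_nn_integral[OF this] show ?thesis
    unfolding mean_hess_weight_def by simp
qed

text \<open>
  The Gaussian weight is invariant under the rotation, so the area formula expresses everything in terms
  of the rotated coefficients \<open>rotate_rest x u\<close>.
\<close>

lemma gauss_count_fibre:
  assumes u: "u \<in> space rest_measure"
  shows "(\<integral>\<^sup>+w. ennreal (exp (- (\<Sum>m\<in>M. (norm (coefs u w m))\<^sup>2) / 2)) * num_critical (trig_comb M (coefs u w)) \<partial>lborel)
    = (\<integral>\<^sup>+x. indicator torus x * mean_hess_weight (rotate_rest x u) \<partial>lborel)"
proof -
  let ?U = "\<Sum>m\<in>J. (norm (u m))\<^sup>2"
  have sq: "(\<Sum>m\<in>M. (norm (coefs u w m))\<^sup>2) = ?U + (norm w)\<^sup>2" for w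
  proof -
    have "(\<Sum>m\<in>J. (norm (coefs u w m))\<^sup>2) = ?U"
      by (rule sum.cong) (simp_all add: coefs_J)
    moreover have "(\<Sum>k\<in>UNIV. (norm (coefs u w (e k)))\<^sup>2) = (norm w)\<^sup>2"
      unfolding norm_vec_sum_squares sum_UNIV_Plus coefs_e by (simp add: norm_prod_def sum.distrib)
    ultimately show ?thesis unfolding sum_split by simp
  qed
  have ex: "ennreal (exp (- (?U + r) / 2)) = ennreal (exp (- ?U / 2)) * ennreal (exp (- r / 2))" for r
  proof -
    have "exp (- (?U + r) / 2) = exp (- ?U / 2) * exp (- r / 2)"
      by (simp add: exp_add[symmetric] add_divide_distrib)
    then show ?thesis by (simp only: ennreal_mult'[OF exp_ge_zero])
  qed
  have rm: "rpart \<in> borel_measurable (borel :: (real^('n + 'n)) measure)" "lpart \<in> borel_measurable (borel :: (real^('n + 'n)) measure)"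
    by (rule borel_measurable_continuous_onI[OF linear_continuous_on], rule bounded_linear_parts)+
  have "(\<lambda>z :: real^('n + 'n). (u, rpart z)) \<in> borel \<rightarrow>\<^sub>M rest_measure \<Otimes>\<^sub>M (borel :: (real^'n) measure)"
    by (intro measurable_Pair measurable_const u rm)
  from measurable_compose[OF this measurable_rotate_rest]
  have "(\<lambda>z :: real^('n + 'n). (rotate_rest (rpart z) u, lpart z)) \<in> borel \<rightarrow>\<^sub>M rest_measure \<Otimes>\<^sub>M (borel :: (real^'n) measure)"
    by (intro measurable_Pair rm) simp
  from measurable_compose[OF this measurable_hess_weight]
  have Wz: "(\<lambda>z. hess_weight (lpart z) (rotate_rest (rpart z) u)) \<in> borel_measurable borel" by simp
  have Iz: "(\<lambda>z. indicator torus (rpart z) :: ennreal) \<in> borel_measurable (borel :: (real^('n + 'n)) measure)"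
    by (rule measurable_compose[OF rm(1)]) simp
  have rn: "(\<Sum>m\<in>J. (norm (rotate_rest x u m))\<^sup>2) = ?U" for x
    by (rule sum.cong) (simp_all add: rotate_rest_def norm_rot2)
  have Weq: "ennreal (exp (- ?U / 2)) * (i * ennreal (\<bar>det (hessian_form s (rotate_rest x u))\<bar> / \<bar>det P\<bar>
        * exp (- ((norm s)\<^sup>2 + (norm (forced_sine (rotate_rest x u)))\<^sup>2) / 2))) = i * hess_weight s (rotate_rest x u)" for i s x
  proof -
    have "hess_weight s (rotate_rest x u) = ennreal (exp (- (?U + ((norm s)\<^sup>2 + (norm (forced_sine (rotate_rest x u)))\<^sup>2)) / 2)) * ennreal (\<bar>det (hessian_form s (rotate_rest x u))\<bar> / \<bar>det P\<bar>)"
      unfolding hess_weight_def rn by (simp only: ennreal_mult'[OF exp_ge_zero] add.assoc)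
    also have "\<dots> = ennreal (exp (- ?U / 2)) * ennreal (\<bar>det (hessian_form s (rotate_rest x u))\<bar> / \<bar>det P\<bar>
        * exp (- ((norm s)\<^sup>2 + (norm (forced_sine (rotate_rest x u)))\<^sup>2) / 2))"
      unfolding ex by (subst ennreal_mult'') (auto simp: mult_ac)
    finally show ?thesis by (simp add: mult_ac)
  qed
  have "(\<integral>\<^sup>+w. ennreal (exp (- (\<Sum>m\<in>M. (norm (coefs u w m))\<^sup>2) / 2)) * num_critical (trig_comb M (coefs u w)) \<partial>lborel)
      = (\<integral>\<^sup>+w. ennreal (exp (- ?U / 2)) * (ennreal (exp (- (norm w)\<^sup>2 / 2)) * num_critical (trig_comb M (coefs u w))) \<partial>lborel)"
    unfolding sq ex mult.assoc ..
  also have "\<dots> = ennreal (exp (- ?U / 2)) * (\<integral>\<^sup>+w. ennreal (exp (- (norm w)\<^sup>2 / 2)) * num_critical (trig_comb M (coefs u w)) \<partial>lborel)"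
    by (rule nn_integral_cmult) (use measurable_fibre_count in measurable)
  also have "\<dots> = (\<integral>\<^sup>+z. ennreal (exp (- ?U / 2)) * (indicator torus (rpart z) * ennreal (\<bar>det (hessian_form (lpart z) (rotate_rest (rpart z) u))\<bar> / \<bar>det P\<bar>
        * exp (- ((norm (lpart z))\<^sup>2 + (norm (forced_sine (rotate_rest (rpart z) u)))\<^sup>2) / 2))) \<partial>lborel)"
  proof -
    have "(\<lambda>z. ennreal (exp (?U / 2)) * (indicator torus (rpart z) * hess_weight (lpart z) (rotate_rest (rpart z) u))) \<in> borel_measurable lborel"
      using Iz Wz by measurable
    moreover have "ennreal (exp (?U / 2)) * (indicator torus (rpart z) * hess_weight (lpart z) (rotate_rest (rpart z) u))
       = indicator torus (rpart z) * ennreal (\<bar>det (hessian_form (lpart z) (rotate_rest (rpart z) u))\<bar> / \<bar>det P\<bar>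
        * exp (- ((norm (lpart z))\<^sup>2 + (norm (forced_sine (rotate_rest (rpart z) u)))\<^sup>2) / 2))" for z
    proof -
      have "ennreal (exp (?U / 2)) * ennreal (exp (- ?U / 2)) = 1"
        by (simp add: ennreal_mult[symmetric] exp_add[symmetric])
      then show ?thesis unfolding Weq[symmetric] by (simp add: mult.assoc[symmetric])
    qed
    ultimately show ?thesis
      unfolding fibre_integral by (intro nn_integral_cmult[symmetric]) simp
  qed
  also have "\<dots> = (\<integral>\<^sup>+z. indicator torus (rpart z) * hess_weight (lpart z) (rotate_rest (rpart z) u) \<partial>lborel)"
    unfolding Weq ..
  also have "\<dots> = (\<integral>\<^sup>+x. \<integral>\<^sup>+s. indicator torus x * hess_weight s (rotate_rest x u) \<partial>lborel \<partial>lborel)"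
    using nn_integral_vjoin[of "\<lambda>z. indicator torus (rpart z) * hess_weight (lpart z) (rotate_rest (rpart z) u)"] Iz Wz
    by simp
  also have "\<dots> = (\<integral>\<^sup>+x. indicator torus x * mean_hess_weight (rotate_rest x u) \<partial>lborel)"
  proof (rule nn_integral_cong)
    fix x :: "real^'n"
    have "rotate_rest x u \<in> space rest_measure"
      by (auto simp: rotate_rest_def space_PiM)
    then have "(\<lambda>s. hess_weight s (rotate_rest x u)) \<in> borel_measurable borel"
      using measurable_compose[OF measurable_Pair1' measurable_hess_weight] by simp
    then show "(\<integral>\<^sup>+s. indicator torus x * hess_weight s (rotate_rest x u) \<partial>lborel) = indicator torus x * mean_hess_weight (rotate_rest x u)"
      unfolding mean_hess_weight_def by (intro nn_integral_cmult) simp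
  qed
  finally show ?thesis .
qed

text \<open>
  For fixed \<open>x\<close> the rotation of the coefficients \<open>u\<close> preserves Lebesgue measure.  Once the order of
  integration is exchanged, the inner integral is therefore the same for every \<open>x\<close>, which leaves the volume of
  the torus as a factor.
\<close>

lemma kac_rice_fibred:
  "(\<integral>\<^sup>+c. ennreal (exp (- (\<Sum>m\<in>M. (norm (c m))\<^sup>2) / 2)) * num_critical (trig_comb M c) \<partial>(\<Pi>\<^sub>M m\<in>M. lborel))
   = ennreal ((2 * pi) ^ CARD('n)) * (\<integral>\<^sup>+v. mean_hess_weight v \<partial>rest_measure)"
proof -
  interpret product_sigma_finite "\<lambda>_::int^'n. lborel :: (real \<times> real) measure"
    by (rule product_sigma_finite_lborel)
  interpret MJ: sigma_finite_measure rest_measure by (rule sigma_finite_rest)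
  interpret pair_sigma_finite rest_measure "lborel :: (real^'n) measure" ..
  let ?F = "\<lambda>c. ennreal (exp (- (\<Sum>m\<in>M. (norm (c m))\<^sup>2) / 2)) * num_critical (trig_comb M c)"
  have F: "?F \<in> borel_measurable (\<Pi>\<^sub>M m\<in>M. lborel)"
  proof -
    note [measurable] = borel_measurable_num_critical[of M]
    have [measurable]: "(\<lambda>c. \<Sum>m\<in>M. (norm (c m))\<^sup>2) \<in> borel_measurable (\<Pi>\<^sub>M m\<in>M. (lborel :: (real \<times> real) measure))"
      by (intro borel_measurable_sum borel_measurable_power
          measurable_compose[OF borel_measurable_PiM_component borel_measurable_norm])
    show ?thesis by measurable
  qed
  have "(\<integral>\<^sup>+c. ?F c \<partial>(\<Pi>\<^sub>M m\<in>M. lborel))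
      = (\<integral>\<^sup>+u. \<integral>\<^sup>+\<omega>. ?F (merge J (range e) (u, \<omega>)) \<partial>(\<Pi>\<^sub>M m\<in>range e. lborel) \<partial>rest_measure)"
    using product_nn_integral_fold[OF MJ(2) finJ _, of ?F] F unfolding MJ(1) by simp
  also have "\<dots> = (\<integral>\<^sup>+u. \<integral>\<^sup>+x. indicator torus x * mean_hess_weight (rotate_rest x u) \<partial>lborel \<partial>rest_measure)"
  proof (rule nn_integral_cong)
    fix u assume u: "u \<in> space rest_measure"
    have "(\<lambda>\<omega>. merge J (range e) (u, \<omega>)) \<in> (\<Pi>\<^sub>M m\<in>range e. lborel) \<rightarrow>\<^sub>M (\<Pi>\<^sub>M m\<in>J \<union> range e. lborel)"
      using u by measurable
    from measurable_compose[OF this, of ?F borel] F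
    have "(\<integral>\<^sup>+\<omega>. ?F (merge J (range e) (u, \<omega>)) \<partial>(\<Pi>\<^sub>M m\<in>range e. lborel)) = (\<integral>\<^sup>+w. ?F (coefs u w) \<partial>lborel)"
      unfolding MJ(1) coefs_def by (intro nn_integral_PiM_pair_vec inj_e) simp
    then show "(\<integral>\<^sup>+\<omega>. ?F (merge J (range e) (u, \<omega>)) \<partial>(\<Pi>\<^sub>M m\<in>range e. lborel))
        = (\<integral>\<^sup>+x. indicator torus x * mean_hess_weight (rotate_rest x u) \<partial>lborel)"
      by (simp only: gauss_count_fibre[OF u])
  qed
  also have "\<dots> = (\<integral>\<^sup>+x. \<integral>\<^sup>+u. indicator torus x * mean_hess_weight (rotate_rest x u) \<partial>rest_measure \<partial>lborel)"
  proof (rule Fubini'[symmetric])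
    have "(\<lambda>p. mean_hess_weight (rotate_rest (snd p) (fst p))) \<in> borel_measurable (rest_measure \<Otimes>\<^sub>M borel)"
      by (rule measurable_compose[OF measurable_rotate_rest measurable_mean_hess_weight])
    then have "(\<lambda>p. indicator torus (snd p) * mean_hess_weight (rotate_rest (snd p) (fst p))) \<in> borel_measurable (rest_measure \<Otimes>\<^sub>M borel)"
      by (intro borel_measurable_times_ennreal measurable_compose[OF measurable_snd]) auto
    then show "(\<lambda>(u, x). indicator torus x * mean_hess_weight (rotate_rest x u)) \<in> borel_measurable (rest_measure \<Otimes>\<^sub>M lborel)"
      by (simp add: case_prod_beta' cong: measurable_cong_sets sets_pair_measure_cong)
  qed
  also have "\<dots> = (\<integral>\<^sup>+x. (\<integral>\<^sup>+v. mean_hess_weight v \<partial>rest_measure) * indicator torus x \<partial>(lborel :: (real^'n) measure))"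
  proof (rule nn_integral_cong)
    fix x :: "real^'n"
    have "(\<lambda>u. (u, x)) \<in> rest_measure \<rightarrow>\<^sub>M rest_measure \<Otimes>\<^sub>M borel" by simp
    from measurable_compose[OF measurable_compose[OF this measurable_rotate_rest] measurable_mean_hess_weight]
    have "(\<lambda>u. mean_hess_weight (rotate_rest x u)) \<in> borel_measurable rest_measure" by simp
    then have "(\<integral>\<^sup>+u. indicator torus x * mean_hess_weight (rotate_rest x u) \<partial>rest_measure) = indicator torus x * (\<integral>\<^sup>+u. mean_hess_weight (rotate_rest x u) \<partial>rest_measure)"
      by (rule nn_integral_cmult)
    also have "(\<integral>\<^sup>+u. mean_hess_weight (rotate_rest x u) \<partial>rest_measure) = (\<integral>\<^sup>+v. mean_hess_weight v \<partial>rest_measure)"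
      unfolding rotate_rest_def by (rule nn_integral_PiM_rot2[OF finJ measurable_mean_hess_weight])
    finally show "(\<integral>\<^sup>+u. indicator torus x * mean_hess_weight (rotate_rest x u) \<partial>rest_measure) = (\<integral>\<^sup>+v. mean_hess_weight v \<partial>rest_measure) * indicator torus x"
      by (simp add: mult.commute)
  qed
  also have "\<dots> = (\<integral>\<^sup>+v. mean_hess_weight v \<partial>rest_measure) * emeasure lborel (torus :: (real^'n) set)"
    by (rule nn_integral_cmult_indicator) simp
  finally show ?thesis by (simp add: emeasure_torus mult.commute)
qed

abbreviation rest_scalars :: "(int^'n \<Rightarrow> real) measure" where
  "rest_scalars \<equiv> \<Pi>\<^sub>M m\<in>J. lborel"

text \<open>
  The weight is a product of a function of the cosine coefficients and a function of the sine
  coefficients.  The latter integrates to the density of the gradient at \<open>0\<close>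
  (\<open>gaussian_on_constraint\<close>).
\<close>

lemma integral_mean_hess_weight:
  "(\<integral>\<^sup>+v. mean_hess_weight v \<partial>rest_measure) = ennreal (sqrt (2 * pi) ^ card J / sqrt (det (\<Sum>m\<in>M. outer (rvec m))))
    * (\<integral>\<^sup>+\<alpha>. ennreal (exp (- (\<Sum>m\<in>M. (\<alpha> m)\<^sup>2) / 2) * \<bar>det (\<Sum>m\<in>M. \<alpha> m *\<^sub>R outer (rvec m))\<bar>) \<partial>(\<Pi>\<^sub>M m\<in>M. lborel))"
proof -
  interpret product_sigma_finite "\<lambda>_::int^'n. lborel :: real measure"
    by (rule product_sigma_finite_lborel)
  define H where "H s \<alpha> = (\<Sum>k\<in>UNIV. (s $ k) *\<^sub>R outer (rvec (e k))) + (\<Sum>m\<in>J. \<alpha> m *\<^sub>R outer (rvec m))"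
    for s :: "real^'n" and \<alpha> :: "int^'n \<Rightarrow> real"
  (* F1 collects the cosine coefficients: s at the selected modes and \<alpha> at the others.
     G1 collects the sine coefficients \<beta> of the other modes, including the Gaussian weight of the
     forced sine coefficients of the selected modes. *)
  define F1 where "F1 s \<alpha> = ennreal (exp (- ((\<Sum>m\<in>J. (\<alpha> m)\<^sup>2) + (norm s)\<^sup>2) / 2) * \<bar>det (H s \<alpha>)\<bar>)"
    for s \<alpha>
  define G1 where "G1 \<beta> = ennreal (exp (- (\<Sum>m\<in>J. (\<beta> m)\<^sup>2) / 2 - (norm (\<Sum>m\<in>J. \<beta> m *\<^sub>R q m))\<^sup>2 / 2) / \<bar>det P\<bar>)"
    for \<beta>
  have G1m: "G1 \<in> borel_measurable rest_scalars"
  proof -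
    note [measurable] = borel_measurable_PiM_sum_squares[OF subset_refl, of J]
      borel_measurable_PiM_lincomb[OF subset_refl, where I=J and q=q]
    show ?thesis unfolding G1_def[abs_def] by measurable
  qed
  let ?FM = "\<lambda>\<alpha>. ennreal (exp (- (\<Sum>m\<in>M. (\<alpha> m)\<^sup>2) / 2) * \<bar>det (\<Sum>m\<in>M. \<alpha> m *\<^sub>R outer (rvec m))\<bar>)"
  have FMm: "?FM \<in> borel_measurable (\<Pi>\<^sub>M m\<in>M. lborel)"
    by (rule borel_measurable_gaussian_hessian)
  have merge: "?FM (merge J (range e) (\<alpha>, vec_coords e s)) = F1 s \<alpha>" for \<alpha> s
  proof -
    let ?m = "merge J (range e) (\<alpha>, vec_coords e s)"
    have m1: "?m m = \<alpha> m" if "m \<in> J" for m using that by (simp add: merge_def)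
    have m2: "?m (e k) = s $ k" for k using inj_e MJ(2) by (auto simp: merge_def vec_coords_def)
    have "(\<Sum>m\<in>J. (?m m)\<^sup>2) = (\<Sum>m\<in>J. (\<alpha> m)\<^sup>2)"
      by (rule sum.cong) (simp_all only: m1)
    moreover have "(\<Sum>m\<in>J. ?m m *\<^sub>R outer (rvec m)) = (\<Sum>m\<in>J. \<alpha> m *\<^sub>R outer (rvec m))"
      by (rule sum.cong) (simp_all only: m1)
    ultimately show ?thesis
      unfolding F1_def H_def sum_split m2 norm_vec_sum_squares by (simp only: add.commute)
  qed
  have FM: "(\<integral>\<^sup>+\<alpha>. ?FM \<alpha> \<partial>(\<Pi>\<^sub>M m\<in>M. lborel)) = (\<integral>\<^sup>+\<alpha>. \<integral>\<^sup>+s. F1 s \<alpha> \<partial>lborel \<partial>rest_scalars)"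
  proof -
    have "(\<integral>\<^sup>+\<alpha>. ?FM \<alpha> \<partial>(\<Pi>\<^sub>M m\<in>M. lborel))
      = (\<integral>\<^sup>+\<alpha>. \<integral>\<^sup>+\<omega>. ?FM (merge J (range e) (\<alpha>, \<omega>)) \<partial>(\<Pi>\<^sub>M m\<in>range e. lborel) \<partial>rest_scalars)"
      using product_nn_integral_fold[OF MJ(2) finJ _, of ?FM] FMm unfolding MJ(1) by simp
    also have "\<dots> = (\<integral>\<^sup>+\<alpha>. \<integral>\<^sup>+s. F1 s \<alpha> \<partial>lborel \<partial>rest_scalars)"
    proof (rule nn_integral_cong)
      fix \<alpha> assume \<alpha>: "\<alpha> \<in> space rest_scalars"
      have "(\<lambda>\<omega>. merge J (range e) (\<alpha>, \<omega>)) \<in> (\<Pi>\<^sub>M m\<in>range e. lborel) \<rightarrow>\<^sub>M (\<Pi>\<^sub>M m\<in>J \<union> range e. lborel)"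
        using \<alpha> by measurable
      from measurable_compose[OF this, of ?FM borel] FMm
      show "(\<integral>\<^sup>+\<omega>. ?FM (merge J (range e) (\<alpha>, \<omega>)) \<partial>(\<Pi>\<^sub>M m\<in>range e. lborel)) = (\<integral>\<^sup>+s. F1 s \<alpha> \<partial>lborel)"
        unfolding MJ(1) merge[symmetric] by (intro nn_integral_PiM_vec inj_e) simp
    qed
    finally show ?thesis .
  qed
  have F1m: "(\<lambda>p. F1 (snd p) (fst p)) \<in> borel_measurable (rest_scalars \<Otimes>\<^sub>M borel)"
  proof -
    have "(\<lambda>p. merge J (range e) (fst p, vec_coords e (snd p))) \<in> rest_scalars \<Otimes>\<^sub>M borel \<rightarrow>\<^sub>M (\<Pi>\<^sub>M m\<in>J \<union> range e. lborel)"
    proof (rule measurable_compose[OF _ measurable_merge])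
      show "(\<lambda>p. (fst p, vec_coords e (snd p))) \<in> rest_scalars \<Otimes>\<^sub>M borel \<rightarrow>\<^sub>M rest_scalars \<Otimes>\<^sub>M (\<Pi>\<^sub>M m\<in>range e. lborel)"
        by (intro measurable_Pair measurable_fst measurable_compose[OF measurable_snd measurable_vec_coords[OF inj_e]])
    qed
    from measurable_compose[OF this, of ?FM borel] FMm show ?thesis
      unfolding MJ(1) merge by simp
  qed
  have F1s: "(\<lambda>s. F1 s \<alpha>) \<in> borel_measurable borel" if "\<alpha> \<in> space rest_scalars" for \<alpha>
    using measurable_compose[OF measurable_Pair1'[OF that] F1m] by simp
  have F1i: "(\<lambda>\<alpha>. \<integral>\<^sup>+s. F1 s \<alpha> \<partial>lborel) \<in> borel_measurable rest_scalars"
  proof -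
    have "(\<lambda>(\<alpha>, s). F1 s \<alpha>) \<in> borel_measurable (rest_scalars \<Otimes>\<^sub>M lborel)"
      using F1m by (simp add: case_prod_beta' cong: measurable_cong_sets sets_pair_measure_cong)
    from lborel.borel_measurable_nn_integral[OF this] show ?thesis by simp
  qed
  have Wpair: "hess_weight s (\<lambda>m\<in>J. (\<alpha> m, \<beta> m)) = F1 s \<alpha> * G1 \<beta>" for s \<alpha> \<beta>
  proof -
    let ?v = "\<lambda>m\<in>J. (\<alpha> m, \<beta> m)"
    have 1: "(\<Sum>m\<in>J. (norm (?v m))\<^sup>2) = (\<Sum>m\<in>J. (\<alpha> m)\<^sup>2) + (\<Sum>m\<in>J. (\<beta> m)\<^sup>2)"
      unfolding sum.distrib[symmetric] by (rule sum.cong) (simp_all add: norm_prod_def)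
    have 2: "norm (forced_sine ?v) = norm (\<Sum>m\<in>J. \<beta> m *\<^sub>R q m)"
      unfolding forced_sine_def norm_minus_cancel by (rule arg_cong[where f=norm], rule sum.cong) simp_all
    have 3: "hessian_form s ?v = H s \<alpha>"
      unfolding hessian_form_def H_def by (rule arg_cong2[where f="(+)", OF refl], rule sum.cong) simp_all
    let ?a = "(\<Sum>m\<in>J. (\<alpha> m)\<^sup>2) + (norm s)\<^sup>2" and ?b = "\<Sum>m\<in>J. (\<beta> m)\<^sup>2" and ?c = "(norm (\<Sum>m\<in>J. \<beta> m *\<^sub>R q m))\<^sup>2"
    have "- ((\<Sum>m\<in>J. (\<alpha> m)\<^sup>2) + ?b + (norm s)\<^sup>2 + ?c) / 2 = - ?a / 2 + (- ?b / 2 - ?c / 2)"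
      by (simp add: field_simps)
    then have "exp (- ((\<Sum>m\<in>J. (\<alpha> m)\<^sup>2) + ?b + (norm s)\<^sup>2 + ?c) / 2) = exp (- ?a / 2) * exp (- ?b / 2 - ?c / 2)"
      by (simp only: exp_add)
    then show ?thesis
      unfolding hess_weight_def F1_def G1_def 1 2 3 by (subst ennreal_mult'[symmetric]) (auto simp: mult_ac)
  qed
  have "(\<integral>\<^sup>+v. mean_hess_weight v \<partial>rest_measure) = (\<integral>\<^sup>+\<alpha>. \<integral>\<^sup>+\<beta>. mean_hess_weight (\<lambda>m\<in>J. (\<alpha> m, \<beta> m)) \<partial>rest_scalars \<partial>rest_scalars)"
    by (rule nn_integral_PiM_pairs[OF finJ measurable_mean_hess_weight])
  also have "\<dots> = (\<integral>\<^sup>+\<alpha>. (\<integral>\<^sup>+s. F1 s \<alpha> \<partial>lborel) * (\<integral>\<^sup>+\<beta>. G1 \<beta> \<partial>rest_scalars) \<partial>rest_scalars)"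
  proof (rule nn_integral_cong)
    fix \<alpha> assume \<alpha>: "\<alpha> \<in> space rest_scalars"
    have "mean_hess_weight (\<lambda>m\<in>J. (\<alpha> m, \<beta> m)) = (\<integral>\<^sup>+s. F1 s \<alpha> \<partial>lborel) * G1 \<beta>" for \<beta>
      unfolding mean_hess_weight_def Wpair using F1s[OF \<alpha>] by (intro nn_integral_multc) simp
    then show "(\<integral>\<^sup>+\<beta>. mean_hess_weight (\<lambda>m\<in>J. (\<alpha> m, \<beta> m)) \<partial>rest_scalars) = (\<integral>\<^sup>+s. F1 s \<alpha> \<partial>lborel) * (\<integral>\<^sup>+\<beta>. G1 \<beta> \<partial>rest_scalars)"
      using G1m by (simp only: nn_integral_cmult)
  qed
  also have "\<dots> = (\<integral>\<^sup>+\<alpha>. \<integral>\<^sup>+s. F1 s \<alpha> \<partial>lborel \<partial>rest_scalars) * (\<integral>\<^sup>+\<beta>. G1 \<beta> \<partial>rest_scalars)"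
    by (rule nn_integral_multc[OF F1i])
  also have "(\<integral>\<^sup>+\<beta>. G1 \<beta> \<partial>rest_scalars) = ennreal (sqrt (2 * pi) ^ card J / sqrt (det (\<Sum>m\<in>M. outer (rvec m))))"
  proof -
    let ?g = "\<lambda>\<beta>. exp (- (\<Sum>m\<in>J. (\<beta> m)\<^sup>2) / 2 - (norm (\<Sum>m\<in>J. \<beta> m *\<^sub>R q m))\<^sup>2 / 2)"
    have gm: "(\<lambda>\<beta>. ennreal (?g \<beta>)) \<in> borel_measurable rest_scalars"
    proof -
      note [measurable] = borel_measurable_PiM_sum_squares[OF subset_refl, of J]
        borel_measurable_PiM_lincomb[OF subset_refl, where I=J and q=q]
      show ?thesis by measurable
    qed
    have "G1 \<beta> = ennreal (1 / \<bar>det P\<bar>) * ennreal (?g \<beta>)" for \<beta>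
      unfolding G1_def by (subst ennreal_mult'[symmetric]) auto
    then have "(\<integral>\<^sup>+\<beta>. G1 \<beta> \<partial>rest_scalars) = ennreal (1 / \<bar>det P\<bar>) * (\<integral>\<^sup>+\<beta>. ennreal (?g \<beta>) \<partial>rest_scalars)"
      using gm by (simp only: nn_integral_cmult)
    also have "(\<integral>\<^sup>+\<beta>. ennreal (?g \<beta>) \<partial>rest_scalars)
        = ennreal (sqrt (2 * pi) ^ card J * \<bar>det P\<bar> / sqrt (det (\<Sum>m\<in>M. outer (rvec m))))"
      unfolding J_def P_def q_def by (rule gaussian_on_constraint[OF finM inj_e e_sub detP])
    also have "ennreal (1 / \<bar>det P\<bar>) * ennreal (sqrt (2 * pi) ^ card J * \<bar>det P\<bar> / sqrt (det (\<Sum>m\<in>M. outer (rvec m))))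
        = ennreal (sqrt (2 * pi) ^ card J / sqrt (det (\<Sum>m\<in>M. outer (rvec m))))"
      using detP by (subst ennreal_mult'[symmetric]) (auto simp: P_def)
    finally show ?thesis .
  qed
  finally show ?thesis unfolding FM by (simp only: mult.commute)
qed

text \<open>
  Up to normalising powers of \<open>sqrt (2 * pi)\<close>, the mean number of critical points is the volume of the
  torus times the density of the gradient at \<open>0\<close> times the mean of \<open>\<bar>det Hess\<bar>\<close>.  The mean is
  unconditional because the Hessian and the gradient at a point are independent.
\<close>

theorem kac_rice:
  "(\<integral>\<^sup>+c. ennreal (exp (- (\<Sum>m\<in>M. (norm (c m))\<^sup>2) / 2)) * num_critical (trig_comb M c) \<partial>(\<Pi>\<^sub>M m\<in>M. lborel))
   = ennreal ((2 * pi) ^ CARD('n) * sqrt (2 * pi) ^ (card M - CARD('n)) / sqrt (det (\<Sum>m\<in>M. outer (rvec m))))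
    * (\<integral>\<^sup>+\<alpha>. ennreal (exp (- (\<Sum>m\<in>M. (\<alpha> m)\<^sup>2) / 2) * \<bar>det (\<Sum>m\<in>M. \<alpha> m *\<^sub>R outer (rvec m))\<bar>) \<partial>(\<Pi>\<^sub>M m\<in>M. lborel))"
proof -
  have "card J = card M - CARD('n)"
    unfolding J_def using e_sub inj_e by (simp add: card_Diff_subset card_image)
  then show ?thesis
    unfolding kac_rice_fibred integral_mean_hess_weight
    by (simp add: mult.assoc[symmetric] ennreal_mult'[symmetric] times_divide_eq_right)
qed

end

section \<open>Orthonormality of the modes\<close>

text \<open>
  No mode of the cone is the negative of another one, nor of itself.  This is what makes the modes
  orthogonal.
\<close>

lemma pos_cone_not_neg:
  assumes "m \<in> pos_cone" "n \<in> pos_cone"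
  shows "m + n \<noteq> (0 :: int^'n::{finite,linorder})"
proof
  assume z: "m + n = 0"
  obtain i where i: "\<forall>j<i. m $ j = 0" "0 < m $ i" using assms(1) by (auto simp: pos_cone_def vec_prec_def)
  obtain k where k: "\<forall>j<k. n $ j = 0" "0 < n $ k" using assms(2) by (auto simp: pos_cone_def vec_prec_def)
  have s: "m $ j + n $ j = 0" for j using z by (metis vector_add_component zero_index)
  show False
    using i k s[of i] s[of k] by (cases i k rule: linorder_cases) auto
qed

lemma integral_cis_period:
  fixes k :: int
  assumes "k \<noteq> 0"
  shows "(LINT t|lborel. indicator {0..<2 * pi} t *\<^sub>R cis (of_int k * t)) = 0"
proof -
  have "(LINT t|lborel. indicator {0..<2 * pi} t *\<^sub>R cis (of_int k * t))
      = (LINT t|lborel. indicator {0..2 * pi} t *\<^sub>R cis (of_int k * t))"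
  proof (rule integral_cong_AE)
    have "AE t in lborel. t \<noteq> 2 * pi" by (rule AE_lborel_singleton)
    then show "AE t in lborel. indicator {0..<2 * pi} t *\<^sub>R cis (of_int k * t) = indicator {0..2 * pi} t *\<^sub>R cis (of_int k * t)"
      by eventually_elim (auto simp: indicator_def)
    have [measurable]: "(\<lambda>t. cis (of_int k * t)) \<in> borel_measurable borel"
      by (intro borel_measurable_continuous_onI continuous_intros)
    show "(\<lambda>t. indicator {0..<2 * pi} t *\<^sub>R cis (of_int k * t)) \<in> borel_measurable lborel"
      "(\<lambda>t. indicator {0..2 * pi} t *\<^sub>R cis (of_int k * t)) \<in> borel_measurable lborel" by measurable
  qed
  also have "\<dots> = cis (of_int k * (2 * pi)) / (\<i> * of_int k) - cis (of_int k * 0) / (\<i> * of_int k)"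
  proof (rule integral_FTC_Icc)
    fix t :: real
    have nz: "\<i> * of_int k \<noteq> (0::complex)" using assms by simp
    have "((\<lambda>z. exp (\<i> * of_int k * z) / (\<i> * of_int k)) has_field_derivative exp (\<i> * of_int k * of_real t)) (at (of_real t))"
      using nz by (auto intro!: derivative_eq_intros)
    from has_vector_derivative_real_field[OF this, of "{0..2 * pi}"]
    show "((\<lambda>t. cis (of_int k * t) / (\<i> * of_int k)) has_vector_derivative cis (of_int k * t)) (at t within {0..2 * pi})"
      by (simp add: cis_conv_exp mult.assoc)
  qed (auto intro!: continuous_intros)
  also have "cis (of_int k * (2 * pi)) = 1"
    using cis_multiple_2pi[of "of_int k"] by (simp add: mult.commute mult.left_commute)
  finally show ?thesis by simp
qed

text \<open>
  The integrand is a product of functions of one coordinate each, and a coordinate with \<open>k $ j \<noteq> 0\<close>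
  contributes the integral of a nontrivial character over a full period.
\<close>

lemma integral_cis_torus:
  fixes k :: "int^'n::finite"
  assumes "k \<noteq> 0"
  shows "(LINT x|lborel. indicator torus x *\<^sub>R cis (rvec k \<bullet> x)) = 0"
proof -
  interpret product_sigma_finite "\<lambda>_::'n. lborel :: real measure"
    by (rule product_sigma_finite_lborel)
  let ?R = "\<Pi>\<^sub>M i\<in>range (id :: 'n \<Rightarrow> 'n). (lborel :: real measure)"
  let ?f = "\<lambda>j t. indicator {0..<2 * pi} t *\<^sub>R cis (of_int (k $ j) * t)"
  have [measurable]: "(\<lambda>t. cis (of_int j * t)) \<in> borel_measurable borel" for j :: int
    by (intro borel_measurable_continuous_onI continuous_intros)
  have [measurable]: "(\<lambda>x. cis (rvec k \<bullet> x)) \<in> borel_measurable borel"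
    by (intro borel_measurable_continuous_onI continuous_intros)
  have m: "(\<lambda>\<omega>. (\<chi> j. \<omega> (id j)) :: real^'n) \<in> borel_measurable ?R"
    by (subst borel_measurable_euclidean_space)
       (auto simp: Basis_vec_def inner_axis intro!: borel_measurable_PiM_component)
  have "(LINT x|lborel. indicator torus x *\<^sub>R cis (rvec k \<bullet> x))
      = (LINT \<omega>|?R. indicator torus ((\<chi> j. \<omega> (id j)) :: real^'n) *\<^sub>R cis (rvec k \<bullet> (\<chi> j. \<omega> (id j))))"
    unfolding distr_PiM_vec[OF inj_on_id, symmetric]
    by (rule integral_distr[OF m]) measurable
  also have "\<dots> = (LINT \<omega>|?R. (\<Prod>j\<in>range id. ?f j (\<omega> j)))"
  proof (rule Bochner_Integration.integral_cong[OF refl])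
    fix \<omega> :: "'n \<Rightarrow> real"
    have "cis (rvec k \<bullet> (\<chi> j. \<omega> (id j))) = (\<Prod>j\<in>UNIV. cis (of_int (k $ j) * \<omega> j))"
      unfolding cis_conv_exp by (simp add: exp_sum[symmetric] rvec_def inner_vec_def sum_distrib_left)
    moreover have "(indicator torus ((\<chi> j. \<omega> (id j)) :: real^'n) :: real) = (\<Prod>j\<in>UNIV. indicator {0..<2 * pi} (\<omega> j))"
    proof (cases "\<forall>j. \<omega> j \<in> {0..<2 * pi}")
      case True
      then show ?thesis by (simp add: torus_def indicator_def)
    next
      case False
      then obtain j where "\<omega> j \<notin> {0..<2 * pi}" by blast
      then have "indicator {0..<2 * pi} (\<omega> j) = (0::real)" by (rule indicator_simps(2))
      then have "(\<Prod>j\<in>UNIV. indicator {0..<2 * pi} (\<omega> j)) = (0::real)"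
        by (intro prod_zero finite bexI[of _ j]) simp_all
      moreover have "(\<chi> j. \<omega> (id j)) \<notin> torus" using False by (auto simp: torus_def)
      ultimately show ?thesis by simp
    qed
    ultimately show "indicator torus ((\<chi> j. \<omega> (id j)) :: real^'n) *\<^sub>R cis (rvec k \<bullet> (\<chi> j. \<omega> (id j)))
        = (\<Prod>j\<in>range id. ?f j (\<omega> j))"
      by (simp add: scaleR_conv_of_real prod.distrib)
  qed
  also have "\<dots> = (\<Prod>j\<in>range id. integral\<^sup>L lborel (?f j))"
  proof (rule product_integral_prod)
    fix j
    show "integrable lborel (?f j)"
      by (rule Bochner_Integration.integrable_bound[where f="indicator {0..<2 * pi} :: real \<Rightarrow> real"])
         (auto simp: indicator_def)
  qed simp
  also have "\<dots> = 0"
  proof -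
    obtain j where "k $ j \<noteq> 0" using assms by (auto simp: vec_eq_iff)
    then show ?thesis
      by (intro prod_zero) (auto intro!: exI[of _ j] integral_cis_period)
  qed
  finally show ?thesis .
qed

lemma integrable_torus:
  fixes f :: "real^'n::finite \<Rightarrow> 'b::euclidean_space"
  assumes "continuous_on UNIV f" "\<And>x. norm (f x) \<le> B"
  shows "integrable lborel (\<lambda>x. indicator torus x *\<^sub>R f x)"
proof (rule Bochner_Integration.integrable_bound[where f="\<lambda>x. indicator torus x *\<^sub>R B"])
  show "integrable lborel (\<lambda>x::real^'n. indicator torus x *\<^sub>R B)"
    by (intro integrable_scaleR_left integrable_real_indicator) (simp_all add: emeasure_torus)
  have [measurable]: "f \<in> borel_measurable borel" using assms(1) by (rule borel_measurable_continuous_onI)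
  show "(\<lambda>x. indicator torus x *\<^sub>R f x) \<in> borel_measurable lborel" by measurable
  have "0 \<le> B" by (rule order_trans[OF norm_ge_zero assms(2)])
  with assms(2) show "AE x in lborel. norm (indicator torus x *\<^sub>R f x) \<le> norm (indicator torus x *\<^sub>R B)"
    by (intro AE_I2) (auto simp: indicator_def)
qed

lemma integral_cos_sin_torus:
  fixes k :: "int^'n::finite"
  shows "(LINT x|lborel. indicator torus x *\<^sub>R cos (rvec k \<bullet> x)) = (if k = 0 then (2 * pi) ^ CARD('n) else 0)"
    and "(LINT x|lborel. indicator torus x *\<^sub>R sin (rvec k \<bullet> x)) = 0"
proof -
  have int: "integrable lborel (\<lambda>x. indicator torus x *\<^sub>R cis (rvec k \<bullet> x))"
    by (rule integrable_torus[of _ 1]) (auto intro!: continuous_intros)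
  have c: "(LINT x|lborel. indicator torus x *\<^sub>R cos (rvec k \<bullet> x)) = Re (LINT x|lborel. indicator torus x *\<^sub>R cis (rvec k \<bullet> x))"
    using integral_Re[OF int] by simp
  have s: "(LINT x|lborel. indicator torus x *\<^sub>R sin (rvec k \<bullet> x)) = Im (LINT x|lborel. indicator torus x *\<^sub>R cis (rvec k \<bullet> x))"
    using integral_Im[OF int] by simp
  show "(LINT x|lborel. indicator torus x *\<^sub>R cos (rvec k \<bullet> x)) = (if k = 0 then (2 * pi) ^ CARD('n) else 0)"
  proof (cases "k = 0")
    case True
    then have "rvec k = 0" by (simp add: rvec_def vec_eq_iff)
    then show ?thesis using True by (simp add: measure_def emeasure_torus)
  next
    case False
    then show ?thesis unfolding c using integral_cis_torus[OF False] by simp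
  qed
  show "(LINT x|lborel. indicator torus x *\<^sub>R sin (rvec k \<bullet> x)) = 0"
  proof (cases "k = 0")
    case True
    then have "rvec k = 0" by (simp add: rvec_def vec_eq_iff)
    then show ?thesis by simp
  next
    case False
    then show ?thesis unfolding s using integral_cis_torus[OF False] by simp
  qed
qed

lemma rvec_add: "rvec (m + n) = rvec m + rvec n" and rvec_diff: "rvec (m - n) = rvec m - rvec n"
  by (simp_all add: rvec_def vec_eq_iff)

text \<open>
  Products of sines and cosines are rewritten through the frequencies \<open>m + n\<close> and \<open>m - n\<close>, of which the
  first never vanishes and the second vanishes only for \<open>m = n\<close>.
\<close>

lemma mode_inner:
  fixes m n :: "int^'n::{finite,linorder}"
  assumes "m \<in> pos_cone" "n \<in> pos_cone"
  defines "f \<equiv> \<lambda>m p x. fst (rot2 (rvec m \<bullet> x) p)"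
  shows "(LINT x|lborel. indicator torus x *\<^sub>R (f m p x * f n r x)) = (if m = n then (2 * pi) ^ CARD('n) / 2 * (fst p * fst r + snd p * snd r) else 0)"
    and "integrable lborel (\<lambda>x. indicator torus x *\<^sub>R (f m p x * f n r x))"
proof -
  obtain a b where p: "p = (a, b)" by (cases p)
  obtain c d where r: "r = (c, d)" by (cases r)
  have prod: "(a * cos \<phi> + b * sin \<phi>) * (c * cos \<psi> + d * sin \<psi>)
     = (a * c + b * d) / 2 * cos (\<phi> - \<psi>) + (a * c - b * d) / 2 * cos (\<phi> + \<psi>)
       + (a * d + b * c) / 2 * sin (\<phi> + \<psi>) + (b * c - a * d) / 2 * sin (\<phi> - \<psi>)" for \<phi> \<psi>
    by (simp add: cos_diff cos_add sin_diff sin_add field_simps)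
  have eq: "indicator torus x *\<^sub>R (f m p x * f n r x)
     = (a * c + b * d) / 2 * (indicator torus x *\<^sub>R cos (rvec (m - n) \<bullet> x))
       + (a * c - b * d) / 2 * (indicator torus x *\<^sub>R cos (rvec (m + n) \<bullet> x))
       + (a * d + b * c) / 2 * (indicator torus x *\<^sub>R sin (rvec (m + n) \<bullet> x))
       + (b * c - a * d) / 2 * (indicator torus x *\<^sub>R sin (rvec (m - n) \<bullet> x))" for x
    unfolding f_def rot2_def p r fst_conv snd_conv prod rvec_add rvec_diff inner_add_left inner_diff_left
    by (simp add: algebra_simps)
  have ic: "integrable lborel (\<lambda>x. indicator torus x *\<^sub>R cos (rvec k \<bullet> x))"
    and si: "integrable lborel (\<lambda>x. indicator torus x *\<^sub>R sin (rvec k \<bullet> x))" for k :: "int^'n::_"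
    by (rule integrable_torus[of _ 1]; auto intro!: continuous_intros)+
  have i: "integrable lborel (\<lambda>x. y * (indicator torus x *\<^sub>R cos (rvec k \<bullet> x)))"
     "integrable lborel (\<lambda>x. y * (indicator torus x *\<^sub>R sin (rvec k \<bullet> x)))" for y and k :: "int^'n::_"
    using integrable_mult_right[OF ic] integrable_mult_right[OF si] by blast+
  show "integrable lborel (\<lambda>x. indicator torus x *\<^sub>R (f m p x * f n r x))"
    unfolding eq by (intro Bochner_Integration.integrable_add i)
  have "m + n \<noteq> 0" by (rule pos_cone_not_neg[OF assms(1,2)])
  then show "(LINT x|lborel. indicator torus x *\<^sub>R (f m p x * f n r x)) = (if m = n then (2 * pi) ^ CARD('n) / 2 * (fst p * fst r + snd p * snd r) else 0)"
    unfolding eq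
    by (simp only: Bochner_Integration.integral_add Bochner_Integration.integrable_add i integral_mult_right_zero integral_cos_sin_torus)
       (simp add: p r)
qed

lemma l2_inner_trig_comb:
  fixes M :: "(int^'n::{finite,linorder}) set"
  assumes M: "finite M" "M \<subseteq> pos_cone"
  shows "l2_inner (trig_comb M c) (trig_comb M d) = (\<Sum>m\<in>M. fst (c m) * fst (d m) + snd (c m) * snd (d m))"
proof -
  let ?f = "\<lambda>m p x. fst (rot2 (rvec m \<bullet> x) p)"
  have i: "integrable lborel (\<lambda>x. indicator torus x *\<^sub>R (?f m (c m) x * ?f n (d n) x))" if "m \<in> M" "n \<in> M" for m n
    using mode_inner(2)[of m n] that M by blast
  have "l2_inner (trig_comb M c) (trig_comb M d)
     = (LINT x|lborel. (amp M)\<^sup>2 * (\<Sum>m\<in>M. \<Sum>n\<in>M. indicator torus x *\<^sub>R (?f m (c m) x * ?f n (d n) x)))"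
    unfolding l2_inner_def set_lebesgue_integral_def trig_comb_eq
  proof (rule Bochner_Integration.integral_cong[OF refl])
    fix x
    have "(\<Sum>m\<in>M. \<Sum>n\<in>M. indicator torus x *\<^sub>R (?f m (c m) x * ?f n (d n) x))
        = indicator torus x *\<^sub>R ((\<Sum>m\<in>M. ?f m (c m) x) * (\<Sum>n\<in>M. ?f n (d n) x))"
      unfolding sum_product scaleR_sum_right ..
    then show "indicator torus x *\<^sub>R (amp M * (\<Sum>m\<in>M. ?f m (c m) x) * (amp M * (\<Sum>n\<in>M. ?f n (d n) x)))
        = (amp M)\<^sup>2 * (\<Sum>m\<in>M. \<Sum>n\<in>M. indicator torus x *\<^sub>R (?f m (c m) x * ?f n (d n) x))"
      by (simp only:) (simp add: power2_eq_square mult_ac)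
  qed
  also have "\<dots> = (amp M)\<^sup>2 * (\<Sum>m\<in>M. \<Sum>n\<in>M. (LINT x|lborel. indicator torus x *\<^sub>R (?f m (c m) x * ?f n (d n) x)))"
    using i by (simp add: Bochner_Integration.integral_sum Bochner_Integration.integrable_sum)
  also have "\<dots> = (amp M)\<^sup>2 * (\<Sum>m\<in>M. \<Sum>n\<in>M. if m = n then (2 * pi) ^ CARD('n) / 2 * (fst (c m) * fst (d n) + snd (c m) * snd (d n)) else 0)"
    using M(2) by (intro arg_cong2[where f="(*)"] refl sum.cong mode_inner(1)) auto
  also have "\<dots> = (amp M)\<^sup>2 * (\<Sum>m\<in>M. (2 * pi) ^ CARD('n) / 2 * (fst (c m) * fst (d m) + snd (c m) * snd (d m)))"
    using M(1) by (simp add: sum.delta)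
  also have "\<dots> = (\<Sum>m\<in>M. fst (c m) * fst (d m) + snd (c m) * snd (d m))"
    unfolding amp_square sum_distrib_left[symmetric] by simp
  finally show ?thesis .
qed

section \<open>Averages over the sphere and Gaussian averages\<close>

abbreviation coef_measure :: "(int^'n) set \<Rightarrow> (int^'n \<Rightarrow> real \<times> real) measure" where
  "coef_measure M \<equiv> \<Pi>\<^sub>M m\<in>M. lborel"

definition sqnorm :: "(int^'n) set \<Rightarrow> (int^'n \<Rightarrow> real \<times> real) \<Rightarrow> real" where
  "sqnorm M c = (\<Sum>m\<in>M. (norm (c m))\<^sup>2)"

lemma sqnorm_nonneg: "0 \<le> sqnorm M c"
  by (simp add: sqnorm_def sum_nonneg)

lemma borel_measurable_sqnorm[measurable]: "sqnorm M \<in> borel_measurable (coef_measure M)"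
  unfolding sqnorm_def[abs_def]
  by (intro borel_measurable_sum borel_measurable_power
      measurable_compose[OF borel_measurable_PiM_component borel_measurable_norm])

lemma l2_inner_eq_sqnorm:
  fixes M :: "(int^'n::{finite,linorder}) set"
  assumes "finite M" "M \<subseteq> pos_cone"
  shows "l2_inner (trig_comb M c) (trig_comb M c) = sqnorm M c"
  unfolding l2_inner_trig_comb[OF assms] sqnorm_def
  by (rule sum.cong) (simp_all add: norm_prod_def power2_eq_square)

lemma rot2_scaleR: "rot2 t (r *\<^sub>R p) = r *\<^sub>R rot2 t p"
  by (simp add: rot2_def algebra_simps)

lemma trig_comb_scaleR:
  "trig_comb M (\<lambda>m\<in>M. r *\<^sub>R c m) x = r * trig_comb M c x"
  "crit_field M (\<lambda>m\<in>M. r *\<^sub>R c m) x = r *\<^sub>R crit_field M c x"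
proof -
  have "(\<Sum>m\<in>M. fst (rot2 (rvec m \<bullet> x) ((\<lambda>m\<in>M. r *\<^sub>R c m) m))) = r * (\<Sum>m\<in>M. fst (rot2 (rvec m \<bullet> x) (c m)))"
    unfolding sum_distrib_left by (rule sum.cong) (simp_all add: rot2_scaleR)
  then show "trig_comb M (\<lambda>m\<in>M. r *\<^sub>R c m) x = r * trig_comb M c x"
    unfolding trig_comb_eq by simp
  show "crit_field M (\<lambda>m\<in>M. r *\<^sub>R c m) x = r *\<^sub>R crit_field M c x"
    unfolding crit_field_def scaleR_sum_right by (rule sum.cong) (simp_all add: rot2_scaleR)
qed

lemma num_critical_scaleR:
  "r \<noteq> 0 \<Longrightarrow> num_critical (trig_comb M (\<lambda>m\<in>M. r *\<^sub>R c m)) = num_critical (trig_comb M c)"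
  unfolding num_critical_def critical_points_trig_comb trig_comb_scaleR(2) by simp

lemma sqnorm_scaleR: "sqnorm M (\<lambda>m\<in>M. r *\<^sub>R c m) = r\<^sup>2 * sqnorm M c"
  unfolding sqnorm_def sum_distrib_left by (rule sum.cong) (simp_all add: power_mult_distrib)

lemma gaussian_tail:
  assumes "r \<ge> 0"
  shows "(\<integral>\<^sup>+s. ennreal (s * exp (- s\<^sup>2 / 2)) * indicator {sqrt r..} s \<partial>lborel) = ennreal (exp (- r / 2))"
proof -
  have "(\<integral>\<^sup>+s. ennreal (s * exp (- s\<^sup>2 / 2)) * indicator {sqrt r..} s \<partial>lborel) = ennreal (0 - (- exp (- (sqrt r)\<^sup>2 / 2)))"
  proof (rule nn_integral_FTC_atLeast[where F="\<lambda>s. - exp (- s\<^sup>2 / 2)"])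
    show "(\<lambda>s::real. s * exp (- s\<^sup>2 / 2)) \<in> borel_measurable borel" by measurable
    fix s :: real assume s: "sqrt r \<le> s"
    show "((\<lambda>s. - exp (- s\<^sup>2 / 2)) has_real_derivative s * exp (- s\<^sup>2 / 2)) (at s)"
      by (auto intro!: derivative_eq_intros)
    have "0 \<le> sqrt r" using assms by simp
    with s have "0 \<le> s" by linarith
    then show "0 \<le> s * exp (- s\<^sup>2 / 2)" by simp
  next
    have "((\<lambda>s::real. - exp (- s\<^sup>2 / 2)) \<longlongrightarrow> - 0) at_top"
    proof (intro tendsto_minus filterlim_compose[OF exp_at_bot])
      show "filterlim (\<lambda>s::real. - s\<^sup>2 / 2) at_bot at_top"
        by real_asymp
    qed
    then show "((\<lambda>s::real. - exp (- s\<^sup>2 / 2)) \<longlongrightarrow> 0) at_top" by simp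
  qed
  then show ?thesis using assms by simp
qed

text \<open>
  The Gaussian density is a superposition of indicator functions of balls.  On a ball of radius \<open>s\<close>
  the integral of a function that is homogeneous of degree zero is \<open>s ^ (2 * card M)\<close> times its integral over
  the unit ball.
\<close>

lemma gaussian_integral_layers:
  fixes M :: "(int^'n) set" and f :: "(int^'n \<Rightarrow> real \<times> real) \<Rightarrow> ennreal"
  assumes M: "finite M" and f: "f \<in> borel_measurable (coef_measure M)"
    and hom: "\<And>r c. r > 0 \<Longrightarrow> f (\<lambda>m\<in>M. r *\<^sub>R c m) = f c"
  shows "(\<integral>\<^sup>+c. ennreal (exp (- sqnorm M c / 2)) * f c \<partial>coef_measure M)
    = (\<integral>\<^sup>+s. ennreal (s ^ (2 * card M + 1) * exp (- s\<^sup>2 / 2)) * indicator {0<..} s \<partial>lborel)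
      * (\<integral>\<^sup>+c. indicator {c. sqnorm M c \<le> 1} c * f c \<partial>coef_measure M)"
proof -
  interpret product_sigma_finite "\<lambda>_::int^'n. lborel :: (real \<times> real) measure"
    by (rule product_sigma_finite_lborel)
  interpret R: sigma_finite_measure "coef_measure M" by (rule sigma_finite[OF M])
  interpret pair_sigma_finite "coef_measure M" "lborel :: real measure" ..
  let ?R = "coef_measure M"
  note [measurable] = f
  let ?B = "\<integral>\<^sup>+c. indicator {c. sqnorm M c \<le> 1} c * f c \<partial>?R"
  have ball: "(\<integral>\<^sup>+c. indicator {c. sqnorm M c \<le> s\<^sup>2} c * f c \<partial>?R) = ennreal (s ^ (2 * card M)) * ?B"
    if s: "s > 0" for s
  proof -
    have m: "(\<lambda>c. indicator {c. sqnorm M c \<le> s\<^sup>2} c * f c) \<in> borel_measurable ?R"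
    proof -
      have "(\<lambda>c. indicator {..s\<^sup>2} (sqnorm M c) * f c) \<in> borel_measurable ?R" by measurable
      then show ?thesis by (simp add: indicator_def)
    qed
    have em: "emeasure lborel ((\<lambda>v::real\<times>real. s *\<^sub>R v) -` A) = ennreal (1 / s\<^sup>2) * emeasure lborel A"
      if "A \<in> sets borel" for A
      using emeasure_lborel_scaleR_vimage[OF _ that, of s] s by (simp add: power2_eq_square)
    have "(\<integral>\<^sup>+c. (indicator {c. sqnorm M c \<le> s\<^sup>2} (\<lambda>m\<in>M. s *\<^sub>R c m) * f (\<lambda>m\<in>M. s *\<^sub>R c m)) \<partial>?R)
        = ennreal (1 / s\<^sup>2) ^ card M * (\<integral>\<^sup>+c. indicator {c. sqnorm M c \<le> s\<^sup>2} c * f c \<partial>?R)"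
      by (rule nn_integral_PiM_componentwise[OF M _ _ em m]) (use s in auto)
    moreover have "(indicator {c. sqnorm M c \<le> s\<^sup>2} (\<lambda>m\<in>M. s *\<^sub>R c m) :: ennreal) = indicator {c. sqnorm M c \<le> 1} c" for c
      using s by (auto simp: indicator_def sqnorm_scaleR)
    ultimately have "?B = ennreal (1 / s\<^sup>2) ^ card M * (\<integral>\<^sup>+c. indicator {c. sqnorm M c \<le> s\<^sup>2} c * f c \<partial>?R)"
      by (simp only: hom[OF s])
    then have "ennreal (s ^ (2 * card M)) * ?B
      = (ennreal (s ^ (2 * card M)) * ennreal (1 / s\<^sup>2) ^ card M) * (\<integral>\<^sup>+c. indicator {c. sqnorm M c \<le> s\<^sup>2} c * f c \<partial>?R)"
      by (simp only: mult.assoc)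
    also have "ennreal (s ^ (2 * card M)) * ennreal (1 / s\<^sup>2) ^ card M = 1"
      using s by (simp add: ennreal_power ennreal_mult[symmetric] power_mult power_divide)
    finally show ?thesis by (simp only: mult_1)
  qed
  have "(\<integral>\<^sup>+c. ennreal (exp (- sqnorm M c / 2)) * f c \<partial>?R)
      = (\<integral>\<^sup>+c. \<integral>\<^sup>+s. ennreal (s * exp (- s\<^sup>2 / 2)) * indicator {sqrt (sqnorm M c)..} s * f c \<partial>lborel \<partial>?R)"
  proof (rule nn_integral_cong)
    fix c
    have "(\<integral>\<^sup>+s. ennreal (s * exp (- s\<^sup>2 / 2)) * indicator {sqrt (sqnorm M c)..} s * f c \<partial>lborel)
        = (\<integral>\<^sup>+s. ennreal (s * exp (- s\<^sup>2 / 2)) * indicator {sqrt (sqnorm M c)..} s \<partial>lborel) * f c"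
      by (rule nn_integral_multc) measurable
    then show "ennreal (exp (- sqnorm M c / 2)) * f c
        = (\<integral>\<^sup>+s. ennreal (s * exp (- s\<^sup>2 / 2)) * indicator {sqrt (sqnorm M c)..} s * f c \<partial>lborel)"
      by (simp only: gaussian_tail[OF sqnorm_nonneg])
  qed
  also have "\<dots> = (\<integral>\<^sup>+s. \<integral>\<^sup>+c. ennreal (s * exp (- s\<^sup>2 / 2)) * indicator {sqrt (sqnorm M c)..} s * f c \<partial>?R \<partial>lborel)"
  proof (rule Fubini'[symmetric])
    have "(\<lambda>p. ennreal (snd p * exp (- (snd p)\<^sup>2 / 2)) * indicator {0..} (snd p - sqrt (sqnorm M (fst p))) * f (fst p))
        \<in> borel_measurable (?R \<Otimes>\<^sub>M lborel)"
      by measurable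
    then show "(\<lambda>(c, s). ennreal (s * exp (- s\<^sup>2 / 2)) * indicator {sqrt (sqnorm M c)..} s * f c) \<in> borel_measurable (?R \<Otimes>\<^sub>M lborel)"
      by (simp add: case_prod_beta' indicator_def)
  qed
  also have "\<dots> = (\<integral>\<^sup>+s. ennreal (s ^ (2 * card M + 1) * exp (- s\<^sup>2 / 2)) * indicator {0<..} s * ?B \<partial>lborel)"
  proof (rule nn_integral_cong)
    fix s :: real
    show "(\<integral>\<^sup>+c. ennreal (s * exp (- s\<^sup>2 / 2)) * indicator {sqrt (sqnorm M c)..} s * f c \<partial>?R)
        = ennreal (s ^ (2 * card M + 1) * exp (- s\<^sup>2 / 2)) * indicator {0<..} s * ?B"
    proof (cases "s > 0")
      case True
      have "(indicator {sqrt (sqnorm M c)..} s :: ennreal) = indicator {c. sqnorm M c \<le> s\<^sup>2} c" for c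
        using True by (auto simp: indicator_def real_le_lsqrt real_sqrt_le_iff sqnorm_nonneg intro: real_le_lsqrt sqrt_le_D)
      then have "(\<integral>\<^sup>+c. ennreal (s * exp (- s\<^sup>2 / 2)) * indicator {sqrt (sqnorm M c)..} s * f c \<partial>?R)
          = (\<integral>\<^sup>+c. ennreal (s * exp (- s\<^sup>2 / 2)) * (indicator {c. sqnorm M c \<le> s\<^sup>2} c * f c) \<partial>?R)"
        by (simp only: mult.assoc)
      also have "\<dots> = ennreal (s * exp (- s\<^sup>2 / 2)) * (\<integral>\<^sup>+c. indicator {c. sqnorm M c \<le> s\<^sup>2} c * f c \<partial>?R)"
      proof (rule nn_integral_cmult)
        have "(\<lambda>c. indicator {..s\<^sup>2} (sqnorm M c) * f c) \<in> borel_measurable ?R" by measurable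
        then show "(\<lambda>c. indicator {c. sqnorm M c \<le> s\<^sup>2} c * f c) \<in> borel_measurable ?R" by (simp add: indicator_def)
      qed
      also have "\<dots> = ennreal (s * exp (- s\<^sup>2 / 2)) * (ennreal (s ^ (2 * card M)) * ?B)"
        by (simp only: ball[OF True])
      also have "\<dots> = ennreal (s ^ (2 * card M + 1) * exp (- s\<^sup>2 / 2)) * ?B"
        using True by (simp add: mult.assoc[symmetric] ennreal_mult[symmetric]) (simp add: mult_ac)
      finally show ?thesis using True by simp
    next
      case False
      have "ennreal (s * exp (- s\<^sup>2 / 2)) = 0" using False by (simp add: ennreal_eq_0_iff mult_le_0_iff)
      then show ?thesis using False by simp
    qed
  qed
  also have "\<dots> = (\<integral>\<^sup>+s. ennreal (s ^ (2 * card M + 1) * exp (- s\<^sup>2 / 2)) * indicator {0<..} s \<partial>lborel) * ?B"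
    by (rule nn_integral_multc) measurable
  finally show ?thesis .
qed

lemma gaussian_total:
  fixes M :: "(int^'n) set"
  assumes M: "finite M"
  shows "(\<integral>\<^sup>+c. ennreal (exp (- sqnorm M c / 2)) \<partial>coef_measure M) = ennreal ((2 * pi) ^ card M)"
proof -
  interpret product_sigma_finite "\<lambda>_::int^'n. lborel :: (real \<times> real) measure"
    by (rule product_sigma_finite_lborel)
  have one: "(\<integral>\<^sup>+t. ennreal (exp (- t\<^sup>2 / 2)) \<partial>lborel) = ennreal (sqrt (2 * pi))"
    using nn_integral_gauss_quadratic[of 1 0] by simp
  have two: "(\<integral>\<^sup>+p. ennreal (exp (- (norm (p::real\<times>real))\<^sup>2 / 2)) \<partial>lborel) = ennreal (2 * pi)"
  proof -
    have "exp (- (norm p)\<^sup>2 / 2) = exp (- (fst p)\<^sup>2 / 2) * exp (- (snd p)\<^sup>2 / 2)" for p :: "real \<times> real"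
      by (simp add: norm_prod_def exp_add[symmetric] add_divide_distrib[symmetric] diff_divide_distrib[symmetric])
    then have "(\<integral>\<^sup>+p. ennreal (exp (- (norm (p::real\<times>real))\<^sup>2 / 2)) \<partial>lborel)
        = (\<integral>\<^sup>+p. ennreal (exp (- (fst p)\<^sup>2 / 2)) * ennreal (exp (- (snd p)\<^sup>2 / 2)) \<partial>(lborel \<Otimes>\<^sub>M lborel))"
      unfolding lborel_prod by (simp only: ennreal_mult'[OF exp_ge_zero])
    also have "\<dots> = (\<integral>\<^sup>+a. \<integral>\<^sup>+b. ennreal (exp (- a\<^sup>2 / 2)) * ennreal (exp (- b\<^sup>2 / 2)) \<partial>lborel \<partial>lborel)"
      by (subst lborel.nn_integral_fst[symmetric]) auto
    also have "\<dots> = ennreal (sqrt (2 * pi)) * ennreal (sqrt (2 * pi))"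
      by (simp add: nn_integral_cmult nn_integral_multc one[simplified])
    also have "\<dots> = ennreal (2 * pi)" by (simp add: ennreal_mult[symmetric])
    finally show ?thesis .
  qed
  have "ennreal (exp (- sqnorm M c / 2)) = (\<Prod>m\<in>M. ennreal (exp (- (norm (c m))\<^sup>2 / 2)))" for c
  proof -
    have "exp (- sqnorm M c / 2) = (\<Prod>m\<in>M. exp (- (norm (c m))\<^sup>2 / 2))"
      using M by (simp add: sqnorm_def exp_sum[symmetric] sum_negf sum_divide_distrib)
    then show ?thesis by (simp add: prod_ennreal)
  qed
  then have "(\<integral>\<^sup>+c. ennreal (exp (- sqnorm M c / 2)) \<partial>coef_measure M) = (\<Prod>m\<in>M. \<integral>\<^sup>+p. ennreal (exp (- (norm (p::real\<times>real))\<^sup>2 / 2)) \<partial>lborel)"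
    using product_nn_integral_prod[OF M, of "\<lambda>_ p. ennreal (exp (- (norm p)\<^sup>2 / 2))"] by simp
  then show ?thesis unfolding two by (simp add: ennreal_power)
qed

lemma AE_sqnorm_pos:
  fixes M :: "(int^'n) set"
  assumes M: "finite M" "M \<noteq> {}"
  shows "AE c in coef_measure M. 0 < sqnorm M c"
proof (rule AE_I)
  interpret product_sigma_finite "\<lambda>_::int^'n. lborel :: (real \<times> real) measure"
    by (rule product_sigma_finite_lborel)
  show "{c \<in> space (coef_measure M). \<not> 0 < sqnorm M c} \<subseteq> (\<Pi>\<^sub>E m\<in>M. {0})"
  proof
    fix c assume c: "c \<in> {c \<in> space (coef_measure M). \<not> 0 < sqnorm M c}"
    then have "sqnorm M c = 0" using sqnorm_nonneg[of M c] by auto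
    then have "\<forall>m\<in>M. c m = 0" using M(1) by (simp add: sqnorm_def sum_nonneg_eq_0_iff)
    with c show "c \<in> (\<Pi>\<^sub>E m\<in>M. {0})" by (auto simp: space_PiM PiE_iff extensional_def fun_eq_iff)
  qed
  have "emeasure (coef_measure M) (\<Pi>\<^sub>E m\<in>M. {0}) = (\<Prod>m\<in>M. emeasure lborel {0 :: real \<times> real})"
    by (rule emeasure_PiM[OF M(1)]) simp
  then show "emeasure (coef_measure M) (\<Pi>\<^sub>E m\<in>M. {0}) = 0"
    using M by (simp add: card_gt_0_iff)
  show "(\<Pi>\<^sub>E m\<in>M. {0}) \<in> sets (coef_measure M)"
    by (rule sets_PiM_I_finite[OF M(1)]) simp
qed

lemma space_trig_lebesgue: "space (trig_lebesgue M) = trig_space M"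
  unfolding trig_lebesgue_def Let_def by (simp add: space_measure_of_conv)

lemma trig_comb_measurable_sigma:
  "trig_comb M \<in> coef_measure M \<rightarrow>\<^sub>M sigma (trig_space M) {E. E \<subseteq> trig_space M \<and> trig_comb M -` E \<inter> space (coef_measure M) \<in> sets (coef_measure M)}"
  by (rule measurable_measure_of) (auto simp: trig_space_def)

lemma trig_comb_measurable: "trig_comb M \<in> coef_measure M \<rightarrow>\<^sub>M trig_lebesgue M"
proof -
  have "sets (trig_lebesgue M) = sets (sigma (trig_space M) {E. E \<subseteq> trig_space M \<and> trig_comb M -` E \<inter> space (coef_measure M) \<in> sets (coef_measure M)})"
    unfolding trig_lebesgue_def Let_def by simp
  with trig_comb_measurable_sigma[of M] show ?thesis
    using measurable_cong_sets by blast
qed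

lemma sets_trig_lebesgue:
  "E \<in> sets (trig_lebesgue M) \<longleftrightarrow> E \<subseteq> trig_space M \<and> trig_comb M -` E \<inter> space (coef_measure M) \<in> sets (coef_measure M)"
proof
  assume E: "E \<in> sets (trig_lebesgue M)"
  show "E \<subseteq> trig_space M \<and> trig_comb M -` E \<inter> space (coef_measure M) \<in> sets (coef_measure M)"
    using sets.sets_into_space[OF E] measurable_sets[OF trig_comb_measurable E] by (simp add: space_trig_lebesgue)
next
  let ?E = "{E. E \<subseteq> trig_space M \<and> trig_comb M -` E \<inter> space (coef_measure M) \<in> sets (coef_measure M)}"
  assume "E \<subseteq> trig_space M \<and> trig_comb M -` E \<inter> space (coef_measure M) \<in> sets (coef_measure M)"
  then have "E \<in> ?E" by simp
  moreover have "?E \<subseteq> Pow (trig_space M)" by blast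
  ultimately have "E \<in> sets (sigma (trig_space M) ?E)"
    by (simp add: sets_measure_of sigma_sets.Basic)
  then show "E \<in> sets (trig_lebesgue M)"
    unfolding trig_lebesgue_def Let_def by simp
qed

lemma nn_integral_trig_lebesgue:
  assumes "f \<in> borel_measurable (trig_lebesgue M)"
  shows "(\<integral>\<^sup>+v. f v \<partial>trig_lebesgue M) = (\<integral>\<^sup>+c. f (trig_comb M c) \<partial>coef_measure M)"
proof -
  have "sets (trig_lebesgue M) = sets (sigma (trig_space M) {E. E \<subseteq> trig_space M \<and> trig_comb M -` E \<inter> space (coef_measure M) \<in> sets (coef_measure M)})"
    unfolding trig_lebesgue_def Let_def by simp
  from measurable_cong_sets[OF this refl] assms
  have f: "f \<in> borel_measurable (sigma (trig_space M) {E. E \<subseteq> trig_space M \<and> trig_comb M -` E \<inter> space (coef_measure M) \<in> sets (coef_measure M)})"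
    by blast
  show ?thesis
    unfolding trig_lebesgue_def Let_def
    by (rule nn_integral_distr[OF trig_comb_measurable_sigma]) (use f in \<open>simp\<close>)
qed

lemma measurable_trig_lebesgueI:
  fixes f :: "(real^'n::finite \<Rightarrow> real) \<Rightarrow> 'b::topological_space"
  assumes "(\<lambda>c. f (trig_comb M c)) \<in> borel_measurable (coef_measure M)"
  shows "f \<in> borel_measurable (trig_lebesgue M)"
proof (rule measurableI)
  fix A :: "'b set" assume A: "A \<in> sets borel"
  have "trig_comb M -` (f -` A \<inter> trig_space M) \<inter> space (coef_measure M)
      = (\<lambda>c. f (trig_comb M c)) -` A \<inter> space (coef_measure M)"
    by (auto simp: trig_space_def)
  then show "f -` A \<inter> space (trig_lebesgue M) \<in> sets (trig_lebesgue M)"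
    using measurable_sets[OF assms A] by (simp add: sets_trig_lebesgue space_trig_lebesgue)
qed simp

text \<open>
  For a function that is homogeneous of degree zero the radial projection in the definition of the
  area can be dropped, so the integral over the sphere is a multiple of the integral over the punctured ball.
\<close>

lemma nn_integral_sphere_area:
  fixes M :: "(int^'n::{finite,linorder}) set" and f :: "(real^'n::_ \<Rightarrow> real) \<Rightarrow> ennreal"
  assumes M: "finite M" "M \<subseteq> pos_cone"
    and f: "(\<lambda>c. f (trig_comb M c)) \<in> borel_measurable (coef_measure M)"
    and hom: "\<And>r c. r > 0 \<Longrightarrow> f (trig_comb M (\<lambda>m\<in>M. r *\<^sub>R c m)) = f (trig_comb M c)"
  shows "(\<integral>\<^sup>+v. f v \<partial>sphere_area M)
    = of_nat (2 * card M) * (\<integral>\<^sup>+c. indicator {c. 0 < sqnorm M c \<and> sqnorm M c \<le> 1} c * f (trig_comb M c) \<partial>coef_measure M)"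
proof -
  let ?T = "trig_lebesgue M" and ?R = "coef_measure M"
  let ?B = "{v \<in> trig_space M. 0 < l2_inner v v \<and> l2_inner v v \<le> 1}"
  let ?nrm = "\<lambda>v (\<theta>::real^'n::_). v \<theta> / sqrt (l2_inner v v)"
  note sq = l2_inner_eq_sqnorm[OF M]
  have nrm: "?nrm (trig_comb M c) = trig_comb M (\<lambda>m\<in>M. (1 / sqrt (sqnorm M c)) *\<^sub>R c m)" for c
    by (simp add: fun_eq_iff trig_comb_scaleR sq)
  have nrm': "(\<lambda>\<theta>. trig_comb M c \<theta> / sqrt (sqnorm M c)) = trig_comb M (\<lambda>m\<in>M. (1 / sqrt (sqnorm M c)) *\<^sub>R c m)" for c
    using nrm[of c] unfolding sq .
  have B: "?B \<in> sets ?T"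
  proof -
    have "trig_comb M -` ?B \<inter> space ?R = {c \<in> space ?R. 0 < sqnorm M c \<and> sqnorm M c \<le> 1}"
      by (auto simp: sq trig_space_def)
    also have "\<dots> \<in> sets ?R" by measurable
    finally show ?thesis unfolding sets_trig_lebesgue by blast
  qed
  have BT: "?B \<inter> space ?T = ?B" by (auto simp: space_trig_lebesgue)
  have sp: "space (restrict_space ?T ?B) = ?B"
    unfolding space_restrict_space BT ..
  have norm_meas: "(\<lambda>c. \<lambda>m\<in>M. (1 / sqrt (sqnorm M c)) *\<^sub>R c m) \<in> ?R \<rightarrow>\<^sub>M ?R"
  proof (rule measurable_restrict)
    fix m assume "m \<in> M"
    note [measurable] = borel_measurable_PiM_component[OF this, where ?'a="real \<times> real"]
    have "(\<lambda>c. (1 / sqrt (sqnorm M c)) *\<^sub>R c m) \<in> borel_measurable ?R" by measurable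
    then show "(\<lambda>c. (1 / sqrt (sqnorm M c)) *\<^sub>R c m) \<in> ?R \<rightarrow>\<^sub>M lborel" by simp
  qed
  have nrm_sphere: "?nrm v \<in> trig_sphere M" if v: "v \<in> ?B" for v
  proof -
    obtain c where c: "v = trig_comb M c" using v by (auto simp: trig_space_def)
    have pos: "0 < sqnorm M c" using v by (simp add: c sq)
    have "?nrm v \<in> trig_space M" unfolding c nrm by (simp add: trig_space_def)
    moreover have "l2_inner (?nrm v) (?nrm v) = 1"
      unfolding c sq nrm' sqnorm_scaleR using pos by (simp add: power_divide)
    ultimately show ?thesis by (simp add: trig_sphere_def)
  qed
  have nrm_meas: "?nrm \<in> restrict_space ?T ?B \<rightarrow>\<^sub>M restrict_space ?T (trig_sphere M)"
  proof (rule measurable_restrict_space2)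
    show "?nrm \<in> space (restrict_space ?T ?B) \<rightarrow> trig_sphere M"
      using nrm_sphere by (auto simp: space_restrict_space)
    show "?nrm \<in> restrict_space ?T ?B \<rightarrow>\<^sub>M ?T"
    proof (rule measurableI)
      fix v assume "v \<in> space (restrict_space ?T ?B)"
      then show "?nrm v \<in> space ?T"
        using nrm_sphere by (auto simp: space_restrict_space space_trig_lebesgue trig_sphere_def)
    next
      fix E assume E: "E \<in> sets ?T"
      have "trig_comb M -` (?nrm -` E \<inter> ?B) \<inter> space ?R
        = {c \<in> space ?R. 0 < sqnorm M c \<and> sqnorm M c \<le> 1}
          \<inter> ((\<lambda>c. trig_comb M (\<lambda>m\<in>M. (1 / sqrt (sqnorm M c)) *\<^sub>R c m)) -` E \<inter> space ?R)"
        by (auto simp: sq nrm' trig_space_def)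
      also have "\<dots> \<in> sets ?R"
      proof (rule sets.Int)
        show "{c \<in> space ?R. 0 < sqnorm M c \<and> sqnorm M c \<le> 1} \<in> sets ?R" by measurable
        show "(\<lambda>c. trig_comb M (\<lambda>m\<in>M. (1 / sqrt (sqnorm M c)) *\<^sub>R c m)) -` E \<inter> space ?R \<in> sets ?R"
          by (rule measurable_sets[OF measurable_compose[OF norm_meas trig_comb_measurable] E])
      qed
      finally have "?nrm -` E \<inter> ?B \<in> sets ?T" unfolding sets_trig_lebesgue by blast
      then show "?nrm -` E \<inter> space (restrict_space ?T ?B) \<in> sets (restrict_space ?T ?B)"
        unfolding sp using sets_restrict_space_iff[of ?B ?T] B unfolding BT by blast
    qed
  qed
  have fT: "f \<in> borel_measurable ?T" by (rule measurable_trig_lebesgueI[OF f])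
  have fS: "f \<in> borel_measurable (restrict_space ?T (trig_sphere M))"
    by (rule measurable_restrict_space1[OF fT])
  have "(\<integral>\<^sup>+v. f v \<partial>sphere_area M) = of_nat (2 * card M) * (\<integral>\<^sup>+v. f (?nrm v) \<partial>restrict_space ?T ?B)"
    unfolding sphere_area_def using fS
    by (simp add: nn_integral_scale_measure nn_integral_distr[OF nrm_meas])
  also have "(\<integral>\<^sup>+v. f (?nrm v) \<partial>restrict_space ?T ?B) = (\<integral>\<^sup>+v. f v \<partial>restrict_space ?T ?B)"
  proof (rule nn_integral_cong)
    fix v assume "v \<in> space (restrict_space ?T ?B)"
    then have v: "v \<in> ?B" by (auto simp: space_restrict_space)
    then obtain c where c: "v = trig_comb M c" by (auto simp: trig_space_def)
    have pos: "0 < sqnorm M c" using v by (simp add: c sq)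
    show "f (?nrm v) = f v"
      unfolding c nrm by (rule hom) (use pos in simp)
  qed
  also have "\<dots> = (\<integral>\<^sup>+v. f v * indicator ?B v \<partial>?T)"
    by (rule nn_integral_restrict_space) (unfold BT, rule B)
  also have "\<dots> = (\<integral>\<^sup>+c. f (trig_comb M c) * indicator ?B (trig_comb M c) \<partial>?R)"
    by (rule nn_integral_trig_lebesgue) (use fT B in measurable)
  also have "\<dots> = (\<integral>\<^sup>+c. indicator {c. 0 < sqnorm M c \<and> sqnorm M c \<le> 1} c * f (trig_comb M c) \<partial>?R)"
    by (rule nn_integral_cong) (auto simp: indicator_def sq trig_space_def)
  finally show ?thesis .
qed

text \<open>
  Both the integral over the sphere and the Gaussian integral of a function of degree zero are fixed
  multiples of its integral over the unit ball.  The multiples cancel in comparison with the constant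
  function \<open>1\<close>, whose Gaussian integral is \<open>(2 * pi) ^ card M\<close>.
\<close>

theorem mean_critical_gaussian:
  fixes M :: "(int^'n::{finite,linorder}) set"
  assumes M: "finite M" "M \<subseteq> pos_cone" "M \<noteq> {}"
    and Z: "(\<integral>\<^sup>+c. ennreal (exp (- sqnorm M c / 2)) * num_critical (trig_comb M c) \<partial>coef_measure M) = ennreal z" "0 \<le> z"
  shows "mean_critical M = ennreal (z / (2 * pi) ^ card M)"
proof -
  let ?R = "coef_measure M"
  define K where "K = (\<integral>\<^sup>+s. ennreal (s ^ (2 * card M + 1) * exp (- s\<^sup>2 / 2)) * indicator {0<..} s \<partial>lborel)"
  have ball: "(\<integral>\<^sup>+v. f v \<partial>sphere_area M) = of_nat (2 * card M) * (\<integral>\<^sup>+c. indicator {c. sqnorm M c \<le> 1} c * f (trig_comb M c) \<partial>?R)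
     \<and> (\<integral>\<^sup>+c. ennreal (exp (- sqnorm M c / 2)) * f (trig_comb M c) \<partial>?R)
       = K * (\<integral>\<^sup>+c. indicator {c. sqnorm M c \<le> 1} c * f (trig_comb M c) \<partial>?R)"
    if f: "(\<lambda>c. f (trig_comb M c)) \<in> borel_measurable ?R"
      and hom: "\<And>r c. r > 0 \<Longrightarrow> f (trig_comb M (\<lambda>m\<in>M. r *\<^sub>R c m)) = f (trig_comb M c)"
    for f :: "(real^'n::_ \<Rightarrow> real) \<Rightarrow> ennreal"
  proof
    have "(\<integral>\<^sup>+c. indicator {c. 0 < sqnorm M c \<and> sqnorm M c \<le> 1} c * f (trig_comb M c) \<partial>?R)
        = (\<integral>\<^sup>+c. indicator {c. sqnorm M c \<le> 1} c * f (trig_comb M c) \<partial>?R)"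
    proof (rule nn_integral_cong_AE)
      show "AE c in ?R. indicator {c. 0 < sqnorm M c \<and> sqnorm M c \<le> 1} c * f (trig_comb M c)
          = indicator {c. sqnorm M c \<le> 1} c * f (trig_comb M c)"
        using AE_sqnorm_pos[OF M(1,3)] by eventually_elim (simp add: indicator_def)
    qed
    with nn_integral_sphere_area[where f=f, OF M(1,2) f hom]
    show "(\<integral>\<^sup>+v. f v \<partial>sphere_area M) = of_nat (2 * card M) * (\<integral>\<^sup>+c. indicator {c. sqnorm M c \<le> 1} c * f (trig_comb M c) \<partial>?R)"
      by (simp only:)
    show "(\<integral>\<^sup>+c. ennreal (exp (- sqnorm M c / 2)) * f (trig_comb M c) \<partial>?R)
       = K * (\<integral>\<^sup>+c. indicator {c. sqnorm M c \<le> 1} c * f (trig_comb M c) \<partial>?R)"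
      unfolding K_def by (rule gaussian_integral_layers[OF M(1) f hom])
  qed
  define X where "X = (\<integral>\<^sup>+c. indicator {c. sqnorm M c \<le> 1} c * num_critical (trig_comb M c) \<partial>?R)"
  define Y where "Y = (\<integral>\<^sup>+c. indicator {c. sqnorm M c \<le> 1} c * (1::ennreal) \<partial>?R)"
  have 1: "(\<integral>\<^sup>+v. num_critical v \<partial>sphere_area M) = of_nat (2 * card M) * X" "ennreal z = K * X"
    using ball[of num_critical, OF borel_measurable_num_critical num_critical_scaleR] Z(1)
    unfolding X_def by auto
  have 2: "(\<integral>\<^sup>+v. 1 \<partial>sphere_area M) = of_nat (2 * card M) * Y" "ennreal ((2 * pi) ^ card M) = K * Y"
    using ball[of "\<lambda>_. 1"] gaussian_total[OF M(1)] unfolding Y_def by auto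
  have "space (sphere_area M) = trig_sphere M"
    unfolding sphere_area_def
    by (auto simp: space_restrict_space space_trig_lebesgue trig_sphere_def space_scale_measure)
  then have area: "emeasure (sphere_area M) (trig_sphere M) = of_nat (2 * card M) * Y"
    using 2(1) by simp
  have card: "card M > 0" using M(1,3) by (simp add: card_gt_0_iff)
  have KY: "K * Y \<noteq> 0" "K * Y \<noteq> top" using 2(2)[symmetric] by auto
  then have K0: "K \<noteq> 0" "Y \<noteq> 0" by auto
  have "K \<noteq> top" "Y \<noteq> top" using KY K0 by (auto simp: ennreal_top_mult ennreal_mult_top)
  obtain k where k: "K = ennreal k" "0 \<le> k"
    using \<open>K \<noteq> top\<close> by (cases K rule: ennreal_cases) auto
  obtain y where y: "Y = ennreal y" "0 \<le> y"
    using \<open>Y \<noteq> top\<close> by (cases Y rule: ennreal_cases) auto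
  have "X \<noteq> top"
  proof
    assume "X = top"
    with K0(1) have "K * X = top" by (simp add: ennreal_mult_top)
    with 1(2) show False by simp
  qed
  then obtain x where x: "X = ennreal x" "0 \<le> x" by (cases X rule: ennreal_cases) auto
  have pos: "k > 0" "y > 0" using K0 k y by (auto simp: order_less_le)
  have kx: "z = k * x" using 1(2) Z(2) k x by (simp add: ennreal_mult[symmetric])
  have ky: "(2 * pi) ^ card M = k * y" using 2(2) k y by (simp add: ennreal_mult[symmetric])
  have n: "of_nat (2 * card M) = ennreal (real (2 * card M))" by (simp add: ennreal_of_nat_eq_real_of_nat)
  have "mean_critical M = (of_nat (2 * card M) * X) / (of_nat (2 * card M) * Y)"
    unfolding mean_critical_def 1(1) area ..
  also have "\<dots> = ennreal (real (2 * card M) * x) / ennreal (real (2 * card M) * y)"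
    unfolding n x(1) y(1) using x y by (simp add: ennreal_mult)
  also have "\<dots> = ennreal ((real (2 * card M) * x) / (real (2 * card M) * y))"
    using card x pos by (intro divide_ennreal) auto
  also have "(real (2 * card M) * x) / (real (2 * card M) * y) = z / (2 * pi) ^ card M"
    unfolding kx ky using card pos by simp
  finally show ?thesis .
qed

section \<open>The Gram matrix of the modes and ampleness\<close>

definition mode_gram :: "(int^'n::finite) set \<Rightarrow> real^'n^'n" where
  "mode_gram M = (\<Sum>m\<in>M. outer (rvec m))"

lemma mode_gram_nth: "mode_gram M $ j $ k = (\<Sum>m\<in>M. of_int (m $ j * m $ k))"
  by (simp add: mode_gram_def outer_def rvec_def)

lemma mode_gram_mult: "mode_gram M *v x = (\<Sum>m\<in>M. (rvec m \<bullet> x) *\<^sub>R rvec m)"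
  unfolding mode_gram_def
  by (induction M rule: infinite_finite_induct) (simp_all add: matrix_vector_mult_add_rdistrib outer_mult_vec)

lemma mode_gram_quadratic: "x \<bullet> (mode_gram M *v x) = (\<Sum>m\<in>M. (rvec m \<bullet> x)\<^sup>2)"
  by (simp add: mode_gram_mult inner_sum_right power2_eq_square inner_commute)

lemma a_coef_eq: "a_coef M j k = (amp M)\<^sup>2 * mode_gram M $ j $ k"
  by (simp add: a_coef_def amp_square mode_gram_nth)

text \<open>
  Spanning of \<open>\<real>\<^sup>L\<close> by the modes, in dual form.
\<close>

definition spanning :: "(int^'n::finite) set \<Rightarrow> bool" where
  "spanning M \<longleftrightarrow> (\<forall>x. (\<forall>m\<in>M. rvec m \<bullet> x = 0) \<longrightarrow> x = 0)"

text \<open>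
  Permuting coordinates maps \<open>M\<close> to itself up to signs, and \<open>m\<^sub>j m\<^sub>k\<close> is insensitive to the sign of
  \<open>m\<close>.
\<close>

lemma a_coef_permute:
  fixes M :: "(int^'n::{finite,linorder}) set"
  assumes M: "finite M" "M \<subseteq> pos_cone" "symmetric_set M" and \<phi>: "bij \<phi>"
  shows "a_coef M (\<phi> j) (\<phi> k) = a_coef M j k"
proof -
  define p :: "int^'n::_ \<Rightarrow> int^'n::_" where "p m = (\<chi> j. m $ \<phi> j)" for m
  (* \<sigma> is the permutation of M induced by p up to sign. *)
  define \<sigma> where "\<sigma> m = (if p m \<in> M then p m else - p m)" for m
  have p_inj: "m = n" if "p m = p n" for m n
  proof (rule vec_eq_iff[THEN iffD2], rule allI)
    fix i
    obtain l where "i = \<phi> l" using \<phi> by (metis bij_def surj_def)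
    moreover have "p m $ l = p n $ l" using that by simp
    ultimately show "m $ i = n $ i" by (simp add: p_def)
  qed
  have p_neg: "p (- m) = - p m" for m by (simp add: p_def vec_eq_iff)
  have maps: "\<sigma> m \<in> M" if m: "m \<in> M" for m
  proof -
    have "m \<in> pos_cone" using m M(2) by blast
    then have "p m \<in> M \<union> uminus ` M"
      using M(3) m \<phi> unfolding symmetric_set_def p_def by blast
    then show ?thesis by (auto simp: \<sigma>_def)
  qed
  have inj: "inj_on \<sigma> M"
  proof (rule inj_onI)
    fix m n assume mn: "m \<in> M" "n \<in> M" "\<sigma> m = \<sigma> n"
    have "p m = p n \<or> p m = - p n"
      using mn(3) unfolding \<sigma>_def by (metis minus_minus)
    moreover have "p m \<noteq> - p n"
    proof
      assume "p m = - p n"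
      then have "m = - n" using p_inj[of m "- n"] by (simp add: p_neg)
      then have "m + n = 0" by simp
      moreover have "m + n \<noteq> 0" by (rule pos_cone_not_neg) (use mn M(2) in blast)+
      ultimately show False by blast
    qed
    ultimately show "m = n" using p_inj by blast
  qed
  have "\<sigma> ` M = M"
    by (rule endo_inj_surj[OF M(1) _ inj]) (use maps in blast)
  then have "(\<Sum>m\<in>M. (of_int (m $ j * m $ k) :: real)) = (\<Sum>m\<in>\<sigma> ` M. of_int (m $ j * m $ k))"
    by simp
  also have "\<dots> = (\<Sum>m\<in>M. of_int (\<sigma> m $ j * \<sigma> m $ k))"
    using inj by (simp add: sum.reindex)
  also have "\<dots> = (\<Sum>m\<in>M. of_int (m $ \<phi> j * m $ \<phi> k))"
    by (rule sum.cong) (simp_all add: \<sigma>_def p_def)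
  finally show ?thesis unfolding a_coef_def by simp
qed

text \<open>
  Any two diagonal positions, and any two off-diagonal positions, are related by a permutation of
  the coordinates.
\<close>

lemma a_coef_values:
  fixes M :: "(int^'n::{finite,linorder}) set"
  assumes M: "finite M" "M \<subseteq> pos_cone" "symmetric_set M"
  shows "a_coef M j k = (if j = k then a_val M else b_val M)"
proof (cases "j = k")
  case True
  have eq: "a_coef M i i = a_coef M j j" for i
    using a_coef_permute[OF M bij_transpose[of j i], of j j] by simp
  have "a_val M = a_coef M j j"
    unfolding a_val_def
  proof (rule the_equality)
    show "\<forall>i. a_coef M i i = a_coef M j j" by (intro allI eq)
    show "c = a_coef M j j" if "\<forall>i. a_coef M i i = c" for c
      using that by metis
  qed
  then show ?thesis using True by simp
next
  case False
  have eq: "a_coef M i l = a_coef M j k" if il: "i \<noteq> l" for i l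
  proof -
    define k' where "k' = Transposition.transpose j i k"
    have k': "k' \<noteq> i" using False unfolding k'_def by (metis transpose_apply_first transpose_involutory)
    let ?\<phi> = "Transposition.transpose k' l \<circ> Transposition.transpose j i"
    have "bij ?\<phi>" by (intro bij_comp bij_transpose)
    moreover have "?\<phi> j = i" using k' il by simp
    moreover have "?\<phi> k = l" by (simp add: k'_def[symmetric])
    ultimately show ?thesis using a_coef_permute[OF M, of ?\<phi> j k] by simp
  qed
  have "CARD('n) \<noteq> 1"
    using False by (metis UNIV_I card_1_singletonE singletonD)
  then have "b_val M = (THE c. \<forall>j k. j \<noteq> k \<longrightarrow> a_coef M j k = c)"
    by (simp add: b_val_def)
  also have "\<dots> = a_coef M j k"
  proof (rule the_equality)
    show "\<forall>i l. i \<noteq> l \<longrightarrow> a_coef M i l = a_coef M j k" using eq by (intro allI impI)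
    show "c = a_coef M j k" if "\<forall>j k. j \<noteq> k \<longrightarrow> a_coef M j k = c" for c
      using that False by metis
  qed
  finally show ?thesis using False by simp
qed

text \<open>
  The rescaled Gram matrix is \<open>(a - b)\<close> times the identity plus \<open>b\<close> times the matrix with all entries \<open>1\<close>.
\<close>

lemma mode_gram_symmetric_mult:
  fixes M :: "(int^'n::{finite,linorder}) set"
  assumes M: "finite M" "M \<subseteq> pos_cone" "symmetric_set M"
  defines "a \<equiv> a_val M" and "b \<equiv> b_val M"
  shows "((amp M)\<^sup>2 *\<^sub>R mode_gram M) *v x = (a - b) *\<^sub>R x + (b * (\<Sum>i\<in>UNIV. x $ i)) *\<^sub>R 1"
proof (rule vec_eq_iff[THEN iffD2], rule allI)
  fix j
  have "(((amp M)\<^sup>2 *\<^sub>R mode_gram M) *v x) $ j = (\<Sum>k\<in>UNIV. a_coef M j k * x $ k)"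
    by (simp add: matrix_vector_mult_def a_coef_eq)
  also have "\<dots> = (\<Sum>k\<in>UNIV. (if k = j then (a - b) * x $ k else 0) + b * x $ k)"
    by (rule sum.cong) (auto simp: a_coef_values[OF M] a_def b_def algebra_simps)
  also have "\<dots> = (a - b) * x $ j + b * (\<Sum>i\<in>UNIV. x $ i)"
    by (simp add: sum.distrib sum_distrib_left)
  finally show "(((amp M)\<^sup>2 *\<^sub>R mode_gram M) *v x) $ j = ((a - b) *\<^sub>R x + (b * (\<Sum>i\<in>UNIV. x $ i)) *\<^sub>R 1) $ j"
    by simp
qed

lemma mode_gram_symmetric_quadratic:
  fixes M :: "(int^'n::{finite,linorder}) set"
  assumes M: "finite M" "M \<subseteq> pos_cone" "symmetric_set M"
  shows "(amp M)\<^sup>2 * (\<Sum>m\<in>M. (rvec m \<bullet> x)\<^sup>2) = (a_val M - b_val M) * (x \<bullet> x) + b_val M * (\<Sum>i\<in>UNIV. x $ i)\<^sup>2"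
proof -
  have "x \<bullet> (1 :: real^'n::_) = (\<Sum>i\<in>UNIV. x $ i)" by (simp add: inner_vec_def)
  then have "x \<bullet> (((amp M)\<^sup>2 *\<^sub>R mode_gram M) *v x) = (a_val M - b_val M) * (x \<bullet> x) + b_val M * (\<Sum>i\<in>UNIV. x $ i)\<^sup>2"
    unfolding mode_gram_symmetric_mult[OF M] by (simp add: inner_add_right power2_eq_square)
  then show ?thesis
    by (simp add: scaleR_matrix_vector_assoc[symmetric] mode_gram_quadratic)
qed

text \<open>
  The modes span if and only if the Gram matrix is positive definite, and its eigenvalues are
  \<open>a - b\<close> and \<open>a + (L - 1) b\<close>.  In dimension one there is no vector with sum zero, but there \<open>b = 0\<close>
  by convention and the two numbers agree.
\<close>

lemma spanning_iff:
  fixes M :: "(int^'n::{finite,linorder}) set"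
  assumes M: "finite M" "M \<subseteq> pos_cone" "symmetric_set M"
  defines "a \<equiv> a_val M" and "b \<equiv> b_val M"
  shows "spanning M \<longleftrightarrow> a \<noteq> b \<and> a + (real CARD('n) - 1) * b \<noteq> 0"
    and "spanning M \<Longrightarrow> a - b > 0" and "spanning M \<Longrightarrow> a + (real CARD('n) - 1) * b > 0"
proof -
  note quad = mode_gram_symmetric_quadratic[OF M, folded a_def b_def]
  have posq: "0 < (amp M)\<^sup>2 * (\<Sum>m\<in>M. (rvec m \<bullet> x)\<^sup>2)" if sp: "spanning M" and nz: "x \<noteq> 0" for x
  proof -
    obtain m where m: "m \<in> M" "rvec m \<bullet> x \<noteq> 0" using sp nz unfolding spanning_def by blast
    have "0 < (\<Sum>m\<in>M. (rvec m \<bullet> x)\<^sup>2)"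
      by (rule sum_pos2[OF M(1) m(1)]) (use m in auto)
    then show ?thesis using amp_pos[of M] by simp
  qed
  show s2: "a + (real CARD('n) - 1) * b > 0" if "spanning M"
  proof -
    have "0 < (a - b) * real CARD('n) + b * (real CARD('n))\<^sup>2"
      (* The vector with all coordinates 1 is an eigenvector for the eigenvalue a + (L - 1) b. *)
      using posq[OF that, of 1] unfolding quad by (simp add: inner_vec_def)
    also have "\<dots> = real CARD('n) * (a + (real CARD('n) - 1) * b)"
      by (simp add: power2_eq_square algebra_simps)
    finally show ?thesis by (simp add: zero_less_mult_iff)
  qed
  show s1: "a - b > 0" if sp: "spanning M"
  proof (cases "CARD('n) = 1")
    case True
    then have "b = 0" by (simp add: b_def b_val_def)
    with s2[OF sp] True show ?thesis by simp
  next
    case False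
    have "\<exists>i j :: 'n. i \<noteq> j"
    proof (rule ccontr)
      assume "\<not> (\<exists>i j :: 'n. i \<noteq> j)"
      then have "(UNIV :: 'n set) = {undefined}" by blast
      then have "CARD('n) = card {undefined :: 'n}" by (rule arg_cong)
      with False show False by simp
    qed
    then obtain i j :: 'n where ij: "i \<noteq> j" by blast
    (* A vector with coordinate sum zero, hence an eigenvector for the eigenvalue a - b. *)
    let ?x = "axis i 1 - axis j 1 :: real^'n::_"
    have "?x \<noteq> 0" using ij by (auto simp: axis_eq_axis)
    moreover have "(\<Sum>l\<in>UNIV. ?x $ l) = 0"
    proof -
      have "(\<Sum>l\<in>UNIV. (axis k 1 :: real^'n::_) $ l) = 1" for k by (simp add: axis_def)
      then show ?thesis by (simp only: vector_minus_component sum_subtractf)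
    qed
    moreover have "?x \<bullet> ?x = 2" using ij by (simp add: inner_diff_left inner_diff_right inner_axis_axis)
    ultimately show ?thesis using posq[OF sp, of ?x] unfolding quad by simp
  qed
  show "spanning M \<longleftrightarrow> a \<noteq> b \<and> a + (real CARD('n) - 1) * b \<noteq> 0"
  proof
    assume "spanning M"
    then show "a \<noteq> b \<and> a + (real CARD('n) - 1) * b \<noteq> 0" using s1 s2 by force
  next
    assume ab: "a \<noteq> b \<and> a + (real CARD('n) - 1) * b \<noteq> 0"
    show "spanning M"
      unfolding spanning_def
    proof (intro allI impI)
      fix x :: "real^'n::_" assume x: "\<forall>m\<in>M. rvec m \<bullet> x = 0"
      then have "mode_gram M *v x = 0" by (simp add: mode_gram_mult)
      then have z: "(a - b) *\<^sub>R x + (b * (\<Sum>i\<in>UNIV. x $ i)) *\<^sub>R 1 = 0"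
        using mode_gram_symmetric_mult[OF M, of x, folded a_def b_def]
        by (simp add: scaleR_matrix_vector_assoc[symmetric])
      let ?s = "\<Sum>i\<in>UNIV. x $ i"
      have zj: "(a - b) * x $ j + b * ?s = 0" for j
        using arg_cong[OF z, of "\<lambda>v. v $ j"] by simp
      (* Summing the coordinates of the equation shows that the coordinate sum of x vanishes. *)
      have "0 = (\<Sum>j\<in>UNIV. (a - b) * x $ j + b * ?s)" by (simp add: zj)
      also have "\<dots> = (a + (real CARD('n) - 1) * b) * ?s"
      proof -
        have "(\<Sum>j\<in>UNIV. (a - b) * x $ j + b * ?s) = (a - b) * ?s + real CARD('n) * (b * ?s)"
          by (simp only: sum.distrib sum_distrib_left[symmetric] sum_constant) (simp add: mult.left_commute)
        then show ?thesis by (simp add: algebra_simps)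
      qed
      finally have "?s = 0" using ab by simp
      then have "x $ j = 0" for j using zj[of j] ab by simp
      then show "x = 0" by (simp add: vec_eq_iff)
    qed
  qed
qed

text \<open>
  The product of the eigenvalues, computed as the determinant of a rank one update of a multiple of the
  identity.
\<close>

lemma det_mode_gram:
  fixes M :: "(int^'n::{finite,linorder}) set"
  assumes M: "finite M" "M \<subseteq> pos_cone" "symmetric_set M" and sp: "spanning M"
  defines "a \<equiv> a_val M" and "b \<equiv> b_val M"
  shows "(amp M) ^ (2 * CARD('n)) * det (mode_gram M) = (a - b) ^ (CARD('n) - 1) * (a + (real CARD('n) - 1) * b)"
proof -
  let ?L = "CARD('n)"
  have ab: "a - b > 0" unfolding a_def b_def by (rule spanning_iff(2)[OF M sp])
  (* B is the rescaled Gram matrix divided by a - b. *)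
  define B :: "real^'n::_^'n::_" where "B = mat 1 + (\<chi> i j. ((b / (a - b)) *\<^sub>R (1::real^'n::_)) $ i * (1::real^'n::_) $ j)"
  have "(amp M)\<^sup>2 *\<^sub>R mode_gram M = (a - b) *\<^sub>R B"
  proof (rule matrix_eq[THEN iffD2], rule allI)
    fix x :: "real^'n::_"
    have "(1::real^'n::_) \<bullet> x = (\<Sum>i\<in>UNIV. x $ i)" by (simp add: inner_vec_def)
    then have "B *v x = x + (\<Sum>i\<in>UNIV. x $ i) *\<^sub>R ((b / (a - b)) *\<^sub>R 1)"
      unfolding B_def matrix_vector_mult_add_rdistrib rank_one_mult_vec matrix_vector_mul_lid by simp
    then have "((a - b) *\<^sub>R B) *v x = (a - b) *\<^sub>R x + (b * (\<Sum>i\<in>UNIV. x $ i)) *\<^sub>R 1"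
      using ab by (simp add: scaleR_matrix_vector_assoc[symmetric] scaleR_add_right mult.commute)
    then show "((amp M)\<^sup>2 *\<^sub>R mode_gram M) *v x = ((a - b) *\<^sub>R B) *v x"
      unfolding mode_gram_symmetric_mult[OF M] a_def b_def by simp
  qed
  from arg_cong[OF this, of det]
  have "(amp M) ^ (2 * ?L) * det (mode_gram M) = (a - b) ^ ?L * det B"
    unfolding det_scaleR by (simp add: power_mult)
  also have "det B = 1 + (b / (a - b)) * real ?L"
    unfolding B_def det_rank_one_update by (simp add: inner_vec_def)
  also have "(a - b) ^ ?L * (1 + (b / (a - b)) * real ?L) = (a - b) ^ (?L - 1) * (a + (real ?L - 1) * b)"
  proof -
    have "(a - b) ^ ?L = (a - b) ^ (?L - 1) * (a - b)"
      by (metis One_nat_def Suc_pred mult.commute power_Suc zero_less_card_finite)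
    moreover have "(a - b) * (1 + (b / (a - b)) * real ?L) = a + (real ?L - 1) * b"
      using ab by (simp add: field_simps)
    ultimately show ?thesis by (simp add: mult.assoc)
  qed
  finally show ?thesis .
qed

text \<open>
  The differential at \<open>x\<close> has the form \<open>\<Sum> \<beta>\<^sub>m m\<close> with arbitrary rotated sine coefficients \<open>\<beta>\<^sub>m\<close>, so
  its range is the span of the modes.  To reach a given covector \<open>\<eta>\<close> one takes \<open>\<beta>\<^sub>m = m \<bullet> \<zeta>\<close>
  where \<open>\<zeta>\<close> solves a linear system with the Gram matrix.
\<close>

lemma ample_iff_spanning:
  fixes M :: "(int^'n::finite) set"
  assumes M: "finite M"
  shows "ample (trig_space M) \<longleftrightarrow> spanning M"
proof
  assume am: "ample (trig_space M)"
  show "spanning M"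
    unfolding spanning_def
  proof (intro allI impI)
    fix x :: "real^'n" assume x: "\<forall>m\<in>M. rvec m \<bullet> x = 0"
    have "(0 :: real^'n) \<in> torus" by (simp add: torus_def)
    moreover have "linear (\<lambda>h. x \<bullet> h)" by (simp add: linear_iff inner_add_right)
    ultimately obtain v where v: "v \<in> trig_space M" "(v has_derivative (\<lambda>h. x \<bullet> h)) (at 0)"
      using am unfolding ample_def by blast
    then obtain c where c: "v = trig_comb M c" by (auto simp: trig_space_def)
    have "(\<lambda>h. x \<bullet> h) = (\<lambda>h. amp M * (crit_field M c 0 \<bullet> h))"
      using has_derivative_unique[OF v(2)[unfolded c] trig_comb_has_derivative] .
    then have "x \<bullet> x = amp M * (crit_field M c 0 \<bullet> x)" by metis
    also have "crit_field M c 0 \<bullet> x = 0"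
      unfolding crit_field_def inner_sum_left inner_scaleR_left using x by simp
    finally show "x = 0" by simp
  qed
next
  assume sp: "spanning M"
  have "\<exists>B. B ** mode_gram M = mat 1"
    unfolding matrix_left_invertible_ker
  proof (intro allI impI)
    fix x assume "mode_gram M *v x = 0"
    then have "(\<Sum>m\<in>M. (rvec m \<bullet> x)\<^sup>2) = 0" using mode_gram_quadratic[of x M] by simp
    then have "\<forall>m\<in>M. rvec m \<bullet> x = 0" using M by (simp add: sum_nonneg_eq_0_iff)
    then show "x = 0" using sp by (simp add: spanning_def)
  qed
  then have inv: "invertible (mode_gram M)" by (simp add: invertible_left_inverse)
  show "ample (trig_space M)"
    unfolding ample_def
  proof (intro ballI allI impI)
    fix x :: "real^'n" and \<xi> :: "real^'n \<Rightarrow> real" assume lin: "linear \<xi>"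
    define \<eta> where "\<eta> = (\<chi> i. \<xi> (axis i 1))"
    have \<xi>: "\<xi> h = \<eta> \<bullet> h" for h
    proof -
      have "\<xi> h = \<xi> (\<Sum>i\<in>UNIV. (h $ i) *\<^sub>R axis i 1)"
        using basis_expansion[of h] by (simp add: scalar_mult_eq_scaleR)
      also have "\<dots> = (\<Sum>i\<in>UNIV. h $ i * \<xi> (axis i 1))"
        by (simp add: linear_sum[OF lin] linear_scale[OF lin])
      finally show ?thesis by (simp add: \<eta>_def inner_vec_def mult.commute)
    qed
    define \<zeta> where "\<zeta> = matrix_inv (mode_gram M) *v ((1 / amp M) *\<^sub>R \<eta>)"
    have \<zeta>: "mode_gram M *v \<zeta> = (1 / amp M) *\<^sub>R \<eta>"
      unfolding \<zeta>_def by (simp only: matrix_vector_mul_assoc matrix_inv_works(1)[OF inv] matrix_vector_mul_lid)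
    (* Rotating back the pair with cosine part 0 and sine part m \<bullet> \<zeta>. *)
    define c where "c m = rot2 (- (rvec m \<bullet> x)) (0, rvec m \<bullet> \<zeta>)" for m
    have "crit_field M c x = mode_gram M *v \<zeta>"
      unfolding crit_field_def c_def rot2_minus mode_gram_mult by simp
    then have "(\<lambda>h. amp M * (crit_field M c x \<bullet> h)) = \<xi>"
      using amp_pos[of M] by (simp add: \<zeta> \<xi> fun_eq_iff)
    then have "(trig_comb M c has_derivative \<xi>) (at x)"
      using trig_comb_has_derivative[of M c x] by simp
    then show "\<exists>v\<in>trig_space M. (v has_derivative \<xi>) (at x)"
      by (auto simp: trig_space_def)
  qed
qed

section \<open>The Hessian as a Gaussian symmetric matrix\<close>

lemma upper_le: "ufst p \<le> usnd (p :: 'n::linorder upper)"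
  using pair_of[of p] by (simp add: ufst_def usnd_def)

lemma upper_Upper: "i \<le> j \<Longrightarrow> ufst (Upper (i, j)) = i" "i \<le> j \<Longrightarrow> usnd (Upper (i, j)) = j"
  by (simp_all add: ufst_def usnd_def Upper_inverse)

lemma upper_eqI: "ufst p = ufst q \<Longrightarrow> usnd p = usnd q \<Longrightarrow> p = q"
  by (metis pair_of_inject prod_eqI ufst_def usnd_def)

text \<open>
  Each entry of a symmetric matrix is met by exactly one \<open>H_mat\<close>, the one at the sorted pair of indices.
\<close>

lemma sym_mat_nth: "sym_mat x $ i $ j = x $ Upper (min i j, max i j)"
proof -
  let ?p = "Upper (min i j, max i j)"
  have le: "min i j \<le> max i j" by (rule order_trans[OF min.cobounded1 max.cobounded1])
  note p = upper_Upper[OF le]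
  have H: "H_mat (ufst q) (usnd q) $ i $ j = (if q = ?p then 1 else 0 :: real)" for q
  proof (cases "q = ?p")
    case True
    have "i = min i j \<and> j = max i j \<or> i = max i j \<and> j = min i j"
      by (simp add: min_def max_def)
    then show ?thesis using True p by (simp add: H_mat_def)
  next
    case False
    have "\<not> (i = ufst q \<and> j = usnd q)"
    proof
      assume ij: "i = ufst q \<and> j = usnd q"
      then have "i \<le> j" using upper_le[of q] by simp
      then have "q = ?p" using ij p by (intro upper_eqI) simp_all
      with False show False ..
    qed
    moreover have "\<not> (i = usnd q \<and> j = ufst q)"
    proof
      assume ij: "i = usnd q \<and> j = ufst q"
      then have "j \<le> i" using upper_le[of q] by simp
      then have "q = ?p" using ij p by (intro upper_eqI) simp_all
      with False show False ..
    qed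
    ultimately show ?thesis using False by (auto simp: H_mat_def)
  qed
  have "sym_mat x $ i $ j = (\<Sum>q\<in>UNIV. x $ q * (if q = ?p then 1 else 0))"
    by (simp add: sym_mat_def H)
  also have "\<dots> = (\<Sum>q\<in>UNIV. if q = ?p then x $ q else 0)"
    by (rule sum.cong) auto
  finally show ?thesis by simp
qed

lemma card_upper: "CARD('n::{finite,linorder} upper) = CARD('n) + (CARD('n) choose 2)"
proof -
  let ?lt = "{p :: 'n \<times> 'n. fst p < snd p}" and ?gt = "{p :: 'n \<times> 'n. snd p < fst p}" and ?eq = "range (\<lambda>i::'n. (i, i))"
  have inj: "inj (pair_of :: 'n upper \<Rightarrow> 'n \<times> 'n)" by (simp add: inj_on_def pair_of_inject)
  have "range (pair_of :: 'n upper \<Rightarrow> 'n \<times> 'n) = {p. fst p \<le> snd p}"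
    using type_definition.Rep_range[OF type_definition_upper] .
  also have "\<dots> = ?eq \<union> ?lt" by (auto simp: le_less)
  finally have "CARD('n upper) = card (?eq \<union> ?lt)"
    using inj by (metis card_image)
  also have "\<dots> = card ?eq + card ?lt" by (rule card_Un_disjoint) auto
  also have "card ?eq = CARD('n)" by (rule card_image) (auto simp: inj_on_def)
  finally have 1: "CARD('n upper) = CARD('n) + card ?lt" .
  have "bij_betw prod.swap ?lt ?gt"
    by (rule bij_betw_byWitness[of _ prod.swap]) auto
  then have gt: "card ?gt = card ?lt" by (simp add: bij_betw_same_card)
  have "(UNIV :: ('n \<times> 'n) set) = (?eq \<union> ?lt) \<union> ?gt"
    by (auto simp: image_iff)
  then have "CARD('n \<times> 'n) = card ((?eq \<union> ?lt) \<union> ?gt)" by (rule arg_cong)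
  also have "\<dots> = card (?eq \<union> ?lt) + card ?gt" by (rule card_Un_disjoint) auto
  also have "card (?eq \<union> ?lt) = card ?eq + card ?lt" by (rule card_Un_disjoint) auto
  also have "card ?eq = CARD('n)" by (rule card_image) (auto simp: inj_on_def)
  finally have "CARD('n) * CARD('n) = CARD('n) + 2 * card ?lt" by (simp add: gt)
  then have "2 * card ?lt = CARD('n) * (CARD('n) - 1)" by (simp add: algebra_simps)
  then have "card ?lt = CARD('n) choose 2" by (simp add: choose_two)
  with 1 show ?thesis by simp
qed

text \<open>
  The coordinates of \<open>amp M\<close> times \<open>m m\<^sup>T\<close> in the basis \<open>H_mat\<close>.  They are also, up to sign, the
  coefficients of \<open>A_fun m\<close> in the functions \<open>a_vec\<close>.
\<close>

definition hess_coord :: "(int^'n::{finite,linorder}) set \<Rightarrow> int^'n::{finite,linorder} \<Rightarrow> real^'n upper" where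
  "hess_coord M m = (\<chi> p. amp M * of_int (m $ ufst p * m $ usnd p))"

lemma sym_mat_hess_coord:
  fixes M :: "(int^'n::{finite,linorder}) set"
  shows "sym_mat (hess_coord M m) = amp M *\<^sub>R outer (rvec m)"
proof (rule vec_eq_iff[THEN iffD2], rule allI, rule vec_eq_iff[THEN iffD2], rule allI)
  fix i j :: 'n
  show "sym_mat (hess_coord M m) $ i $ j = (amp M *\<^sub>R outer (rvec m)) $ i $ j"
    unfolding sym_mat_nth
    by (cases "i \<le> j") (simp_all add: hess_coord_def outer_def rvec_def min_def max_def upper_Upper mult.commute)
qed

lemma linear_sym_mat: "linear sym_mat"
  by (rule linearI) (simp_all add: vec_eq_iff sym_mat_nth)

lemma sym_mat_comb: "sym_mat (\<Sum>m\<in>M. \<alpha> m *\<^sub>R hess_coord M m) = amp M *\<^sub>R (\<Sum>m\<in>M. \<alpha> m *\<^sub>R outer (rvec m))"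
  by (simp add: linear_sum[OF linear_sym_mat] linear_scale[OF linear_sym_mat] sym_mat_hess_coord
      scaleR_sum_right mult.commute)

lemma a_vec_eq: "a_vec M i j = trig_comb M (\<lambda>m. (- amp M * of_int (m $ i * m $ j), 0))"
  unfolding a_vec_def trig_comb_def amp_def[symmetric, where M=M]
  by (auto simp: fun_eq_iff sum_distrib_left mult.assoc intro!: sum.cong)

text \<open>
  The modes are orthonormal, so the Gram matrix of the functions \<open>a_vec\<close> is that of their coefficient
  vectors.
\<close>

lemma C_mat_nth:
  fixes M :: "(int^'n::{finite,linorder}) set"
  assumes M: "finite M" "M \<subseteq> pos_cone"
  shows "C_mat M $ p $ q = 2 / (2 * pi) ^ CARD('n) *
         (\<Sum>m\<in>M. of_int (m $ ufst p * m $ usnd p * m $ ufst q * m $ usnd q))"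
    and "C_mat M = (\<Sum>m\<in>M. outer (hess_coord M m))"
proof -
  have "C_mat M $ p $ q = (\<Sum>m\<in>M. (amp M)\<^sup>2 * of_int (m $ ufst p * m $ usnd p * m $ ufst q * m $ usnd q))" for p q
    unfolding C_mat_def vec_lambda_beta a_vec_eq l2_inner_trig_comb[OF M]
    by (rule sum.cong) (simp_all add: power2_eq_square)
  then have *: "C_mat M $ p $ q = (amp M)\<^sup>2 * (\<Sum>m\<in>M. of_int (m $ ufst p * m $ usnd p * m $ ufst q * m $ usnd q))" for p q
    by (simp only: sum_distrib_left)
  then show "C_mat M $ p $ q = 2 / (2 * pi) ^ CARD('n) *
         (\<Sum>m\<in>M. of_int (m $ ufst p * m $ usnd p * m $ ufst q * m $ usnd q))"
    by (simp only: amp_square)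
  show "C_mat M = (\<Sum>m\<in>M. outer (hess_coord M m))"
  proof (rule vec_eq_iff[THEN iffD2], rule allI, rule vec_eq_iff[THEN iffD2], rule allI)
    fix p q
    have "(\<Sum>m\<in>M. outer (hess_coord M m)) $ p $ q
        = (\<Sum>m\<in>M. (amp M)\<^sup>2 * of_int (m $ ufst p * m $ usnd p * m $ ufst q * m $ usnd q))"
      unfolding sum_component by (rule sum.cong) (simp_all add: outer_def hess_coord_def power2_eq_square)
    then show "C_mat M $ p $ q = (\<Sum>m\<in>M. outer (hess_coord M m)) $ p $ q"
      unfolding * by (simp only: sum_distrib_left)
  qed
qed

text \<open>
  A vector \<open>y\<close> orthogonal to all \<open>hess_coord M m\<close> gives a linear relation between the functions
  \<open>a_vec\<close>.  If the modes are all orthogonal to \<open>\<xi>\<close>, then so are the matrices \<open>m m\<^sup>T\<close> to the quadratic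
  form \<open>X \<mapsto> \<xi> \<bullet> X \<xi>\<close>, which is therefore zero; its values at the diagonal \<open>H_mat i i\<close> are the
  squares of the coordinates of \<open>\<xi>\<close>.
\<close>

lemma independent_spans:
  fixes M :: "(int^'n::{finite,linorder}) set"
  assumes ind: "a_vecs_independent M"
  shows "(\<And>m. m \<in> M \<Longrightarrow> hess_coord M m \<bullet> y = 0) \<Longrightarrow> y = 0"
    and "spanning M"
proof -
  show dual: "y = 0" if y: "\<And>m. m \<in> M \<Longrightarrow> hess_coord M m \<bullet> y = 0" for y
  proof -
    have "(\<Sum>p\<in>UNIV. y $ p * a_vec M (ufst p) (usnd p) \<theta>) = 0" for \<theta>
    proof -
      have "a_vec M (ufst p) (usnd p) \<theta> = - (\<Sum>m\<in>M. hess_coord M m $ p * A_fun m \<theta>)" for p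
        unfolding a_vec_def amp_def[symmetric, where M=M]
        by (simp add: hess_coord_def sum_distrib_left mult.assoc sum_negf)
      then have "(\<Sum>p\<in>UNIV. y $ p * a_vec M (ufst p) (usnd p) \<theta>)
          = - (\<Sum>p\<in>UNIV. \<Sum>m\<in>M. y $ p * (hess_coord M m $ p * A_fun m \<theta>))"
        by (simp add: sum_negf sum_distrib_left)
      also have "(\<Sum>p\<in>UNIV. \<Sum>m\<in>M. y $ p * (hess_coord M m $ p * A_fun m \<theta>))
          = (\<Sum>m\<in>M. \<Sum>p\<in>UNIV. y $ p * (hess_coord M m $ p * A_fun m \<theta>))"
        by (rule sum.swap)
      also have "\<dots> = (\<Sum>m\<in>M. (hess_coord M m \<bullet> y) * A_fun m \<theta>)"
        by (rule sum.cong) (simp_all add: inner_vec_def sum_distrib_left mult_ac)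
      also have "\<dots> = 0" using y by simp
      finally show ?thesis by simp
    qed
    then have "\<forall>p. y $ p = 0"
      using ind unfolding a_vecs_independent_def by blast
    then show "y = 0" by (simp add: vec_eq_iff)
  qed
  show "spanning M"
    unfolding spanning_def
  proof (intro allI impI)
    fix \<xi> :: "real^'n::_" assume \<xi>: "\<forall>m\<in>M. rvec m \<bullet> \<xi> = 0"
    (* The quadratic form X |-> \<xi> \<bullet> X \<xi> in coordinates. *)
    define y :: "real^'n upper" where "y = (\<chi> p. \<xi> \<bullet> (H_mat (ufst p) (usnd p) *v \<xi>))"
    have mult: "(\<Sum>p\<in>S. x $ p *\<^sub>R H_mat (ufst p) (usnd p)) *v \<xi> = (\<Sum>p\<in>S. x $ p *\<^sub>R (H_mat (ufst p) (usnd p) *v \<xi>))"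
      for S and x :: "real^'n upper"
      by (induction S rule: infinite_finite_induct)
         (simp_all add: matrix_vector_mult_add_rdistrib scaleR_matrix_vector_assoc[symmetric])
    have quad: "\<xi> \<bullet> (sym_mat x *v \<xi>) = x \<bullet> y" for x
      unfolding sym_mat_def mult by (simp add: inner_sum_right y_def inner_vec_def[of x])
    have "hess_coord M m \<bullet> y = 0" if "m \<in> M" for m
      unfolding quad[symmetric] sym_mat_hess_coord
      using \<xi> that by (simp add: scaleR_matrix_vector_assoc[symmetric] outer_mult_vec)
    then have "y = 0" by (rule dual)
    have "\<xi> $ i = 0" for i
    proof -
      let ?p = "Upper (i, i)"
      note p = upper_Upper[OF order_refl, of i]
      have "H_mat i i *v \<xi> = axis i (\<xi> $ i)"
      proof (rule vec_eq_iff[THEN iffD2], rule allI)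
        fix k
        have "(H_mat i i *v \<xi>) $ k = (\<Sum>l\<in>UNIV. if l = i then (if k = i then \<xi> $ l else 0) else 0)"
          unfolding matrix_vector_mult_def vec_lambda_beta by (rule sum.cong) (auto simp: H_mat_def)
        then show "(H_mat i i *v \<xi>) $ k = axis i (\<xi> $ i) $ k" by (simp add: axis_def)
      qed
      then have "y $ ?p = \<xi> $ i * \<xi> $ i" by (simp add: y_def p inner_axis)
      then show ?thesis using \<open>y = 0\<close> by simp
    qed
    then show "\<xi> = 0" by (simp add: vec_eq_iff)
  qed
qed

section \<open>The mean number of critical points\<close>

lemma gaussian_moment_finite:
  "(\<integral>\<^sup>+t. ennreal (exp (- t\<^sup>2 / 2) * (1 + \<bar>t\<bar>) ^ n) \<partial>lborel) < \<infinity>"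
proof -
  have bound: "exp (- t\<^sup>2 / 2) * (1 + \<bar>t\<bar>) ^ n \<le> (fact n * exp 2) * exp (- (1 / 2 * t\<^sup>2 - 2 * 0 * t) / 2)" for t :: real
  proof -
    have "(1 + \<bar>t\<bar>) ^ n / fact n \<le> exp (1 + \<bar>t\<bar>)"
    proof -
      have "(\<Sum>k\<in>{n}. (1 + \<bar>t\<bar>) ^ k /\<^sub>R fact k) \<le> (\<Sum>k. (1 + \<bar>t\<bar>) ^ k /\<^sub>R fact k)"
        by (rule sum_le_suminf[OF summable_exp_generic]) auto
      then show ?thesis by (simp add: exp_def divide_inverse mult.commute)
    qed
    then have "(1 + \<bar>t\<bar>) ^ n \<le> fact n * exp (1 + \<bar>t\<bar>)"
      by (simp add: field_simps)
    then have "exp (- t\<^sup>2 / 2) * (1 + \<bar>t\<bar>) ^ n \<le> exp (- t\<^sup>2 / 2) * (fact n * exp (1 + \<bar>t\<bar>))"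
      by (rule mult_left_mono) simp
    also have "\<dots> = fact n * exp (- t\<^sup>2 / 2 + (1 + \<bar>t\<bar>))"
      by (simp only: exp_add mult_ac)
    also have "- t\<^sup>2 / 2 + (1 + \<bar>t\<bar>) \<le> 2 - t\<^sup>2 / 4"
    proof -
      have "0 \<le> (\<bar>t\<bar> / 2 - 1)\<^sup>2" by simp
      also have "\<dots> = t\<^sup>2 / 4 - \<bar>t\<bar> + 1" by (simp add: power2_diff power_divide)
      finally show ?thesis by simp
    qed
    then have "fact n * exp (- t\<^sup>2 / 2 + (1 + \<bar>t\<bar>)) \<le> fact n * exp (2 - t\<^sup>2 / 4)" by simp
    also have "\<dots> = (fact n * exp 2) * exp (- (1 / 2 * t\<^sup>2 - 2 * 0 * t) / 2)"
    proof -
      have "2 - t\<^sup>2 / 4 = 2 + (- (1 / 2 * t\<^sup>2 - 2 * 0 * t) / 2)" by simp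
      then show ?thesis by (simp only: exp_add mult.assoc)
    qed
    finally show ?thesis .
  qed
  have "(\<integral>\<^sup>+t. ennreal (exp (- t\<^sup>2 / 2) * (1 + \<bar>t\<bar>) ^ n) \<partial>lborel)
      \<le> (\<integral>\<^sup>+t. ennreal (fact n * exp 2) * ennreal (exp (- (1 / 2 * t\<^sup>2 - 2 * 0 * t) / 2)) \<partial>lborel)"
    by (rule nn_integral_mono) (use bound in \<open>simp add: ennreal_mult'[symmetric] ennreal_leI\<close>)
  also have "\<dots> = ennreal (fact n * exp 2) * (\<integral>\<^sup>+t. ennreal (exp (- (1 / 2 * t\<^sup>2 - 2 * 0 * t) / 2)) \<partial>lborel)"
    by (rule nn_integral_cmult) measurable
  also have "\<dots> < \<infinity>"
    unfolding nn_integral_gauss_quadratic[of "1/2" 0, OF half_gt_zero[OF zero_less_one]]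
    by (simp add: ennreal_mult_less_top)
  finally show ?thesis .
qed

lemma det_le_entry_bound:
  fixes A :: "real^'n::finite^'n"
  assumes "\<And>i j. \<bar>A $ i $ j\<bar> \<le> B"
  shows "\<bar>det A\<bar> \<le> fact CARD('n) * B ^ CARD('n)"
proof -
  have "\<bar>det A\<bar> \<le> (\<Sum>p\<in>{p. p permutes (UNIV::'n set)}. \<bar>of_int (sign p) * (\<Prod>i\<in>UNIV. A $ i $ p i)\<bar>)"
    unfolding det_def by (rule sum_abs)
  also have "\<dots> \<le> (\<Sum>p\<in>{p. p permutes (UNIV::'n set)}. B ^ CARD('n))"
  proof (rule sum_mono)
    fix p :: "'n \<Rightarrow> 'n"
    have "\<bar>of_int (sign p) * (\<Prod>i\<in>UNIV. A $ i $ p i)\<bar> = (\<Prod>i\<in>UNIV. \<bar>A $ i $ p i\<bar>)"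
      by (simp add: abs_mult sign_def abs_prod)
    also have "\<dots> \<le> (\<Prod>i\<in>(UNIV::'n set). B)"
      by (rule prod_mono) (use assms in auto)
    finally show "\<bar>of_int (sign p) * (\<Prod>i\<in>UNIV. A $ i $ p i)\<bar> \<le> B ^ CARD('n)" by simp
  qed
  also have "\<dots> = fact CARD('n) * B ^ CARD('n)"
    using card_permutations[of "UNIV :: 'n set", OF refl] by simp
  finally show ?thesis .
qed

text \<open>
  The determinant is a polynomial in the coefficients, so it is bounded by a constant times a product of
  powers of \<open>1 + \<bar>\<alpha> m\<bar>\<close>, which has finite Gaussian moments.  Finiteness is what allows the nonnegative
  integral to be written as a real number.
\<close>

lemma gaussian_hessian_finite:
  fixes M :: "(int^'n::finite) set"
  assumes M: "finite M"
  shows "(\<integral>\<^sup>+\<alpha>. ennreal (exp (- (\<Sum>m\<in>M. (\<alpha> m)\<^sup>2) / 2) * \<bar>det (\<Sum>m\<in>M. \<alpha> m *\<^sub>R outer (rvec m))\<bar>) \<partial>(\<Pi>\<^sub>M m\<in>M. lborel)) < \<infinity>"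
proof -
  interpret product_sigma_finite "\<lambda>_::int^'n. lborel :: real measure"
    by (rule product_sigma_finite_lborel)
  let ?L = "CARD('n)"
  define B where "B = (\<Sum>m\<in>M. (norm (rvec m))\<^sup>2)"
  have bound: "exp (- (\<Sum>m\<in>M. (\<alpha> m)\<^sup>2) / 2) * \<bar>det (\<Sum>m\<in>M. \<alpha> m *\<^sub>R outer (rvec m))\<bar>
      \<le> (fact ?L * B ^ ?L) * (\<Prod>m\<in>M. exp (- (\<alpha> m)\<^sup>2 / 2) * (1 + \<bar>\<alpha> m\<bar>) ^ ?L)" for \<alpha>
  proof -
    define Q where "Q = (\<Prod>m\<in>M. 1 + \<bar>\<alpha> m\<bar>)"
    have Q: "\<bar>\<alpha> m\<bar> \<le> Q" if "m \<in> M" for m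
    proof -
      have "1 + \<bar>\<alpha> m\<bar> = (\<Prod>k\<in>{m}. 1 + \<bar>\<alpha> k\<bar>)" by simp
      also have "\<dots> \<le> Q" unfolding Q_def by (rule prod_mono2) (use M that in auto)
      finally show ?thesis by simp
    qed
    have "\<bar>(\<Sum>m\<in>M. \<alpha> m *\<^sub>R outer (rvec m)) $ i $ j\<bar> \<le> Q * B" for i j
    proof -
      have "\<bar>(\<Sum>m\<in>M. \<alpha> m *\<^sub>R outer (rvec m)) $ i $ j\<bar> \<le> (\<Sum>m\<in>M. \<bar>\<alpha> m * (rvec m $ i * rvec m $ j)\<bar>)"
        by (simp add: outer_def)
      also have "\<dots> \<le> (\<Sum>m\<in>M. Q * (norm (rvec m))\<^sup>2)"
      proof (rule sum_mono)
        fix m assume m: "m \<in> M"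
        have "\<bar>rvec m $ i * rvec m $ j\<bar> \<le> (norm (rvec m))\<^sup>2"
          unfolding abs_mult power2_eq_square by (intro mult_mono component_le_norm_cart) auto
        then show "\<bar>\<alpha> m * (rvec m $ i * rvec m $ j)\<bar> \<le> Q * (norm (rvec m))\<^sup>2"
          unfolding abs_mult[of "\<alpha> m"] using Q[OF m] by (intro mult_mono) auto
      qed
      finally show ?thesis by (simp add: B_def sum_distrib_left)
    qed
    from det_le_entry_bound[OF this]
    have "\<bar>det (\<Sum>m\<in>M. \<alpha> m *\<^sub>R outer (rvec m))\<bar> \<le> fact ?L * B ^ ?L * Q ^ ?L"
      by (simp add: power_mult_distrib mult_ac)
    then have "exp (- (\<Sum>m\<in>M. (\<alpha> m)\<^sup>2) / 2) * \<bar>det (\<Sum>m\<in>M. \<alpha> m *\<^sub>R outer (rvec m))\<bar>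
        \<le> exp (- (\<Sum>m\<in>M. (\<alpha> m)\<^sup>2) / 2) * (fact ?L * B ^ ?L * Q ^ ?L)"
      by (rule mult_left_mono) simp
    also have "exp (- (\<Sum>m\<in>M. (\<alpha> m)\<^sup>2) / 2) * (fact ?L * B ^ ?L * Q ^ ?L)
        = (\<Prod>m\<in>M. exp (- (\<alpha> m)\<^sup>2 / 2)) * (fact ?L * B ^ ?L * Q ^ ?L)"
    proof -
      have "- (\<Sum>m\<in>M. (\<alpha> m)\<^sup>2) / 2 = (\<Sum>m\<in>M. - (\<alpha> m)\<^sup>2 / 2)"
        by (simp add: sum_negf sum_divide_distrib)
      then show ?thesis by (simp only: exp_sum[OF M])
    qed
    also have "(\<Prod>m\<in>M. exp (- (\<alpha> m)\<^sup>2 / 2)) * (fact ?L * B ^ ?L * Q ^ ?L)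
        = (fact ?L * B ^ ?L) * (\<Prod>m\<in>M. exp (- (\<alpha> m)\<^sup>2 / 2) * (1 + \<bar>\<alpha> m\<bar>) ^ ?L)"
      by (simp add: Q_def prod.distrib prod_power_distrib mult_ac)
    finally show ?thesis .
  qed
  have B0: "0 \<le> B" by (simp add: B_def sum_nonneg)
  have "(\<integral>\<^sup>+\<alpha>. ennreal (exp (- (\<Sum>m\<in>M. (\<alpha> m)\<^sup>2) / 2) * \<bar>det (\<Sum>m\<in>M. \<alpha> m *\<^sub>R outer (rvec m))\<bar>) \<partial>(\<Pi>\<^sub>M m\<in>M. lborel))
      \<le> (\<integral>\<^sup>+\<alpha>. ennreal (fact ?L * B ^ ?L) * (\<Prod>m\<in>M. ennreal (exp (- (\<alpha> m)\<^sup>2 / 2) * (1 + \<bar>\<alpha> m\<bar>) ^ ?L)) \<partial>(\<Pi>\<^sub>M m\<in>M. lborel))"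
  proof (rule nn_integral_mono)
    fix \<alpha> :: "int^'n \<Rightarrow> real"
    have "(\<Prod>m\<in>M. ennreal (exp (- (\<alpha> m)\<^sup>2 / 2) * (1 + \<bar>\<alpha> m\<bar>) ^ ?L))
        = ennreal (\<Prod>m\<in>M. exp (- (\<alpha> m)\<^sup>2 / 2) * (1 + \<bar>\<alpha> m\<bar>) ^ ?L)"
      by (rule prod_ennreal) simp
    then show "ennreal (exp (- (\<Sum>m\<in>M. (\<alpha> m)\<^sup>2) / 2) * \<bar>det (\<Sum>m\<in>M. \<alpha> m *\<^sub>R outer (rvec m))\<bar>)
       \<le> ennreal (fact ?L * B ^ ?L) * (\<Prod>m\<in>M. ennreal (exp (- (\<alpha> m)\<^sup>2 / 2) * (1 + \<bar>\<alpha> m\<bar>) ^ ?L))"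
      using bound[of \<alpha>] B0 by (simp only: ennreal_leI ennreal_mult'[symmetric] zero_le_mult_iff fact_ge_zero zero_le_power simp_thms)
  qed
  also have "\<dots> = ennreal (fact ?L * B ^ ?L) * (\<integral>\<^sup>+\<alpha>. (\<Prod>m\<in>M. ennreal (exp (- (\<alpha> m)\<^sup>2 / 2) * (1 + \<bar>\<alpha> m\<bar>) ^ ?L)) \<partial>(\<Pi>\<^sub>M m\<in>M. lborel))"
  proof (rule nn_integral_cmult, rule borel_measurable_prod_ennreal)
    fix m assume m: "m \<in> M"
    note [measurable] = borel_measurable_PiM_component[OF m, where ?'a=real]
    show "(\<lambda>\<alpha>. ennreal (exp (- (\<alpha> m)\<^sup>2 / 2) * (1 + \<bar>\<alpha> m\<bar>) ^ ?L)) \<in> borel_measurable (\<Pi>\<^sub>M m\<in>M. lborel)"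
      by measurable
  qed
  also have "(\<integral>\<^sup>+\<alpha>. (\<Prod>m\<in>M. ennreal (exp (- (\<alpha> m)\<^sup>2 / 2) * (1 + \<bar>\<alpha> m\<bar>) ^ ?L)) \<partial>(\<Pi>\<^sub>M m\<in>M. lborel))
      = (\<Prod>m\<in>M. \<integral>\<^sup>+t. ennreal (exp (- t\<^sup>2 / 2) * (1 + \<bar>t\<bar>) ^ ?L) \<partial>lborel)"
    by (rule product_nn_integral_prod[OF M]) simp
  also have "ennreal (fact ?L * B ^ ?L) * \<dots> < \<infinity>"
    using gaussian_moment_finite[of ?L] by (simp add: ennreal_mult_less_top power_less_top_ennreal)
  finally show ?thesis .
qed

lemma borel_measurable_det_sym_mat [measurable]:
  "(\<lambda>x :: real^'n::{finite,linorder} upper. det (sym_mat x)) \<in> borel_measurable borel"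
proof -
  have "continuous_on UNIV (\<lambda>x :: real^'n::_ upper. \<Sum>p\<in>{p. p permutes (UNIV::'n set)}.
      of_int (sign p) * (\<Prod>i\<in>UNIV. x $ Upper (min i (p i), max i (p i))))"
    by (intro continuous_intros)
  then have "continuous_on UNIV (\<lambda>x :: real^'n::_ upper. det (sym_mat x))"
    by (simp add: det_def sym_mat_nth)
  then show ?thesis by (rule borel_measurable_continuous_onI)
qed

text \<open>
  The mean of \<open>\<bar>det Hess\<bar>\<close>, transported to the coordinates on the space of symmetric matrices,
  where the Hessian has covariance \<open>C_mat M\<close>.  The factor \<open>amp M\<close> in \<open>hess_coord\<close> comes out of the
  determinant to the power \<open>L\<close>.
\<close>

lemma gaussian_hessian_eq:
  fixes M :: "(int^'n::{finite,linorder}) set"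
  assumes M: "finite M" "M \<subseteq> pos_cone"
    and e: "inj e" "range e \<subseteq> M" and P: "det (frame_matrix (hess_coord M) e) \<noteq> 0"
  defines "I \<equiv> (LINT x|lborel. exp (- (1 / 2) * ((matrix_inv (C_mat M) *v x) \<bullet> x)) * \<bar>det (sym_mat x)\<bar>)"
  shows "(\<integral>\<^sup>+\<alpha>. ennreal (exp (- (\<Sum>m\<in>M. (\<alpha> m)\<^sup>2) / 2) * \<bar>det (\<Sum>m\<in>M. \<alpha> m *\<^sub>R outer (rvec m))\<bar>) \<partial>(\<Pi>\<^sub>M m\<in>M. lborel))
      = ennreal (sqrt (2 * pi) ^ (card M - CARD('n upper)) / (amp M ^ CARD('n) * sqrt (det (C_mat M))) * I)"
    and "0 \<le> I"
proof -
  let ?F = "\<integral>\<^sup>+\<alpha>. ennreal (exp (- (\<Sum>m\<in>M. (\<alpha> m)\<^sup>2) / 2) * \<bar>det (\<Sum>m\<in>M. \<alpha> m *\<^sub>R outer (rvec m))\<bar>) \<partial>(\<Pi>\<^sub>M m\<in>M. lborel)"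
  let ?s = "sqrt (2 * pi)" and ?L = "CARD('n)" and ?k = "card M - CARD('n upper)"
  let ?g = "\<lambda>x. exp (- (1 / 2) * ((matrix_inv (C_mat M) *v x) \<bullet> x)) * \<bar>det (sym_mat x)\<bar>"
  have C: "C_mat M = (\<Sum>m\<in>M. outer (hess_coord M m))" by (rule C_mat_nth(2)[OF M])
  have detC: "det (C_mat M) > 0" unfolding C by (rule det_frame_covariance(3)[OF M(1) e P])
  have card: "card (M - range e) = ?k"
    using e by (simp add: card_Diff_subset card_image)
  show I0: "0 \<le> I" unfolding I_def by (rule Bochner_Integration.integral_nonneg) simp
  have amp: "amp M ^ ?L > 0" using amp_pos[of M] by simp
  have meas: "?g \<in> borel_measurable lborel"
  proof -
    have "(\<lambda>x. gauss_kernel (C_mat M) x * sqrt (det (C_mat M)) * \<bar>det (sym_mat x)\<bar>) \<in> borel_measurable lborel"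
      using borel_measurable_gauss_kernel[of "C_mat M"] by measurable
    then show ?thesis using detC by (simp add: gauss_kernel_def)
  qed
  have int: "(\<integral>\<^sup>+\<alpha>. ennreal (exp (- (\<Sum>m\<in>M. (\<alpha> m)\<^sup>2) / 2)) * ennreal \<bar>det (sym_mat (\<Sum>m\<in>M. \<alpha> m *\<^sub>R hess_coord M m))\<bar> \<partial>(\<Pi>\<^sub>M m\<in>M. lborel))
      = ennreal (?s ^ ?k) * (\<integral>\<^sup>+x. ennreal (gauss_kernel (C_mat M) x) * ennreal \<bar>det (sym_mat x)\<bar> \<partial>lborel)"
    unfolding C card[symmetric] by (rule gaussian_pushforward[OF M(1) e P]) measurable
  have "(\<integral>\<^sup>+\<alpha>. ennreal (exp (- (\<Sum>m\<in>M. (\<alpha> m)\<^sup>2) / 2)) * ennreal \<bar>det (sym_mat (\<Sum>m\<in>M. \<alpha> m *\<^sub>R hess_coord M m))\<bar> \<partial>(\<Pi>\<^sub>M m\<in>M. lborel))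
      = (\<integral>\<^sup>+\<alpha>. ennreal (amp M ^ ?L) * ennreal (exp (- (\<Sum>m\<in>M. (\<alpha> m)\<^sup>2) / 2) * \<bar>det (\<Sum>m\<in>M. \<alpha> m *\<^sub>R outer (rvec m))\<bar>) \<partial>(\<Pi>\<^sub>M m\<in>M. lborel))"
    using amp by (intro nn_integral_cong)
      (simp add: sym_mat_comb det_scaleR abs_mult ennreal_mult'[symmetric] mult_ac)
  also have "\<dots> = ennreal (amp M ^ ?L) * ?F"
    by (rule nn_integral_cmult) (rule borel_measurable_gaussian_hessian)
  finally have 1: "ennreal (amp M ^ ?L) * ?F
      = ennreal (?s ^ ?k) * (\<integral>\<^sup>+x. ennreal (gauss_kernel (C_mat M) x) * ennreal \<bar>det (sym_mat x)\<bar> \<partial>lborel)"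
    using int by simp
  have "(\<integral>\<^sup>+x. ennreal (gauss_kernel (C_mat M) x) * ennreal \<bar>det (sym_mat x)\<bar> \<partial>lborel)
      = (\<integral>\<^sup>+x. ennreal (1 / sqrt (det (C_mat M))) * ennreal (?g x) \<partial>lborel)"
    using detC by (intro nn_integral_cong) (simp add: gauss_kernel_def ennreal_mult'[symmetric])
  also have "\<dots> = ennreal (1 / sqrt (det (C_mat M))) * (\<integral>\<^sup>+x. ennreal (?g x) \<partial>lborel)"
    by (rule nn_integral_cmult) (use meas in measurable)
  finally have 2: "ennreal (amp M ^ ?L) * ?F
      = ennreal (?s ^ ?k / sqrt (det (C_mat M))) * (\<integral>\<^sup>+x. ennreal (?g x) \<partial>lborel)"
    unfolding 1 using detC by (simp add: mult.assoc[symmetric] ennreal_mult'[symmetric])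
  have fin: "(\<integral>\<^sup>+x. ennreal (?g x) \<partial>lborel) < \<infinity>"
  proof (rule ccontr)
    assume "\<not> ?thesis"
    then have "(\<integral>\<^sup>+x. ennreal (?g x) \<partial>lborel) = top" by (simp add: less_top[symmetric])
    then have "ennreal (amp M ^ ?L) * ?F = top"
      unfolding 2 using detC by (simp add: ennreal_mult_top)
    moreover have "ennreal (amp M ^ ?L) * ?F < top"
      using gaussian_hessian_finite[OF M(1)] by (simp add: ennreal_mult_less_top)
    ultimately show False by simp
  qed
  have "integrable lborel ?g"
    by (rule integrableI_nonneg[OF meas _ fin]) simp
  then have 3: "(\<integral>\<^sup>+x. ennreal (?g x) \<partial>lborel) = ennreal I"
    unfolding I_def by (rule nn_integral_eq_integral) simp
  have "?F = ennreal (1 / amp M ^ ?L) * (ennreal (amp M ^ ?L) * ?F)"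
    using amp_pos[of M] by (simp add: mult.assoc[symmetric] ennreal_mult'[symmetric])
  also have "\<dots> = ennreal (1 / amp M ^ ?L * (?s ^ ?k / sqrt (det (C_mat M)) * I))"
    unfolding 2 3 using amp detC I0 by (simp add: ennreal_mult'[symmetric])
  also have "1 / amp M ^ ?L * (?s ^ ?k / sqrt (det (C_mat M)) * I) = ?s ^ ?k / (amp M ^ ?L * sqrt (det (C_mat M))) * I"
    by simp
  finally show "?F = ennreal (?s ^ ?k / (amp M ^ ?L * sqrt (det (C_mat M))) * I)" .
qed

text \<open>
  The sphere is replaced by the Gaussian measure, the Kac-Rice formula is applied with a basis chosen
  among the modes, and the law of the Hessian is inserted with a basis chosen among the vectors
  \<open>hess_coord M m\<close>.  Neither choice leaves a trace in the result.
\<close>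

lemma mean_critical_eq:
  fixes M :: "(int^'n::{finite,linorder}) set"
  assumes M: "finite M" "M \<subseteq> pos_cone" and ind: "a_vecs_independent M"
  shows "mean_critical M = ennreal
     (1 / (sqrt (2 * pi) ^ (CARD('n) choose 2) * (amp M ^ CARD('n) * sqrt (det (mode_gram M))) * sqrt (det (C_mat M)))
      * (LINT x|lborel. exp (- (1 / 2) * ((matrix_inv (C_mat M) *v x) \<bullet> x)) * \<bar>det (sym_mat x)\<bar>))"
proof -
  let ?L = "CARD('n)" and ?N = "card M"
  define s where "s = sqrt (2 * pi)"
  have s: "s > 0" "s\<^sup>2 = 2 * pi" by (simp_all add: s_def)
  let ?U = "CARD('n upper)" and ?D = "?L choose 2"
  define I where "I = (LINT x|lborel. exp (- (1 / 2) * ((matrix_inv (C_mat M) *v x) \<bullet> x)) * \<bar>det (sym_mat x)\<bar>)"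
  obtain e where e: "inj e" "range e \<subseteq> M" "det (frame_matrix rvec e) \<noteq> 0"
  proof (rule exists_frame[OF M(1)])
    show "x = 0" if "\<And>m. m \<in> M \<Longrightarrow> rvec m \<bullet> x = 0" for x :: "real^'n::_"
      using independent_spans(2)[OF ind] that unfolding spanning_def by blast
  qed
  obtain f where f: "inj f" "range f \<subseteq> M" "det (frame_matrix (hess_coord M) f) \<noteq> 0"
  proof (rule exists_frame[OF M(1)])
    show "x = 0" if "\<And>m. m \<in> M \<Longrightarrow> hess_coord M m \<bullet> x = 0" for x
      by (rule independent_spans(1)[OF ind that])
  qed
  interpret mode_frame M e by standard (use M(1) e in auto)
  have NL: "?L \<le> ?N" using card_mono[OF M(1) e(2)] card_image[OF e(1)] by simp
  have NU: "?U \<le> ?N" using card_mono[OF M(1) f(2)] card_image[OF f(1)] by simp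
  have detG: "det (mode_gram M) > 0"
    unfolding mode_gram_def by (rule det_frame_covariance(3)[OF M(1) e])
  have detC: "det (C_mat M) > 0"
    unfolding C_mat_nth(2)[OF M] by (rule det_frame_covariance(3)[OF M(1) f])
  note hess = gaussian_hessian_eq[OF M f, folded I_def s_def]
  have amp: "amp M > 0" by (rule amp_pos)
  define z where "z = (2 * pi) ^ ?L * s ^ (?N - ?L) / sqrt (det (mode_gram M))
      * (s ^ (?N - ?U) / (amp M ^ ?L * sqrt (det (C_mat M))) * I)"
  have z: "0 \<le> z" unfolding z_def using detG detC amp hess(2) s(1) by simp
  have "(\<integral>\<^sup>+c. ennreal (exp (- sqnorm M c / 2)) * num_critical (trig_comb M c) \<partial>coef_measure M) = ennreal z"
    unfolding sqnorm_def kac_rice hess(1) s_def[symmetric] z_def mode_gram_def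
    using det_frame_covariance(3)[OF M(1) e] s(1) by (intro ennreal_mult'[symmetric]) simp
  then have "mean_critical M = ennreal (z / (2 * pi) ^ ?N)"
    using mean_critical_gaussian[OF M _ _ z] e(2) by blast
  also have "z / (2 * pi) ^ ?N = 1 / (s ^ ?D * (amp M ^ ?L * sqrt (det (mode_gram M))) * sqrt (det (C_mat M))) * I"
  proof -
    have sq: "(2 * pi) ^ k = s ^ (2 * k)" for k by (simp only: power_mult s(2))
    (* Neither subtraction truncates, because e and f are injections into M. *)
    have "2 * ?L + (?N - ?L) + (?N - ?U) + ?D = 2 * ?N"
      using NL NU card_upper[where 'n='n] by linarith
    then have "(2 * pi) ^ ?L * s ^ (?N - ?L) * s ^ (?N - ?U) * s ^ ?D = (2 * pi) ^ ?N"
      by (simp only: sq power_add[symmetric])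
    then have "(2 * pi) ^ ?L * s ^ (?N - ?L) * s ^ (?N - ?U) / (2 * pi) ^ ?N = 1 / s ^ ?D"
      using s(1) by (simp add: eq_divide_eq divide_eq_eq)
    moreover have "z / (2 * pi) ^ ?N = ((2 * pi) ^ ?L * s ^ (?N - ?L) * s ^ (?N - ?U) / (2 * pi) ^ ?N)
        * (I / (amp M ^ ?L * sqrt (det (mode_gram M)) * sqrt (det (C_mat M))))"
      unfolding z_def by (simp only: times_divide_eq_left times_divide_eq_right divide_divide_eq_left mult_ac)
    ultimately show ?thesis by (simp only: times_divide_eq_left times_divide_eq_right divide_divide_eq_left mult_ac mult_1)
  qed
  finally show ?thesis unfolding I_def s_def .
qed

theorem theorem3p1:
  fixes M :: "(int ^ 'n::{finite,linorder}) set" and a b :: real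
  assumes "finite M" and "M \<subseteq> pos_cone" and "symmetric_set M" and "card M > CARD('n)"
    and "a = a_val M" and "b = b_val M"
  shows "(ample (trig_space M) \<longleftrightarrow> a \<noteq> b \<and> a + (real CARD('n) - 1) * b \<noteq> 0) \<and>
    (\<forall>p q. C_mat M $ p $ q =
       2 / (2 * pi) ^ CARD('n) *
         (\<Sum>m\<in>M. of_int (m $ ufst p * m $ usnd p * m $ ufst q * m $ usnd q))) \<and>
    (a_vecs_independent M \<longrightarrow>
       mean_critical M = ennreal (
         1 / ((2 * pi) powr (1 / 2 * real (CARD('n) choose 2))
              * (a - b) powr ((real CARD('n) - 1) / 2)
              * sqrt (a + (real CARD('n) - 1) * b)
              * sqrt (det (C_mat M)))
         * (LINT x|lborel. exp (- (1 / 2) * ((matrix_inv (C_mat M) *v x) \<bullet> x))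
                            * \<bar>det (sym_mat x)\<bar>)))"
proof (intro conjI allI impI)
  note M = assms(1-3) and ab = assms(5,6)
  let ?L = "CARD('n)"
  show "ample (trig_space M) \<longleftrightarrow> a \<noteq> b \<and> a + (real ?L - 1) * b \<noteq> 0"
    unfolding ample_iff_spanning[OF M(1)] spanning_iff(1)[OF M] ab ..
  show "C_mat M $ p $ q = 2 / (2 * pi) ^ CARD('n) *
      (\<Sum>m\<in>M. of_int (m $ ufst p * m $ usnd p * m $ ufst q * m $ usnd q))" for p q
    by (rule C_mat_nth(1)[OF M(1,2)])
  assume ind: "a_vecs_independent M"
  note sp = independent_spans(2)[OF ind]
  note pos = spanning_iff(2,3)[OF M sp, folded ab]
  have sqrt_powr: "x powr (real k / 2) = sqrt x ^ k" if "x > 0" for x :: real and k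
    using that by (simp add: powr_half_sqrt[symmetric] powr_realpow[symmetric] powr_powr)
  have "(2 * pi) powr (1 / 2 * real (?L choose 2)) = sqrt (2 * pi) ^ (?L choose 2)"
    using sqrt_powr[of "2 * pi" "?L choose 2"] by simp
  moreover have "amp M ^ ?L * sqrt (det (mode_gram M))
      = (a - b) powr ((real ?L - 1) / 2) * sqrt (a + (real ?L - 1) * b)"
  proof -
    have "amp M ^ ?L * sqrt (det (mode_gram M)) = sqrt (amp M ^ (2 * ?L) * det (mode_gram M))"
      using amp_pos[of M] by (simp add: real_sqrt_mult power_even_abs real_sqrt_power power_mult real_sqrt_unique)
    also have "\<dots> = sqrt (a - b) ^ (?L - 1) * sqrt (a + (real ?L - 1) * b)"
      unfolding det_mode_gram[OF M sp] ab by (simp add: real_sqrt_mult real_sqrt_power)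
    also have "sqrt (a - b) ^ (?L - 1) = (a - b) powr ((real ?L - 1) / 2)"
      using sqrt_powr[OF pos(1), of "?L - 1"] by (simp add: of_nat_diff)
    finally show ?thesis .
  qed
  ultimately show "mean_critical M = ennreal (
         1 / ((2 * pi) powr (1 / 2 * real (CARD('n) choose 2))
              * (a - b) powr ((real CARD('n) - 1) / 2)
              * sqrt (a + (real CARD('n) - 1) * b)
              * sqrt (det (C_mat M)))
         * (LINT x|lborel. exp (- (1 / 2) * ((matrix_inv (C_mat M) *v x) \<bullet> x))
                            * \<bar>det (sym_mat x)\<bar>))"
    unfolding mean_critical_eq[OF M(1,2) ind] by (simp only: mult.assoc)
qed

end
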